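(* Let $n\ge1$ be an integer, $k\ge\frac{n-1}{2n}$ with $2k+\frac2n-2>0$, and $T>0$. Let $u\in C^1([0,T],W^2_{k,n})$ be a solution of $$n|x|^{2-\frac2n}\Delta_k^x u(t,x)-\partial_t u(t,x)=0,\qquad (t,x)\in[0,T]\times\mathbb{R},$$ with initial datum $u_0=u(0,\cdot)\in L^2_{k,n}$, and assume moreover $u_0\in L^1_{k,n}$ and that there are constants $C,\delta>0$ with $$|u(T,x)|\le C\,e^{-n\delta|x|^{2/n}}\qquad\text{for all }x\in\mathbb{R}.$$ If $\delta\ge\frac1{4T}$, then $u=0$ (i.e. $u(t,\cdot)=0$ a.e. for all $t\in[0,T]$).
   Context: Notation: $\alpha=kn-\frac n2$; $j_\beta$ is the normalized Bessel function $j_\beta(z)=\Gamma(\beta+1)\sum_{m\ge0}\frac{(-1)^m}{m!\Gamma(\beta+m+1)}(z/2)^{2m}$; $d\mu_{k,n}(x)=\frac{1}{2\Gamma(kn-\frac n2+1)}(\frac n2)^{kn-\frac n2}|x|^{2k+\frac2n-2}dx$, $L^p_{k,n}=L^p(\mathbb{R},d\mu_{k,n})$. The $(k,\frac2n)$-generalized Fourier transform is $\mathcal{F}_{k,n}f(\lambda)=\int_{\mathbb{R}}f(x)B_{k,n}(x,\lambda)d\mu_{k,n}(x)$ with kernel $B_{k,n}(x,\lambda)=j_\alpha(n|\lambda x|^{1/n})+(-i)^n(\frac n2)^n\frac{\Gamma(\alpha+1)}{\Gamma(\alpha+n+1)}\lambda x\,j_{\alpha+n}(n|\lambda x|^{1/n})$,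 extended to a unitary operator on $L^2_{k,n}$. The one-dimensional Dunkl Laplacian is $\Delta_kf(x)=f''(x)+\frac{2k}{x}f'(x)-k\frac{f(x)-f(-x)}{x^2}$ ($x\neq0$). The Sobolev-type space $W^2_{k,n}$ is the set of $f\in L^2_{k,n}$ with $|x|^{2-\frac2n}\Delta_kf\in L^2_{k,n}$, where on $L^2_{k,n}$ this operator is characterized by $\mathcal{F}_{k,n}\big(|x|^{2-\frac2n}\Delta_k f\big)(\xi)=-|\xi|^{2/n}\mathcal{F}_{k,n}f(\xi)$. *)

theory Defs
  imports "HOL-Analysis.Analysis"
begin

definition alpha_kn :: "real \<Rightarrow> nat \<Rightarrow> real" where
  "alpha_kn k n = k * real n - real n / 2"

definition bessel_j :: "real \<Rightarrow> real \<Rightarrow> real" where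
  "bessel_j \<beta> z = Gamma (\<beta> + 1) *
     (\<Sum>m. (-1) ^ m / (fact m * Gamma (\<beta> + real m + 1)) * (z / 2) ^ (2 * m))"

definition mu_kn :: "real \<Rightarrow> nat \<Rightarrow> real measure" where
  "mu_kn k n = density lborel (\<lambda>x. ennreal
      ((real n / 2) powr (alpha_kn k n) / (2 * Gamma (alpha_kn k n + 1))
        * \<bar>x\<bar> powr (2 * k + 2 / real n - 2)))"

definition memL :: "real \<Rightarrow> nat \<Rightarrow> real \<Rightarrow> (real \<Rightarrow> complex) \<Rightarrow> bool" where
  "memL k n p f \<longleftrightarrow> f \<in> borel_measurable (mu_kn k n)
      \<and> integrable (mu_kn k n) (\<lambda>x. norm (f x) powr p)"

definition L2norm :: "real \<Rightarrow> nat \<Rightarrow> (real \<Rightarrow> complex) \<Rightarrow> real" where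
  "L2norm k n f = sqrt (\<integral>x. (norm (f x))\<^sup>2 \<partial>(mu_kn k n))"

definition kernel_B :: "real \<Rightarrow> nat \<Rightarrow> real \<Rightarrow> real \<Rightarrow> complex" where
  "kernel_B k n x lam =
     complex_of_real (bessel_j (alpha_kn k n) (real n * \<bar>lam * x\<bar> powr (1 / real n)))
     + (- \<i>) ^ n * complex_of_real ((real n / 2) ^ n * Gamma (alpha_kn k n + 1)
         / Gamma (alpha_kn k n + real n + 1) * lam * x
         * bessel_j (alpha_kn k n + real n) (real n * \<bar>lam * x\<bar> powr (1 / real n)))"

definition FT1 :: "real \<Rightarrow> nat \<Rightarrow> (real \<Rightarrow> complex) \<Rightarrow> real \<Rightarrow> complex" where
  "FT1 k n f lam = (\<integral>x. f x * kernel_B k n x lam \<partial>(mu_kn k n))"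

text \<open>Its unitary extension to L^2: g is (a representative of) the L^2 transform
  of f iff g is the L^2-limit of the transforms of the truncations f 1_[-R,R].\<close>
definition FT2 :: "real \<Rightarrow> nat \<Rightarrow> (real \<Rightarrow> complex) \<Rightarrow> (real \<Rightarrow> complex) \<Rightarrow> bool" where
  "FT2 k n f g \<longleftrightarrow> memL k n 2 g \<and>
     ((\<lambda>R. L2norm k n (\<lambda>\<xi>. FT1 k n (\<lambda>x. indicator {-R..R} x * f x) \<xi> - g \<xi>))
        \<longlongrightarrow> 0) at_top"

text \<open>g represents |x|^{2-2/n} Delta_k f on L^2, characterized via the transform.\<close>
definition is_wlap :: "real \<Rightarrow> nat \<Rightarrow> (real \<Rightarrow> complex) \<Rightarrow> (real \<Rightarrow> complex) \<Rightarrow> bool" where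
  "is_wlap k n f g \<longleftrightarrow> memL k n 2 f \<and> memL k n 2 g \<and>
     (\<exists>Ff Fg. FT2 k n f Ff \<and> FT2 k n g Fg \<and>
        (AE \<xi> in mu_kn k n. Fg \<xi> = - complex_of_real (\<bar>\<xi>\<bar> powr (2 / real n)) * Ff \<xi>))"

definition in_W2 :: "real \<Rightarrow> nat \<Rightarrow> (real \<Rightarrow> complex) \<Rightarrow> bool" where
  "in_W2 k n f \<longleftrightarrow> (\<exists>g. is_wlap k n f g)"

definition wlap :: "real \<Rightarrow> nat \<Rightarrow> (real \<Rightarrow> complex) \<Rightarrow> real \<Rightarrow> complex" where
  "wlap k n f = (SOME g. is_wlap k n f g)"

definition W2norm :: "real \<Rightarrow> nat \<Rightarrow> (real \<Rightarrow> complex) \<Rightarrow> real" where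
  "W2norm k n f = L2norm k n f + L2norm k n (wlap k n f)"

definition C1_W2 :: "real \<Rightarrow> nat \<Rightarrow> real \<Rightarrow> (real \<Rightarrow> real \<Rightarrow> complex)
    \<Rightarrow> (real \<Rightarrow> real \<Rightarrow> complex) \<Rightarrow> bool" where
  "C1_W2 k n T u u' \<longleftrightarrow>
     (\<forall>t\<in>{0..T}. in_W2 k n (u t) \<and> in_W2 k n (u' t))
     \<and> (\<forall>t\<in>{0..T}. ((\<lambda>s. W2norm k n (\<lambda>x. (u s x - u t x) / complex_of_real (s - t) - u' t x))
            \<longlongrightarrow> 0) (at t within {0..T}))
     \<and> (\<forall>t\<in>{0..T}. ((\<lambda>s. W2norm k n (\<lambda>x. u' s x - u' t x)) \<longlongrightarrow> 0) (at t within {0..T}))"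

end

theory Submission
  imports Defs "HOL-Complex_Analysis.Complex_Analysis"
begin

text \<open>
  Write \<open>rad x = |x|^(2/n)\<close> and, for \<open>j = 0, 1\<close>, pair a function \<open>f\<close> with the Gaussians
  \<open>x^j * exp (- p * rad x)\<close>. The transform maps \<open>x^j * exp (- s * rad x)\<close> to a multiple of
  \<open>s^-(\<beta> + 1) * x^j * exp (- (n^2 / 4 s) * rad x)\<close> with \<open>\<beta> = \<alpha> + j n\<close>, so after the substitution
  \<open>p = n^2 / 4 s\<close> the operator acts on the pairing as \<open>d/ds\<close> and the heat flow as the translation
  \<open>s \<mapsto> s + n t\<close>. Hence, with \<open>\<rho> = n / 4 T\<close>, the pairing \<open>V q\<close> of the initial datum equals
  \<open>(\<rho> / (\<rho> - q))^(\<beta> + 1)\<close> times the pairing \<open>W (q \<rho> / (\<rho> - q))\<close> of the final datum for \<open>0 < q < \<rho>\<close>.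
  Now \<open>V\<close> is holomorphic for \<open>Re q > 0\<close>, whereas the decay of \<open>u(T)\<close> with \<open>\<delta> \<ge> 1 / 4 T\<close> makes the
  right-hand side holomorphic for \<open>Re q < \<rho>\<close>. So \<open>V\<close> is entire, of polynomial growth, and tends to \<open>0\<close>
  along the positive axis; by Liouville it vanishes. Pairings with Gaussians determine a function.
\<close>

section \<open>Integration preliminaries\<close>

text \<open>Pairings with Gaussians are bounded functionals on L^2. They therefore pass through the
  L^2 limit in \<open>FT2\<close> and through the difference quotients in \<open>C1_W2\<close>, and
  every statement about the transform or the flow becomes one about scalar functions of
  \<open>s\<close>. That Gaussians go to Gaussians is Weber's integral for the Bessel series. The
  kernel is an even plus an odd part, which is why \<open>j = 0\<close> and \<open>j = 1\<close> are
  handled separately. The threshold comes from the map q -> q \<rho> / (\<rho> - q). It carries Re q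
  < \<rho> onto Re p > - \<rho>, which is the half-plane where decay of \<open>u T\<close> at rate
  \<rho> makes \<open>W\<close> converge. A slower rate \<sigma> < \<rho> would give Re p > -
  \<sigma>, whose preimage is a disc, and the plane would not be covered. Equality is allowed
  because \<open>W\<close> blows up at most like a power at the edge Re p = - \<rho>, and the map
  turns this into polynomial growth in q. Decay of \<open>V\<close> along the positive axis is
  Cauchy-Schwarz for the initial datum.\<close>

lemma norm_integral_le:
  fixes f :: "'a \<Rightarrow> 'b::{banach,second_countable_topology}"
  assumes "integrable M f" "integrable M g" "\<And>x. norm (f x) \<le> g x"
  shows "norm (\<integral>x. f x \<partial>M) \<le> (\<integral>x. g x \<partial>M)"
  using assms by (intro order.trans[OF integral_norm_bound] integral_mono) auto

lemma cauchy_schwarz_integral: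
  fixes f g :: "'a \<Rightarrow> 'b::{real_normed_field,banach,second_countable_topology}"
  assumes [measurable]: "f \<in> borel_measurable M" "g \<in> borel_measurable M"
    and f2: "integrable M (\<lambda>x. (norm (f x))\<^sup>2)" and g2: "integrable M (\<lambda>x. (norm (g x))\<^sup>2)"
  shows "integrable M (\<lambda>x. f x * g x)" (is ?int)
    and "norm (\<integral>x. f x * g x \<partial>M)
           \<le> sqrt (\<integral>x. (norm (f x))\<^sup>2 \<partial>M) * sqrt (\<integral>x. (norm (g x))\<^sup>2 \<partial>M)"
proof -
  have *: "integrable M (\<lambda>x. (norm (f x))\<^sup>2 + (norm (g x))\<^sup>2)"
    using f2 g2 by simp
  have b: "norm (f x * g x) \<le> (norm (f x))\<^sup>2 + (norm (g x))\<^sup>2" for x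
  proof -
    have "0 \<le> norm (f x) * norm (g x)" by simp
    with sum_squares_bound[of "norm (f x)" "norm (g x)"] show ?thesis
      unfolding norm_mult mult.assoc by linarith
  qed
  show int: ?int
    by (rule Bochner_Integration.integrable_bound[OF *]) (use b in \<open>auto intro!: AE_I2 simp: abs_of_nonneg\<close>)
  have "(\<integral>\<^sup>+x. ennreal (norm (f x)) * ennreal (norm (g x)) \<partial>M)\<^sup>2
      \<le> (\<integral>\<^sup>+x. ennreal (norm (f x)) ^ 2 \<partial>M) * (\<integral>\<^sup>+x. ennreal (norm (g x)) ^ 2 \<partial>M)"
    by (rule Cauchy_Schwarz_nn_integral) auto
  also have "(\<integral>\<^sup>+x. ennreal (norm (f x)) * ennreal (norm (g x)) \<partial>M) = ennreal (\<integral>x. norm (f x * g x) \<partial>M)"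
    using integrable_norm[OF int] by (subst nn_integral_eq_integral[symmetric]) (auto simp: norm_mult ennreal_mult)
  also have "(\<integral>\<^sup>+x. ennreal (norm (f x)) ^ 2 \<partial>M) = ennreal (\<integral>x. (norm (f x))\<^sup>2 \<partial>M)"
    using f2 by (subst nn_integral_eq_integral[symmetric]) (auto simp: ennreal_power)
  also have "(\<integral>\<^sup>+x. ennreal (norm (g x)) ^ 2 \<partial>M) = ennreal (\<integral>x. (norm (g x))\<^sup>2 \<partial>M)"
    using g2 by (subst nn_integral_eq_integral[symmetric]) (auto simp: ennreal_power)
  finally have "(\<integral>x. norm (f x * g x) \<partial>M)\<^sup>2
      \<le> (\<integral>x. (norm (f x))\<^sup>2 \<partial>M) * (\<integral>x. (norm (g x))\<^sup>2 \<partial>M)"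
    by (simp add: ennreal_power flip: ennreal_mult)
  then have "(\<integral>x. norm (f x * g x) \<partial>M)
      \<le> sqrt (\<integral>x. (norm (f x))\<^sup>2 \<partial>M) * sqrt (\<integral>x. (norm (g x))\<^sup>2 \<partial>M)"
    by (simp add: real_le_rsqrt flip: real_sqrt_mult)
  with integral_norm_bound[of M "\<lambda>x. f x * g x"]
  show "norm (\<integral>x. f x * g x \<partial>M)
           \<le> sqrt (\<integral>x. (norm (f x))\<^sup>2 \<partial>M) * sqrt (\<integral>x. (norm (g x))\<^sup>2 \<partial>M)"
    by linarith
qed

text \<open>The positive and the negative part of \<open>h\<close> are densities of two measures
  that are finite and equal on all rays, hence equal; equal measures have almost everywhere equal
  densities.\<close>

lemma AE_eq_zero_if_tail_integrals_zero:
  fixes h :: "real \<Rightarrow> real"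
  assumes h: "integrable lborel h"
    and tail: "\<And>a. (\<integral>x. indicator {a<..} x * h x \<partial>lborel) = 0"
  shows "AE x in lborel. h x = 0"
proof -
  have [measurable]: "h \<in> borel_measurable lborel"
    using h by auto
  have fin: "integrable lborel (\<lambda>x. indicator {a<..} x * max 0 (c * h x))" for a c :: real
    using h by (intro Bochner_Integration.integrable_bound[OF integrable_mult_right[OF h, of c]])
      (auto split: split_indicator)
  define D where "D = (\<lambda>c. density lborel (\<lambda>x. ennreal (max 0 (c * h x))))"
  have em: "emeasure (D c) {a<..}
      = ennreal (\<integral>x. indicator {a<..} x * max 0 (c * h x) \<partial>lborel)" for a c
    using fin[of a c]
    by (subst nn_integral_eq_integral[symmetric])
       (auto simp: D_def emeasure_density indicator_def intro!: nn_integral_cong)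
  have "(\<integral>x. indicator {a<..} x * max 0 (1 * h x) \<partial>lborel) - (\<integral>x. indicator {a<..} x * max 0 (-1 * h x) \<partial>lborel)
     = (\<integral>x. indicator {a<..} x * h x \<partial>lborel)" for a
    by (subst Bochner_Integration.integral_diff[symmetric, OF fin fin])
       (auto intro!: Bochner_Integration.integral_cong split: split_indicator)
  then have "D 1 = D (-1)"
    using tail by (intro measure_eqI_lessThan) (simp_all add: em, simp_all add: D_def)
  then have "AE x in lborel. ennreal (max 0 (1 * h x)) = ennreal (max 0 (-1 * h x))"
    unfolding D_def by (subst (asm) sigma_finite_measure.density_unique_iff[OF sigma_finite_lborel]) auto
  then show ?thesis
    by eventually_elim (auto simp: max_def split: if_splits)
qed

text \<open>The substitution \<open>t = p * x powr d\<close> turns Euler's integral for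
  \<open>Gamma ((c + 1) / d)\<close> into the integral over the positive axis, and evenness doubles
  it.\<close>

lemma gauss_type_integral:
  fixes c d p :: real
  assumes c: "c > -1" and d: "d > 0" and p: "p > 0"
  shows "has_bochner_integral lborel (\<lambda>x. \<bar>x\<bar> powr c * exp (- p * \<bar>x\<bar> powr d))
           (2 / d * Gamma ((c + 1) / d) * p powr (- ((c + 1) / d)))"
proof -
  define g where "g = (c + 1) / d"
  have g0: "g > 0" using c d by (simp add: g_def)
  have "((\<lambda>t. t powr (g - 1) / exp t) has_integral Gamma g) {0<..}"
    using Gamma_integral_real[OF g0]
    by (subst has_integral_spike_set_eq[where T="{0..}"]) (auto intro: negligible_subset[of "{0}"])
  moreover from this have "(\<lambda>t. t powr (g - 1) / exp t) absolutely_integrable_on {0<..}"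
    by (intro nonnegative_absolutely_integrable_1) (auto simp: integrable_on_def)
  ultimately have *: "(\<lambda>t. t powr (g - 1) / exp t) absolutely_integrable_on {0<..}
      \<and> integral {0<..} (\<lambda>t. t powr (g - 1) / exp t) = Gamma g"
    by (auto simp: integral_unique)
  let ?s = "\<lambda>x::real. p * x powr d"
  have img: "?s ` {0<..} = {0<..}"
  proof (intro equalityI subsetI)
    fix y :: real assume y: "y \<in> {0<..}"
    then have "y = ?s ((y / p) powr (1 / d))"
      using p d by (simp add: powr_powr)
    moreover have "(y / p) powr (1 / d) \<in> {0<..}" using y p by simp
    ultimately show "y \<in> ?s ` {0<..}" by blast
  qed (use p in auto)
  have inj: "inj_on ?s {0<..}"
  proof (rule inj_onI)
    fix x y :: real assume "x \<in> {0<..}" "y \<in> {0<..}" "?s x = ?s y"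
    then show "x = y" using p d powr_less_mono2[of d x y] powr_less_mono2[of d y x] by (cases x y rule: linorder_cases) auto
  qed
  have cv: "(\<lambda>x. \<bar>p * (d * x powr (d - 1))\<bar> * (?s x powr (g - 1) / exp (?s x))) absolutely_integrable_on {0<..}
      \<and> integral {0<..} (\<lambda>x. \<bar>p * (d * x powr (d - 1))\<bar> * (?s x powr (g - 1) / exp (?s x))) = Gamma g"
    by (subst has_absolute_integral_change_of_variables_1'[where g = ?s])
       (use * img inj in \<open>auto intro!: derivative_eq_intros\<close>)
  have eq: "\<bar>p * (d * x powr (d - 1))\<bar> * (?s x powr (g - 1) / exp (?s x))
       = (d * p powr g) * (x powr c * exp (- p * x powr d))" if "x \<in> {0<..}" for x
  proof -
    have "d * g = c + 1" using d by (simp add: g_def)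
    then have "x powr (d - 1) * (x powr d) powr (g - 1) = x powr c"
      by (simp add: powr_powr powr_add[symmetric] algebra_simps)
    moreover have "p * p powr (g - 1) = p powr g"
      using p by (simp add: powr_mult_base)
    ultimately show ?thesis using that p d
      by (simp add: powr_mult abs_mult exp_minus field_simps)
  qed
  have 1: "(\<lambda>x. (d * p powr g) * (x powr c * exp (- p * x powr d))) absolutely_integrable_on {0<..}"
    using cv by (subst set_integrable_cong[OF refl refl eq[symmetric]]) auto
  then have 2: "(\<lambda>x. x powr c * exp (- p * x powr d)) absolutely_integrable_on {0<..}"
    using set_integrable_mult_right_iff[of "d * p powr g"] d p by simp
  have 3: "(d * p powr g) * integral {0<..} (\<lambda>x. x powr c * exp (- p * x powr d)) = Gamma g"
    using cv by (subst integral_mult_right[symmetric], subst integral_cong[OF eq[symmetric]]) auto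
  have int: "set_integrable lborel {0<..} (\<lambda>x. x powr c * exp (- p * x powr d))"
    using 2 unfolding set_integrable_def by (subst (asm) integrable_completion) auto
  have "set_lebesgue_integral lborel {0<..} (\<lambda>x. x powr c * exp (- p * x powr d)) = Gamma g / (d * p powr g)"
    using 3 d p set_borel_integral_eq_integral(2)[OF int] by (simp add: field_simps)
  then have "has_bochner_integral lborel (\<lambda>x. indicator {0<..} x *\<^sub>R (x powr c * exp (- p * x powr d))) (Gamma g / (d * p powr g))"
    using int by (simp add: has_bochner_integral_iff set_integrable_def set_lebesgue_integral_def)
  \<comment> \<open>The rule for even functions expects the closed half-line. The added point
    contributes the value 0 for every \<open>c\<close>, since \<open>0 powr c = 0\<close>.\<close>
  then have "has_bochner_integral lborel (\<lambda>x. indicator {0..} x *\<^sub>R (\<bar>x\<bar> powr c * exp (- p * \<bar>x\<bar> powr d))) (Gamma g / (d * p powr g))"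
    by (rule has_bochner_integral_cong[THEN iffD1, rotated -1])
       (auto split: split_indicator)
  from has_bochner_integral_even_function[OF this]
  show ?thesis by (simp add: g_def powr_minus field_simps)
qed

section \<open>Gaussian moments and pairings\<close>

text \<open>Differentiation under the integral by the second-order Taylor remainder of
  \<open>exp\<close>: its quadratic factor is absorbed by a slightly smaller exponent, which is
  still above the abscissa \<open>c0\<close>.\<close>

lemma laplace_has_field_derivative:
  fixes g :: "'a \<Rightarrow> complex" and \<phi> :: "'a \<Rightarrow> real"
  assumes [measurable]: "g \<in> borel_measurable M" "\<phi> \<in> borel_measurable M"
    and \<phi>: "\<And>x. \<phi> x \<ge> 0"
    and int: "\<And>c. c > c0 \<Longrightarrow> integrable M (\<lambda>x. norm (g x) * exp (- c * \<phi> x))"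
    and p: "Re p > c0"
  shows "((\<lambda>p. \<integral>x. g x * exp (- p * complex_of_real (\<phi> x)) \<partial>M) has_field_derivative
           (\<integral>x. - complex_of_real (\<phi> x) * g x * exp (- p * complex_of_real (\<phi> x)) \<partial>M)) (at p)"
proof -
  \<comment> \<open>A quarter of the margin, so that \<open>Re p - 2 * e\<close> still exceeds
    \<open>c0\<close>. One \<open>e\<close> pays for \<open>exp (norm h * \<phi> x)\<close>, the
    other for the factor \<open>(\<phi> x)\<^sup>2\<close>.\<close>
  define e where "e = (Re p - c0) / 4"
  have e: "e > 0" using p by (simp add: e_def)
  define c where "c = Re p - 2 * e"
  have c: "c > c0" using p by (simp add: c_def e_def field_simps)
  have i0: "integrable M (\<lambda>x. g x * exp (- q * complex_of_real (\<phi> x)))" if "Re q > c0" for q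
    by (rule Bochner_Integration.integrable_bound[OF int[OF that]])
       (auto simp: norm_mult)
  have sq: "y\<^sup>2 \<le> 2 / e\<^sup>2 * exp (e * y)" if "y \<ge> 0" for y
    using exp_lower_Taylor_quadratic[of "e * y"] that e
    by (simp add: power_mult_distrib field_simps) (smt (verit) mult_nonneg_nonneg zero_le_power2)
  have ln: "y \<le> 1 / e * exp (e * y)" for y
  proof -
    have "e * y \<le> exp (e * y)" using exp_ge_add_one_self[of "e * y"] by linarith
    then show ?thesis using e by (simp add: field_simps)
  qed
  have i1: "integrable M (\<lambda>x. - complex_of_real (\<phi> x) * g x * exp (- p * complex_of_real (\<phi> x)))"
  proof (rule Bochner_Integration.integrable_bound[OF integrable_mult_right[OF int[OF c], of "1 / e"]], measurable, rule AE_I2)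
    fix x
    have "norm (- complex_of_real (\<phi> x) * g x * exp (- p * complex_of_real (\<phi> x)))
        = \<phi> x * (norm (g x) * exp (- Re p * \<phi> x))"
      using \<phi>[of x] by (simp add: norm_mult)
    also have "\<dots> \<le> (1 / e * exp (e * \<phi> x)) * (norm (g x) * exp (- Re p * \<phi> x))"
      by (intro mult_right_mono ln) auto
    also have "\<dots> = 1 / e * (norm (g x) * exp (- (c + e) * \<phi> x))"
      by (simp add: c_def exp_add[symmetric] algebra_simps)
    also have "\<dots> \<le> 1 / e * (norm (g x) * exp (- c * \<phi> x))"
      using e \<phi>[of x] by (intro mult_left_mono) (auto simp: algebra_simps)
    finally show "norm (- complex_of_real (\<phi> x) * g x * exp (- p * complex_of_real (\<phi> x)))
        \<le> norm (1 / e * (norm (g x) * exp (- c * \<phi> x)))" using e by simp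
  qed
  define W where "W = (\<lambda>p. \<integral>x. g x * exp (- p * complex_of_real (\<phi> x)) \<partial>M)"
  define D where "D = (\<integral>x. - complex_of_real (\<phi> x) * g x * exp (- p * complex_of_real (\<phi> x)) \<partial>M)"
  define K where "K = (\<integral>x. 2 / e\<^sup>2 * (norm (g x) * exp (- c * \<phi> x)) \<partial>M)"
  have main: "norm (W (p + h) - W p - h * D) \<le> (norm h)\<^sup>2 * K" if h: "norm h < e" for h
  proof -
    have ph: "Re (p + h) > c0" using abs_Re_le_cmod[of h] h p by (simp add: e_def)
    have "W (p + h) - W p - h * D = (\<integral>x. g x * exp (- (p + h) * complex_of_real (\<phi> x))
        - g x * exp (- p * complex_of_real (\<phi> x))
        - h * (- complex_of_real (\<phi> x) * g x * exp (- p * complex_of_real (\<phi> x))) \<partial>M)"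
      unfolding W_def D_def using i0[OF ph] i0[OF p] i1
      by (subst Bochner_Integration.integral_diff) (auto intro!: Bochner_Integration.integrable_diff integrable_mult_right)
    also have "norm \<dots> \<le> (\<integral>x. (norm h)\<^sup>2 * (2 / e\<^sup>2 * (norm (g x) * exp (- c * \<phi> x))) \<partial>M)"
    proof (rule norm_integral_le)
      show "integrable M (\<lambda>x. (norm h)\<^sup>2 * (2 / e\<^sup>2 * (norm (g x) * exp (- c * \<phi> x))))"
        by (intro integrable_mult_right int c)
      fix x
      let ?z = "- h * complex_of_real (\<phi> x)"
      have "norm (exp ?z - (\<Sum>i\<le>1. ?z ^ i / fact i)) \<le> exp (norm ?z) * norm ?z ^ Suc 1 / fact 1"
        by (rule Taylor_exp_field)
      then have T: "norm (exp ?z - 1 - ?z) \<le> exp (norm h * \<phi> x) * (norm h * \<phi> x)\<^sup>2"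
        using \<phi>[of x] by (simp add: norm_mult algebra_simps power2_eq_square)
      have "norm (g x * exp (- (p + h) * complex_of_real (\<phi> x)) - g x * exp (- p * complex_of_real (\<phi> x))
          - h * (- complex_of_real (\<phi> x) * g x * exp (- p * complex_of_real (\<phi> x))))
        = norm (g x * exp (- p * complex_of_real (\<phi> x)) * (exp ?z - 1 - ?z))"
        by (simp add: algebra_simps exp_add exp_diff exp_minus divide_inverse)
      also have "\<dots> = norm (g x) * exp (- Re p * \<phi> x) * norm (exp ?z - 1 - ?z)"
        by (simp add: norm_mult)
      also have "\<dots> \<le> norm (g x) * exp (- Re p * \<phi> x) * (exp (norm h * \<phi> x) * (norm h * \<phi> x)\<^sup>2)"
        by (intro mult_left_mono T) auto
      also have "\<dots> \<le> norm (g x) * exp (- Re p * \<phi> x) * (exp (e * \<phi> x) * ((norm h)\<^sup>2 * (2 / e\<^sup>2 * exp (e * \<phi> x))))"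
        unfolding power_mult_distrib using h \<phi>[of x]
        by (intro mult_left_mono mult_mono sq) (auto intro!: mult_right_mono)
      also have "\<dots> = (norm h)\<^sup>2 * (2 / e\<^sup>2 * (norm (g x) * (exp (- Re p * \<phi> x) * exp (e * \<phi> x) * exp (e * \<phi> x))))"
        by simp
      also have "exp (- Re p * \<phi> x) * exp (e * \<phi> x) * exp (e * \<phi> x) = exp (- c * \<phi> x)"
        by (simp add: exp_add[symmetric] c_def algebra_simps)
      finally show "norm (g x * exp (- (p + h) * complex_of_real (\<phi> x)) - g x * exp (- p * complex_of_real (\<phi> x))
          - h * (- complex_of_real (\<phi> x) * g x * exp (- p * complex_of_real (\<phi> x))))
        \<le> (norm h)\<^sup>2 * (2 / e\<^sup>2 * (norm (g x) * exp (- c * \<phi> x)))" .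
    qed (use i0[OF ph] i0[OF p] i1 in \<open>auto intro!: Bochner_Integration.integrable_diff integrable_mult_right\<close>)
    finally show ?thesis by (simp add: K_def)
  qed
  have "((\<lambda>h. (W (p + h) - W p) / h - D) \<longlongrightarrow> 0) (at 0)"
  proof (rule Lim_null_comparison)
    show "((\<lambda>h. norm h * K) \<longlongrightarrow> 0) (at (0::complex))"
      by (auto intro!: tendsto_eq_intros)
    have "norm ((W (p + h) - W p) / h - D) \<le> norm h * K" if "h \<noteq> 0" "norm h < e" for h
    proof -
      have "(W (p + h) - W p) / h - D = (W (p + h) - W p - h * D) / h"
        using that by (simp add: field_simps)
      then show ?thesis
        using main[OF that(2)] that by (simp add: norm_divide field_simps power2_eq_square)
    qed
    then show "\<forall>\<^sub>F h in at 0. norm ((W (p + h) - W p) / h - D) \<le> norm h * K"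
      using e by (auto simp: eventually_at dist_norm)
  qed
  then show ?thesis
    unfolding DERIV_def W_def[symmetric] D_def[symmetric] by (simp add: LIM_zero_iff)
qed

lemma memL_2_iff:
  "memL k n 2 f \<longleftrightarrow> f \<in> borel_measurable (mu_kn k n) \<and> integrable (mu_kn k n) (\<lambda>x. (norm (f x))\<^sup>2)"
proof -
  have "norm (f x) powr 2 = (norm (f x))\<^sup>2" for x
    by (cases "f x = 0") auto
  then show ?thesis by (simp add: memL_def)
qed

lemma L2norm_nonneg: "L2norm k n f \<ge> 0"
  by (simp add: L2norm_def)

locale kn_params =
  fixes k :: real and n :: nat
  assumes n_ge_1: "n \<ge> 1" and exponent_pos: "2 * k + 2 / real n - 2 > 0"
begin

abbreviation \<mu> where "\<mu> \<equiv> mu_kn k n"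
abbreviation \<alpha> where "\<alpha> \<equiv> alpha_kn k n"

definition rad :: "real \<Rightarrow> real" where "rad x = \<bar>x\<bar> powr (2 / real n)"
text \<open>\<open>\<beta> j\<close> is the Bessel index of the kernel component of degree
  \<open>j\<close>, and it also governs the moments of \<open>x ^ (2 * j)\<close>. The constant
  \<open>\<kappa>\<close> normalizes the image of the measure under \<open>rad\<close>, which has
  density \<open>\<kappa> * r powr \<alpha>\<close> on \<open>r > 0\<close>.\<close>

definition \<beta> :: "nat \<Rightarrow> real" where "\<beta> j = \<alpha> + real j * real n"
definition \<kappa> :: real where "\<kappa> = (real n / 2) powr (\<alpha> + 1) / Gamma (\<alpha> + 1)"

lemma n_pos: "real n > 0"
  using n_ge_1 by simp

text \<open>Positivity of the exponent says k n > n - 1, hence \<alpha> > n/2 - 1. The value -1/2 is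
  the index whose normalized Bessel function is the cosine, the comparison case for all series
  estimates.\<close>

lemma alpha_gt: "\<alpha> > - 1 / 2"
proof -
  have "k * real n > real n - 1"
    using exponent_pos n_pos by (simp add: field_simps)
  then show ?thesis
    using n_ge_1 by (simp add: alpha_kn_def)
qed

lemma beta_gt: "\<beta> j > - 1 / 2"
  using alpha_gt by (simp add: \<beta>_def add_pos_nonneg) (smt (verit) mult_nonneg_nonneg of_nat_0_le_iff)

lemma Gamma_beta_pos: "Gamma (\<beta> j + 1) > 0" 
  using beta_gt[of j] by (intro Gamma_real_pos) simp

lemma Gamma_alpha_pos: "Gamma (\<alpha> + 1) > 0" 
  using alpha_gt by (intro Gamma_real_pos) simp

lemma kappa_pos: "\<kappa> > 0"
  using Gamma_alpha_pos n_pos by (simp add: \<kappa>_def)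

lemma sets_mu [simp, measurable_cong]: "sets \<mu> = sets borel"
  by (simp add: mu_kn_def)

lemma space_mu [simp]: "space \<mu> = UNIV"
  by (simp add: mu_kn_def)

lemma borel_measurable_mu [simp]: "borel_measurable \<mu> = borel_measurable borel"
  by (rule measurable_cong_sets) auto

lemma rad_measurable [measurable]: "rad \<in> borel_measurable borel"
  unfolding rad_def by measurable

lemma rad_nonneg [simp]: "rad x \<ge> 0"
  by (simp add: rad_def)

lemma rad_minus [simp]: "rad (- x) = rad x"
  by (simp add: rad_def)

text \<open>The density vanishes at the origin alone, so the measure has the null sets of Lebesgue
  measure.\<close>

lemma AE_mu_iff: 
  assumes [measurable]: "Measurable.pred borel P"
  shows "(AE x in \<mu>. P x) \<longleftrightarrow> (AE x in lborel. P x)"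
proof -
  have "AE x in lborel. x \<noteq> (0::real)"
    by (rule AE_lborel_singleton)
  then have "(AE x in \<mu>. P x) \<longleftrightarrow> (AE x in lborel. x \<noteq> 0 \<longrightarrow> P x)"
    unfolding mu_kn_def using n_pos Gamma_alpha_pos 
    by (subst AE_density) (auto simp: zero_less_mult_iff zero_less_divide_iff)
  also have "\<dots> \<longleftrightarrow> (AE x in lborel. P x)"
    using \<open>AE x in lborel. x \<noteq> (0::real)\<close> by auto
  finally show ?thesis .
qed

lemma AE_mu_nonzero: "AE x in \<mu>. x \<noteq> 0"
  by (subst AE_mu_iff) (auto intro: AE_lborel_singleton)

lemma powr_moment:
  assumes p: "p > 0" and b: "b \<ge> 0"
  shows "has_bochner_integral \<mu> (\<lambda>x. \<bar>x\<bar> powr b * exp (- p * rad x))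
    (\<kappa> * Gamma (\<alpha> + 1 + b * real n / 2) * p powr - (\<alpha> + 1 + b * real n / 2))"
proof -
  define C where "C = (real n / 2) powr \<alpha> / (2 * Gamma (\<alpha> + 1))"
  define a where "a = 2 * k + 2 / real n - 2"
  have C: "C > 0" using n_pos Gamma_alpha_pos by (simp add: C_def)
  have e: "(a + b + 1) / (2 / real n) = \<alpha> + 1 + b * real n / 2"
    using n_pos by (simp add: a_def alpha_kn_def field_simps)
  have "has_bochner_integral lborel (\<lambda>x. \<bar>x\<bar> powr (a + b) * exp (- p * \<bar>x\<bar> powr (2 / real n)))
           (2 / (2 / real n) * Gamma ((a + b + 1) / (2 / real n)) * p powr (- ((a + b + 1) / (2 / real n))))"
    by (rule gauss_type_integral) (use p b exponent_pos n_pos in \<open>auto simp: a_def\<close>)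
  then have "has_bochner_integral lborel (\<lambda>x. C * (\<bar>x\<bar> powr (a + b) * exp (- p * rad x)))
           (C * (real n * Gamma (\<alpha> + 1 + b * real n / 2) * p powr (- (\<alpha> + 1 + b * real n / 2))))"
    unfolding e by (intro has_bochner_integral_mult_right) (simp add: rad_def)
  also have "(\<lambda>x. C * (\<bar>x\<bar> powr (a + b) * exp (- p * rad x))) = (\<lambda>x. (C * \<bar>x\<bar> powr a) *\<^sub>R (\<bar>x\<bar> powr b * exp (- p * rad x)))"
    by (simp add: powr_add fun_eq_iff)
  also have "C * (real n * Gamma (\<alpha> + 1 + b * real n / 2) * p powr (- (\<alpha> + 1 + b * real n / 2)))
     = \<kappa> * Gamma (\<alpha> + 1 + b * real n / 2) * p powr - (\<alpha> + 1 + b * real n / 2)"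
    using n_pos by (simp add: C_def \<kappa>_def powr_add)
  finally show ?thesis
    unfolding mu_kn_def C_def[symmetric] a_def[symmetric]
    using C by (intro has_bochner_integral_density) (auto intro!: AE_I2 mult_nonneg_nonneg)
qed

lemma power_moment:
  assumes p: "p > 0"
  shows "has_bochner_integral \<mu> (\<lambda>x. \<bar>x\<bar> ^ i * rad x ^ m * exp (- p * rad x))
    (\<kappa> * Gamma (\<alpha> + 1 + real i * real n / 2 + real m) * p powr - (\<alpha> + 1 + real i * real n / 2 + real m))"
proof -
  define b where "b = real i + 2 * real m / real n"
  have b: "b \<ge> 0" "b * real n / 2 = real i * real n / 2 + real m"
    using n_pos by (simp_all add: b_def field_simps)
  \<comment> \<open>Almost everywhere, because at \<open>x = 0\<close> with \<open>i = m = 0\<close>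
    the left side is 0 (\<open>0 powr 0 = 0\<close>) while the right side is 1.\<close>
  have "AE x in \<mu>. \<bar>x\<bar> powr b * exp (- p * rad x) = \<bar>x\<bar> ^ i * rad x ^ m * exp (- p * rad x)"
    using AE_mu_nonzero
  proof eventually_elim
    case (elim x)
    then have "\<bar>x\<bar> powr b = \<bar>x\<bar> ^ i * rad x ^ m"
      by (simp add: b_def powr_add rad_def powr_realpow[symmetric] powr_powr)
    then show ?case by simp
  qed
  then show ?thesis
    using powr_moment[OF p b(1)] unfolding b
    by (subst has_bochner_integral_cong_AE[symmetric]) (auto simp: algebra_simps)
qed

lemma beta_moment:
  assumes p: "p > 0"
  shows "has_bochner_integral \<mu> (\<lambda>x. x ^ (2 * j) * rad x ^ m * exp (- p * rad x))
    (\<kappa> * Gamma (\<beta> j + 1 + real m) * p powr - (\<beta> j + 1 + real m))"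
  using power_moment[OF p, of "2 * j" m] by (simp add: \<beta>_def power_even_abs algebra_simps)

text \<open>The parameter \<open>j\<close> takes the values \<open>0\<close> and \<open>1\<close>, for the even and the odd part of \<open>f\<close>.\<close>

definition gauss_pair :: "nat \<Rightarrow> (real \<Rightarrow> complex) \<Rightarrow> complex \<Rightarrow> complex" where
  "gauss_pair j f p = (\<integral>x. f x * (of_real (x ^ j) * exp (- p * of_real (rad x))) \<partial>\<mu>)"

lemma gauss_sq:
  assumes "Re p > 0"
  shows "integrable \<mu> (\<lambda>x. (norm (of_real (x ^ j) * exp (- p * complex_of_real (rad x))))\<^sup>2)"
    and "(\<integral>x. (norm (of_real (x ^ j) * exp (- p * complex_of_real (rad x))))\<^sup>2 \<partial>\<mu>)
      = \<kappa> * Gamma (\<beta> j + 1) * (2 * Re p) powr - (\<beta> j + 1)"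
proof -
  have "(norm (of_real (x ^ j) * exp (- p * complex_of_real (rad x))))\<^sup>2
     = x ^ (2 * j) * rad x ^ 0 * exp (- (2 * Re p) * rad x)" for x
    by (simp add: norm_mult power_mult_distrib exp_double[symmetric] mult_ac power_mult
        flip: of_real_power)
  then show "integrable \<mu> (\<lambda>x. (norm (of_real (x ^ j) * exp (- p * complex_of_real (rad x))))\<^sup>2)"
    and "(\<integral>x. (norm (of_real (x ^ j) * exp (- p * complex_of_real (rad x))))\<^sup>2 \<partial>\<mu>)
      = \<kappa> * Gamma (\<beta> j + 1) * (2 * Re p) powr - (\<beta> j + 1)"
    using beta_moment[of "2 * Re p" j 0] assms by (auto simp: has_bochner_integral_iff)
qed

lemma gauss_pair_integrable:
  assumes f: "memL k n 2 f" and p: "Re p > 0"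
  shows "integrable \<mu> (\<lambda>x. f x * (of_real (x ^ j) * exp (- p * complex_of_real (rad x))))"
  using f by (intro cauchy_schwarz_integral gauss_sq p) (auto simp: memL_2_iff)

lemma gauss_pair_bound:
  assumes f: "memL k n 2 f" and p: "Re p > 0"
  shows "norm (gauss_pair j f p) \<le> L2norm k n f * sqrt (\<kappa> * Gamma (\<beta> j + 1) * (2 * Re p) powr - (\<beta> j + 1))"
  using cauchy_schwarz_integral(2)[of f \<mu> "\<lambda>x. of_real (x ^ j) * exp (- p * complex_of_real (rad x))"]
    f gauss_sq[OF p, of j]
  by (simp add: gauss_pair_def L2norm_def memL_2_iff)

text \<open>The abscissa is left free: it is 0 for a general L^2 function, but negative for the
  rapidly decaying final datum, whose pairing continues to the left of the imaginary axis.\<close>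

lemma gauss_pair_has_derivative_general:
  assumes [measurable]: "f \<in> borel_measurable borel"
    and int: "\<And>c. c > c0 \<Longrightarrow> integrable \<mu> (\<lambda>x. norm (f x * of_real (x ^ j)) * exp (- c * rad x))"
    and p: "Re p > c0"
  shows "(gauss_pair j f has_field_derivative gauss_pair j (\<lambda>x. - of_real (rad x) * f x) p) (at p)"
proof -
  have "((\<lambda>p. \<integral>x. (f x * of_real (x ^ j)) * exp (- p * complex_of_real (rad x)) \<partial>\<mu>) has_field_derivative
           (\<integral>x. - complex_of_real (rad x) * (f x * of_real (x ^ j)) * exp (- p * complex_of_real (rad x)) \<partial>\<mu>)) (at p)"
    by (rule laplace_has_field_derivative[OF _ _ _ int p]) auto
  then show ?thesis
    by (simp add: gauss_pair_def[abs_def] mult.assoc)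
qed

lemma gauss_pair_has_derivative:
  assumes f: "memL k n 2 f" and p: "Re p > 0"
  shows "(gauss_pair j f has_field_derivative gauss_pair j (\<lambda>x. - of_real (rad x) * f x) p) (at p)"
proof (rule gauss_pair_has_derivative_general[OF _ _ p])
  show "f \<in> borel_measurable borel" using f by (simp add: memL_2_iff)
  fix c :: real assume "c > 0"
  then have "integrable \<mu> (\<lambda>x. norm (f x * (of_real (x ^ j) * exp (- of_real c * complex_of_real (rad x)))))"
    by (intro integrable_norm gauss_pair_integrable f) auto
  then show "integrable \<mu> (\<lambda>x. norm (f x * of_real (x ^ j)) * exp (- c * rad x))"
    by (simp add: norm_mult mult.assoc)
qed

end

section \<open>The Bessel kernel\<close>

text \<open>The coefficient is the reciprocal of \<open>pochhammer (b + 1) m\<close> up to factors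
  free of \<open>b\<close>, so it is largest at \<open>b = - 1 / 2\<close>. There
  \<open>fact_double\<close> turns it into that of the cosine, with majorant
  \<open>cosh\<close>.\<close>

lemma bessel_coeff_bound:
  fixes b :: real
  assumes b: "b > - 1 / 2"
  shows "\<bar>(-1) ^ m / (fact m * Gamma (b + real m + 1)) * Gamma (b + 1) * (z / 2) ^ (2 * m)\<bar>
    \<le> z ^ (2 * m) / fact (2 * m)"
proof -
  have G: "Gamma (b + 1) > 0" "Gamma (b + real m + 1) > 0"
    using b by (auto intro!: Gamma_real_pos)
  have nz: "b + 1 \<notin> \<int>\<^sub>\<le>\<^sub>0"
    using b nonpos_Ints_nonpos by fastforce
  have "pochhammer (1 / 2) m \<le> pochhammer (b + 1) m"
    unfolding pochhammer_prod using b by (intro prod_mono) auto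
  also have "\<dots> = Gamma (b + real m + 1) / Gamma (b + 1)"
    using pochhammer_Gamma[OF nz, of m] by (simp add: add_ac)
  finally have "fact (2 * m) \<le> 2 ^ (2 * m) * (Gamma (b + real m + 1) / Gamma (b + 1)) * fact m"
    unfolding fact_double by (intro mult_right_mono mult_left_mono) auto
  then have "z ^ (2 * m) * fact (2 * m) \<le> z ^ (2 * m) * (2 ^ (2 * m) * (Gamma (b + real m + 1) / Gamma (b + 1)) * fact m)"
    by (rule mult_left_mono) auto
  then show ?thesis
    using G by (simp add: abs_mult power_abs power_divide power_even_abs field_simps)
qed

lemma even_exp_sums_cosh: "(\<lambda>m. z ^ (2 * m) / fact (2 * m)) sums cosh (z :: real)"
proof -
  have "(\<lambda>n. if even n then z ^ n /\<^sub>R fact n else 0) sums cosh z"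
    by (rule cosh_converges)
  then have "(\<lambda>m. if even (2 * m) then z ^ (2 * m) /\<^sub>R fact (2 * m) else 0) sums cosh z"
    by (subst sums_mono_reindex[of "\<lambda>m. 2 * m" "\<lambda>n. if even n then z ^ n /\<^sub>R fact n else 0"])
       (auto simp: strict_mono_def elim!: evenE)
  then show ?thesis by (simp add: divide_inverse mult.commute)
qed

lemma bessel_j_abs_summable:
  fixes b :: real
  assumes b: "b > - 1 / 2"
  shows "summable (\<lambda>m. \<bar>(-1) ^ m / (fact m * Gamma (b + real m + 1)) * Gamma (b + 1) * (z / 2) ^ (2 * m)\<bar>)"
  by (rule summable_comparison_test'[OF sums_summable[OF even_exp_sums_cosh[of z]]])
     (use bessel_coeff_bound[OF b] in simp)

lemma bessel_j_sums:
  fixes b :: real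
  assumes b: "b > - 1 / 2"
  shows "(\<lambda>m. (-1) ^ m / (fact m * Gamma (b + real m + 1)) * Gamma (b + 1) * (z / 2) ^ (2 * m)) sums bessel_j b z"
proof -
  have G: "Gamma (b + 1) > 0"
    using b by (intro Gamma_real_pos) auto
  have s: "summable (\<lambda>m. (-1) ^ m / (fact m * Gamma (b + real m + 1)) * Gamma (b + 1) * (z / 2) ^ (2 * m))"
    by (rule summable_rabs_cancel[OF bessel_j_abs_summable[OF b]])
  have eq: "(-1) ^ m / (fact m * Gamma (b + real m + 1)) * Gamma (b + 1) * (z / 2) ^ (2 * m)
     = Gamma (b + 1) * ((-1) ^ m / (fact m * Gamma (b + real m + 1)) * (z / 2) ^ (2 * m))" for m
    by simp
  have "summable (\<lambda>m. (-1) ^ m / (fact m * Gamma (b + real m + 1)) * (z / 2) ^ (2 * m))"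
    using s G unfolding eq by (subst (asm) summable_cmult_iff) auto
  then show ?thesis
    unfolding bessel_j_def eq by (intro sums_mult summable_sums)
qed

lemma bessel_j_bound:
  assumes b: "b > - 1 / 2" and z: "z \<ge> 0"
  shows "\<bar>bessel_j b z\<bar> \<le> exp z"
proof -
  have "\<bar>bessel_j b z\<bar> \<le> (\<Sum>m. z ^ (2 * m) / fact (2 * m))"
    unfolding sums_unique[OF bessel_j_sums[OF b]]
    by (rule order.trans[OF summable_rabs[OF bessel_j_abs_summable[OF b]]
        suminf_le[OF bessel_coeff_bound[OF b] bessel_j_abs_summable[OF b] sums_summable[OF even_exp_sums_cosh[of z]]]])
  also have "\<dots> = cosh z"
    by (rule sums_unique[symmetric, OF even_exp_sums_cosh])
  also have "\<dots> \<le> exp z"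
    using z by (simp add: cosh_def)
  finally show ?thesis .
qed

lemma bessel_j_measurable [measurable]: "bessel_j b \<in> borel_measurable borel"
  unfolding bessel_j_def[abs_def] by measurable

text \<open>In the variable \<open>(z / 2)\<^sup>2\<close> the function is a power series. It
  converges at every \<open>y\<close> by absolute convergence of the Bessel series at
  \<open>2 * sqrt \<bar>y\<bar>\<close>.\<close>

lemma isCont_bessel_j:
  assumes b: "b > - 1 / 2"
  shows "isCont (bessel_j b) z"
proof -
  define c where "c m = (-1) ^ m / (fact m * Gamma (b + real m + 1)) * Gamma (b + 1)" for m
  have "summable (\<lambda>m. c m * y ^ m)" for y
  proof (rule summable_rabs_cancel, rule summable_comparison_test'[OF bessel_j_abs_summable[OF b, of "2 * sqrt \<bar>y\<bar>"]])
    show "norm \<bar>c m * y ^ m\<bar> \<le> \<bar>(-1) ^ m / (fact m * Gamma (b + real m + 1)) * Gamma (b + 1) * (2 * sqrt \<bar>y\<bar> / 2) ^ (2 * m)\<bar>" for m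
      by (simp add: c_def abs_mult power_mult power_abs)
  qed
  then have "isCont (\<lambda>y. \<Sum>m. c m * y ^ m) ((z / 2)\<^sup>2)"
    by (rule isCont_powser_converges_everywhere)
  then have "isCont (\<lambda>z. \<Sum>m. c m * ((z / 2)\<^sup>2) ^ m) z"
    by (rule isCont_o2[rotated]) auto
  moreover have "(\<Sum>m. c m * ((z / 2)\<^sup>2) ^ m) = bessel_j b z" for z
    unfolding sums_unique[OF bessel_j_sums[OF b]] by (simp add: c_def power_mult)
  ultimately show ?thesis by simp
qed

section \<open>Parity components of the kernel and Weber's integral\<close>

context kn_params begin

lemma sigma_finite_mu: "sigma_finite_measure \<mu>"
  unfolding mu_kn_def
  by (subst sigma_finite_measure.sigma_finite_iff_density_finite[OF sigma_finite_lborel]) auto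

sublocale mu_pair: pair_sigma_finite \<mu> \<mu>
  by (intro pair_sigma_finite.intro sigma_finite_mu)

text \<open>For \<open>j = 0\<close> and \<open>j = 1\<close> these are the even and the odd part of
  \<open>kernel_B\<close>, stripped of the constant \<open>ft_coef j\<close>.\<close>

definition ker :: "nat \<Rightarrow> real \<Rightarrow> real \<Rightarrow> real" where
  "ker j x \<xi> = (x * \<xi>) ^ j * bessel_j (\<beta> j) (real n * \<bar>\<xi> * x\<bar> powr (1 / real n))"

lemma ker_measurable [measurable]:
  assumes [measurable]: "a \<in> borel_measurable M" "b \<in> borel_measurable M"
  shows "(\<lambda>p. ker j (a p) (b p)) \<in> borel_measurable M"
  unfolding ker_def by measurable

lemma bessel_arg_power: "(real n * \<bar>\<xi> * x\<bar> powr (1 / real n) / 2) ^ (2 * m) = ((real n)\<^sup>2 / 4 * rad x) ^ m * rad \<xi> ^ m"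
proof -
  have "(\<bar>\<xi> * x\<bar> powr (1 / real n))\<^sup>2 = rad x * rad \<xi>"
  proof -
    have "a powr (2 / real n) = a powr (1 / real n) * a powr (1 / real n)" for a :: real
      by (simp add: powr_add[symmetric])
    then show ?thesis
      by (simp add: rad_def abs_mult powr_mult power2_eq_square)
  qed
  then show ?thesis
    by (simp add: power_mult power_divide power_mult_distrib)
qed

lemma ker_sums:
  "(\<lambda>m. (-1) ^ m / (fact m * Gamma (\<beta> j + real m + 1)) * Gamma (\<beta> j + 1) * ((real n)\<^sup>2 / 4 * rad x) ^ m * rad \<xi> ^ m * (x * \<xi>) ^ j)
    sums ker j x \<xi>"
  using sums_mult2[OF bessel_j_sums[OF beta_gt[of j], of "real n * \<bar>\<xi> * x\<bar> powr (1 / real n)"], of "(x * \<xi>) ^ j"]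
  unfolding bessel_arg_power ker_def by (simp add: mult_ac)

lemma ker_abs_summable:
  "summable (\<lambda>m. \<bar>(-1) ^ m / (fact m * Gamma (\<beta> j + real m + 1)) * Gamma (\<beta> j + 1) * ((real n)\<^sup>2 / 4 * rad x) ^ m * rad \<xi> ^ m * (x * \<xi>) ^ j\<bar>)"
  using summable_mult2[OF bessel_j_abs_summable[OF beta_gt[of j], of "real n * \<bar>\<xi> * x\<bar> powr (1 / real n)"], of "\<bar>(x * \<xi>) ^ j\<bar>"]
  unfolding bessel_arg_power by (simp add: abs_mult mult_ac)

text \<open>The Bessel argument is \<open>n * sqrt (rad x) * sqrt (rad \<xi>)\<close>; the
  arithmetic-geometric mean inequality splits it between the variables. The free parameter is chosen
  so that \<open>exp (s / 2 * rad \<xi>)\<close> uses up half of a Gaussian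
  \<open>exp (- s * rad \<xi>)\<close>.\<close>

lemma ker_bound:
  assumes s: "s > 0"
  shows "\<bar>ker j x \<xi>\<bar> \<le> \<bar>x\<bar> ^ j * exp ((real n)\<^sup>2 / (2 * s) * rad x) * (\<bar>\<xi>\<bar> ^ j * exp (s / 2 * rad \<xi>))"
proof -
  define z where "z = real n * \<bar>\<xi> * x\<bar> powr (1 / real n)"
  have z: "z = real n * sqrt (rad x) * sqrt (rad \<xi>)"
    by (simp add: z_def rad_def powr_half_sqrt[symmetric] powr_powr abs_mult powr_mult)
  have "2 * (real n * sqrt (rad x) / sqrt s) * (sqrt s * sqrt (rad \<xi>))
      \<le> (real n * sqrt (rad x) / sqrt s)\<^sup>2 + (sqrt s * sqrt (rad \<xi>))\<^sup>2"
    by (rule sum_squares_bound)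
  then have "z \<le> (real n)\<^sup>2 / (2 * s) * rad x + s / 2 * rad \<xi>"
    using s by (simp add: z power_mult_distrib power_divide field_simps)
  then have "exp z \<le> exp ((real n)\<^sup>2 / (2 * s) * rad x) * exp (s / 2 * rad \<xi>)"
    by (simp add: exp_add[symmetric])
  moreover have "\<bar>bessel_j (\<beta> j) z\<bar> \<le> exp z"
    by (rule bessel_j_bound[OF beta_gt]) (simp add: z_def)
  ultimately have "\<bar>bessel_j (\<beta> j) z\<bar> \<le> exp ((real n)\<^sup>2 / (2 * s) * rad x) * exp (s / 2 * rad \<xi>)"
    by linarith
  then have "\<bar>(x * \<xi>) ^ j\<bar> * \<bar>bessel_j (\<beta> j) z\<bar> \<le> \<bar>(x * \<xi>) ^ j\<bar> * (exp ((real n)\<^sup>2 / (2 * s) * rad x) * exp (s / 2 * rad \<xi>))"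
    by (rule mult_left_mono) auto
  moreover have "\<bar>ker j x \<xi>\<bar> = \<bar>(x * \<xi>) ^ j\<bar> * \<bar>bessel_j (\<beta> j) z\<bar>"
    unfolding ker_def z_def by (rule abs_mult)
  moreover have "\<bar>(x * \<xi>) ^ j\<bar> = \<bar>x\<bar> ^ j * \<bar>\<xi>\<bar> ^ j"
    by (simp add: abs_mult power_abs power_mult_distrib)
  ultimately show ?thesis
    by (simp only: mult_ac)
qed

text \<open>Weber's integral, obtained by integrating \<open>ker_sums\<close> term by term. The
  factor \<open>Gamma (b + m + 1)\<close> of each moment cancels the one in the coefficient, which
  leaves the exponential series in \<open>- y / s\<close>.\<close>

lemma ker_gauss_integral:
  assumes s: "s > 0"
  shows "has_bochner_integral \<mu> (\<lambda>\<xi>. ker j x \<xi> * (\<xi> ^ j * exp (- s * rad \<xi>)))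
     (\<kappa> * Gamma (\<beta> j + 1) * s powr - (\<beta> j + 1) * (x ^ j * exp (- ((real n)\<^sup>2 / (4 * s)) * rad x)))"
proof -
  define b where "b = \<beta> j"
  define y where "y = (real n)\<^sup>2 / 4 * rad x"
  have y0: "y \<ge> 0" by (simp add: y_def)
  have b: "b > - 1 / 2" using beta_gt by (simp add: b_def)
  have G: "Gamma (b + real m + 1) > 0" for m
    using b by (intro Gamma_real_pos) auto
  define c where "c m = (-1) ^ m / (fact m * Gamma (b + real m + 1)) * Gamma (b + 1) * y ^ m * x ^ j" for m
  define f where "f m \<xi> = c m * (\<xi> ^ (2 * j) * rad \<xi> ^ m * exp (- s * rad \<xi>))" for m \<xi>
  have mom: "has_bochner_integral \<mu> (\<lambda>\<xi>. \<xi> ^ (2 * j) * rad \<xi> ^ m * exp (- s * rad \<xi>))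
       (\<kappa> * Gamma (b + real m + 1) * s powr - (b + 1) * s powr - real m)" for m
  proof -
    have "s powr - (b + 1) * s powr - real m = s powr - (\<beta> j + 1 + real m)"
      by (simp add: b_def powr_add[symmetric])
    then show ?thesis
      using beta_moment[OF s, of j m] by (simp add: b_def mult.assoc add_ac)
  qed
  have sp: "s powr - real m = (1 / s) ^ m" for m
    using s by (simp add: powr_minus powr_realpow power_divide inverse_eq_divide)
  have cG: "c m * (\<kappa> * Gamma (b + real m + 1) * s powr - (b + 1) * s powr - real m)
      = \<kappa> * Gamma (b + 1) * s powr - (b + 1) * x ^ j * ((- y / s) ^ m / fact m)" for m
  proof -
    have "(- y / s) ^ m = (-1) ^ m * y ^ m * (1 / s) ^ m"
      unfolding power_mult_distrib[symmetric] by simp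
    then show ?thesis
      using G[of m] unfolding sp c_def by simp
  qed
  have f1: "has_bochner_integral \<mu> (f m) (\<kappa> * Gamma (b + 1) * s powr - (b + 1) * x ^ j * ((- y / s) ^ m / fact m))" for m
    using has_bochner_integral_mult_right[OF mom, of "c m" m] unfolding f_def[symmetric] cG by simp
  have absf: "\<bar>f m \<xi>\<bar> = \<bar>c m\<bar> * (\<xi> ^ (2 * j) * rad \<xi> ^ m * exp (- s * rad \<xi>))" for m \<xi>
    by (simp add: f_def abs_mult)
  \<comment> \<open>The same computation with absolute values. These norms form an exponential
    series in \<open>y / s\<close>, and its convergence licenses the exchange of sum and
    integral.\<close>
  have f2: "(\<integral>\<xi>. norm (f m \<xi>) \<partial>\<mu>) = \<kappa> * Gamma (b + 1) * s powr - (b + 1) * \<bar>x\<bar> ^ j * ((y / s) ^ m / fact m)" for m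
  proof -
    have "(\<integral>\<xi>. norm (f m \<xi>) \<partial>\<mu>) = \<bar>c m\<bar> * (\<kappa> * Gamma (b + real m + 1) * s powr - (b + 1) * s powr - real m)"
      using mom[of m] by (simp add: absf has_bochner_integral_iff)
    also have "\<dots> = \<bar>c m * (\<kappa> * Gamma (b + real m + 1) * s powr - (b + 1) * s powr - real m)\<bar>"
      using kappa_pos G[of m] by (simp add: abs_mult)
    also have "\<dots> = \<kappa> * Gamma (b + 1) * s powr - (b + 1) * \<bar>x\<bar> ^ j * ((y / s) ^ m / fact m)"
      unfolding cG using kappa_pos G[of 0] y0 s by (simp add: abs_mult power_abs)
    finally show ?thesis .
  qed
  have pw: "\<xi> ^ (2 * j) = \<xi> ^ j * \<xi> ^ j" for \<xi> :: real
    by (simp add: mult_2 power_add)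
  have fker: "(\<lambda>m. f m \<xi>) sums (ker j x \<xi> * (\<xi> ^ j * exp (- s * rad \<xi>)))" for \<xi>
    using sums_mult2[OF ker_sums[of j x \<xi>], of "\<xi> ^ j * exp (- s * rad \<xi>)"]
    unfolding f_def pw by (simp add: c_def y_def b_def power_mult_distrib mult_ac)
  have fabs: "summable (\<lambda>m. norm (f m \<xi>))" for \<xi>
    using summable_mult2[OF ker_abs_summable[of j x \<xi>], of "\<bar>\<xi> ^ j * exp (- s * rad \<xi>)\<bar>"]
    unfolding f_def pw by (simp add: c_def y_def b_def abs_mult power_mult_distrib mult_ac)
  have smb: "summable (\<lambda>m. (\<integral>\<xi>. norm (f m \<xi>) \<partial>\<mu>))"
    unfolding f2 using summable_exp[of "y / s"]
    by (intro summable_mult) (simp add: divide_inverse mult.commute)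
  have int: "integrable \<mu> (f m)" for m using f1 by (auto simp: has_bochner_integral_iff)
  have suminf: "(\<Sum>m. f m \<xi>) = ker j x \<xi> * (\<xi> ^ j * exp (- s * rad \<xi>))" for \<xi>
    using fker by (simp add: sums_iff)
  have "(\<lambda>m. (\<integral>\<xi>. f m \<xi> \<partial>\<mu>)) sums (\<integral>\<xi>. ker j x \<xi> * (\<xi> ^ j * exp (- s * rad \<xi>)) \<partial>\<mu>)"
    unfolding suminf[symmetric] by (intro sums_integral int AE_I2 fabs smb)
  moreover have "(\<lambda>m. (\<integral>\<xi>. f m \<xi> \<partial>\<mu>)) sums (\<kappa> * Gamma (b + 1) * s powr - (b + 1) * x ^ j * exp (- y / s))"
    using f1 exp_converges[of "- y / s"]
    by (auto simp: has_bochner_integral_iff divide_inverse mult.commute intro!: sums_mult sums_mult2)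
  ultimately have "(\<integral>\<xi>. ker j x \<xi> * (\<xi> ^ j * exp (- s * rad \<xi>)) \<partial>\<mu>)
      = \<kappa> * Gamma (b + 1) * s powr - (b + 1) * x ^ j * exp (- y / s)"
    by (rule sums_unique2)
  moreover have "integrable \<mu> (\<lambda>\<xi>. ker j x \<xi> * (\<xi> ^ j * exp (- s * rad \<xi>)))"
    unfolding suminf[symmetric] by (intro integrable_suminf int AE_I2 fabs smb)
  ultimately show ?thesis
    by (simp add: has_bochner_integral_iff b_def y_def)
qed

text \<open>Combines \<open>norm (f x) \<le> (norm (f x))\<^sup>2 + 1\<close> with the fact that on
  the support the 1 is at most \<open>exp (rad R) * exp (- rad x)\<close>, a multiple of an
  integrable Gaussian.\<close>

lemma bounded_support_integrable:
  fixes f :: "real \<Rightarrow> complex"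
  assumes f: "memL k n 2 f" and R: "\<forall>x. \<bar>x\<bar> > R \<longrightarrow> f x = 0"
    and [measurable]: "w \<in> borel_measurable borel" and w: "\<And>x. \<bar>x\<bar> \<le> R \<Longrightarrow> \<bar>w x\<bar> \<le> W"
  shows "integrable \<mu> (\<lambda>x. norm (f x) * w x)"
proof (rule Bochner_Integration.integrable_bound)
  have [measurable]: "f \<in> borel_measurable borel" using f by (simp add: memL_2_iff)
  show "(\<lambda>x. norm (f x) * w x) \<in> borel_measurable \<mu>" by simp
  have "integrable \<mu> (\<lambda>x. \<bar>x\<bar> ^ 0 * rad x ^ 0 * exp (- 1 * rad x))"
    using power_moment[of 1 0 0] by (auto simp: has_bochner_integral_iff)
  then show "integrable \<mu> (\<lambda>x. \<bar>W\<bar> * ((norm (f x))\<^sup>2 + exp (rad R) * exp (- rad x)))"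
    using f by (auto simp: memL_2_iff)
  show "AE x in \<mu>. norm (norm (f x) * w x) \<le> norm (\<bar>W\<bar> * ((norm (f x))\<^sup>2 + exp (rad R) * exp (- rad x)))"
  proof (rule AE_I2)
    fix x
    show "norm (norm (f x) * w x) \<le> norm (\<bar>W\<bar> * ((norm (f x))\<^sup>2 + exp (rad R) * exp (- rad x)))"
    proof (cases "\<bar>x\<bar> \<le> R")
      case True
      have "rad x \<le> rad R" unfolding rad_def using True by (intro powr_mono2) auto
      then have "1 \<le> exp (rad R) * exp (- rad x)" by (simp add: exp_add[symmetric])
      moreover have "norm (f x) \<le> (norm (f x))\<^sup>2 + 1"
        using zero_le_power2[of "norm (f x) - 1 / 2"] by (simp add: power2_diff power2_eq_square field_simps)
      ultimately have "norm (f x) \<le> (norm (f x))\<^sup>2 + exp (rad R) * exp (- rad x)" by linarith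
      moreover have "\<bar>w x\<bar> \<le> \<bar>W\<bar>" using w[OF True] by linarith
      ultimately have "norm (f x) * \<bar>w x\<bar> \<le> ((norm (f x))\<^sup>2 + exp (rad R) * exp (- rad x)) * \<bar>W\<bar>"
        by (intro mult_mono) (auto intro!: add_nonneg_nonneg)
      then show ?thesis by (simp add: abs_mult mult.commute)
    qed (use R in simp)
  qed
qed

lemma weight_integrable:
  assumes f: "memL k n 2 f" and R: "\<forall>x. \<bar>x\<bar> > R \<longrightarrow> f x = 0"
  shows "integrable \<mu> (\<lambda>x. norm (f x) * (\<bar>x\<bar> ^ j * exp (c * rad x)))"
proof (rule bounded_support_integrable[OF f R])
  fix x :: real assume x: "\<bar>x\<bar> \<le> R"
  have "rad x \<le> rad R" unfolding rad_def using x by (intro powr_mono2) auto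
  then have "c * rad x \<le> \<bar>c\<bar> * rad R" by (intro mult_mono) auto
  then show "\<bar>\<bar>x\<bar> ^ j * exp (c * rad x)\<bar> \<le> \<bar>R\<bar> ^ j * exp (\<bar>c\<bar> * rad R)"
    using x by (auto simp: abs_mult intro!: mult_mono power_mono)
qed auto

section \<open>Transforms of square-integrable functions with bounded support\<close>

definition hankel :: "nat \<Rightarrow> (real \<Rightarrow> complex) \<Rightarrow> real \<Rightarrow> complex" where
  "hankel j f \<xi> = (\<integral>x. f x * of_real (ker j x \<xi>) \<partial>\<mu>)"

context
  fixes f :: "real \<Rightarrow> complex" and R :: real
  assumes f: "memL k n 2 f" and R: "\<forall>x. \<bar>x\<bar> > R \<longrightarrow> f x = 0"
begin

lemma support_weight_integrable: "integrable \<mu> (\<lambda>x. norm (f x) * (\<bar>x\<bar> ^ j * exp (c * rad x)))"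
  by (rule weight_integrable[OF f R])

lemma hankel_integrable: "integrable \<mu> (\<lambda>x. f x * of_real (ker j x \<xi>))"
proof (rule Bochner_Integration.integrable_bound[OF integrable_mult_left[OF support_weight_integrable[ where j = j and c = "(real n)\<^sup>2 / (2 * 2)"], of "\<bar>\<xi>\<bar> ^ j * exp (2 / 2 * rad \<xi>)"]])
  show "AE x in \<mu>. norm (f x * of_real (ker j x \<xi>)) \<le> norm (norm (f x) * (\<bar>x\<bar> ^ j * exp ((real n)\<^sup>2 / (2 * 2) * rad x)) * (\<bar>\<xi>\<bar> ^ j * exp (2 / 2 * rad \<xi>)))"
    using ker_bound[of 2 j _ \<xi>] by (intro AE_I2) (auto simp: norm_mult abs_mult mult.assoc intro!: mult_left_mono)
qed (use f in \<open>auto simp: memL_2_iff\<close>)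

lemma hankel_bound:
  obtains D where "D \<ge> 0" "\<And>\<xi>. norm (hankel j f \<xi>) \<le> D * (\<bar>\<xi>\<bar> ^ j * exp (rad \<xi>))"
proof
  let ?D = "\<integral>x. norm (f x) * (\<bar>x\<bar> ^ j * exp ((real n)\<^sup>2 / (2 * 2) * rad x)) \<partial>\<mu>"
  show "?D \<ge> 0" by simp
  fix \<xi>
  have "norm (hankel j f \<xi>) \<le> (\<integral>x. norm (f x) * (\<bar>x\<bar> ^ j * exp ((real n)\<^sup>2 / (2 * 2) * rad x)) * (\<bar>\<xi>\<bar> ^ j * exp (rad \<xi>)) \<partial>\<mu>)"
    unfolding hankel_def
    using ker_bound[of 2 j _ \<xi>]
    by (intro norm_integral_le hankel_integrable integrable_mult_left support_weight_integrable)
       (auto simp: norm_mult abs_mult mult.assoc intro!: mult_left_mono)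
  then show "norm (hankel j f \<xi>) \<le> ?D * (\<bar>\<xi>\<bar> ^ j * exp (rad \<xi>))" by simp
qed

text \<open>Fubini moves the transform from \<open>f\<close> onto the Gaussian, where
  \<open>ker_gauss_integral\<close> evaluates it.\<close>

lemma hankel_dual:
  assumes s: "s > 0"
  shows "(\<integral>\<xi>. hankel j f \<xi> * of_real (\<xi> ^ j * exp (- s * rad \<xi>)) \<partial>\<mu>)
    = of_real (\<kappa> * Gamma (\<beta> j + 1) * s powr - (\<beta> j + 1)) * gauss_pair j f (of_real ((real n)\<^sup>2 / (4 * s)))"
proof -
  have [measurable]: "f \<in> borel_measurable borel" using f by (simp add: memL_2_iff)
  let ?g = "\<lambda>x \<xi>. f x * of_real (ker j x \<xi> * (\<xi> ^ j * exp (- s * rad \<xi>)))"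
  have kg: "integrable \<mu> (\<lambda>\<xi>. ker j x \<xi> * (\<xi> ^ j * exp (- s * rad \<xi>)))" for x
    using ker_gauss_integral[OF s] by (auto simp: has_bochner_integral_iff)
  \<comment> \<open>\<open>ker_bound\<close> with the same \<open>s\<close> leaves half of the
    Gaussian in \<open>\<xi>\<close> and, in \<open>x\<close>, a weight that is integrable against
    \<open>f\<close> by its bounded support; this dominates the double integral.\<close>
  have b: "\<bar>ker j x \<xi> * (\<xi> ^ j * exp (- s * rad \<xi>))\<bar>
     \<le> \<bar>x\<bar> ^ j * exp ((real n)\<^sup>2 / (2 * s) * rad x) * (\<xi> ^ (2 * j) * rad \<xi> ^ 0 * exp (- (s / 2) * rad \<xi>))" for x \<xi>
  proof -
    have "\<bar>ker j x \<xi> * (\<xi> ^ j * exp (- s * rad \<xi>))\<bar>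
       \<le> (\<bar>x\<bar> ^ j * exp ((real n)\<^sup>2 / (2 * s) * rad x) * (\<bar>\<xi>\<bar> ^ j * exp (s / 2 * rad \<xi>))) * (\<bar>\<xi>\<bar> ^ j * exp (- s * rad \<xi>))"
      unfolding abs_mult power_abs using ker_bound[OF s, of j x \<xi>] by (intro mult_mono) auto
    also have "\<dots> = \<bar>x\<bar> ^ j * exp ((real n)\<^sup>2 / (2 * s) * rad x) * ((\<bar>\<xi>\<bar> ^ j)\<^sup>2 * (exp (s / 2 * rad \<xi>) * exp (- s * rad \<xi>)))"
      by (simp add: power2_eq_square mult_ac)
    also have "exp (s / 2 * rad \<xi>) * exp (- s * rad \<xi>) = exp (- (s / 2) * rad \<xi>)"
      by (simp add: exp_add[symmetric] field_simps)
    also have "(\<bar>\<xi>\<bar> ^ j)\<^sup>2 = \<xi> ^ (2 * j)"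
      by (simp add: power_mult[symmetric] mult.commute power_even_abs)
    finally show ?thesis by simp
  qed
  have mom: "integrable \<mu> (\<lambda>\<xi>. \<xi> ^ (2 * j) * rad \<xi> ^ 0 * exp (- (s / 2) * rad \<xi>))"
    using beta_moment[of "s / 2" j 0] s by (simp add: has_bochner_integral_iff)
  define A where "A = (\<integral>\<xi>. \<xi> ^ (2 * j) * rad \<xi> ^ 0 * exp (- (s / 2) * rad \<xi>) \<partial>\<mu>)"
  have int: "integrable (\<mu> \<Otimes>\<^sub>M \<mu>) (case_prod ?g)"
  proof (rule mu_pair.Fubini_integrable)
    show "case_prod ?g \<in> borel_measurable (\<mu> \<Otimes>\<^sub>M \<mu>)" 
      unfolding case_prod_beta by measurable
    show "AE x in \<mu>. integrable \<mu> (\<lambda>\<xi>. case (x, \<xi>) of (x, \<xi>) \<Rightarrow> ?g x \<xi>)"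
      using kg by (auto intro!: AE_I2 integrable_mult_right integrable_of_real simp del: of_real_mult)
    have nb: "(\<integral>\<xi>. norm (?g x \<xi>) \<partial>\<mu>) \<le> norm (f x) * (\<bar>x\<bar> ^ j * exp ((real n)\<^sup>2 / (2 * s) * rad x)) * A" for x
    proof -
      have "(\<integral>\<xi>. norm (?g x \<xi>) \<partial>\<mu>) = norm (f x) * (\<integral>\<xi>. \<bar>ker j x \<xi> * (\<xi> ^ j * exp (- s * rad \<xi>))\<bar> \<partial>\<mu>)"
        by (simp add: norm_mult abs_mult del: of_real_mult)
      also have "\<dots> \<le> norm (f x) * (\<integral>\<xi>. \<bar>x\<bar> ^ j * exp ((real n)\<^sup>2 / (2 * s) * rad x) * (\<xi> ^ (2 * j) * rad \<xi> ^ 0 * exp (- (s / 2) * rad \<xi>)) \<partial>\<mu>)"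
        by (intro mult_left_mono integral_mono b integrable_abs kg integrable_mult_right mom) auto
      finally show ?thesis by (simp add: A_def)
    qed
    show "integrable \<mu> (\<lambda>x. \<integral>\<xi>. norm (case (x, \<xi>) of (x, \<xi>) \<Rightarrow> ?g x \<xi>) \<partial>\<mu>)"
    proof (rule Bochner_Integration.integrable_bound[OF integrable_mult_left[OF support_weight_integrable[ where j = j and c = "(real n)\<^sup>2 / (2 * s)"], of A]])
      have "(\<lambda>(x, \<xi>). norm (?g x \<xi>)) \<in> borel_measurable (\<mu> \<Otimes>\<^sub>M \<mu>)"
        unfolding case_prod_beta by measurable
      then show "(\<lambda>x. \<integral>\<xi>. norm (case (x, \<xi>) of (x, \<xi>) \<Rightarrow> ?g x \<xi>) \<partial>\<mu>) \<in> borel_measurable \<mu>"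
        using sigma_finite_measure.borel_measurable_lebesgue_integral[OF sigma_finite_mu, of "\<lambda>x \<xi>. norm (?g x \<xi>)" \<mu>] by simp
      show "AE x in \<mu>. norm (\<integral>\<xi>. norm (case (x, \<xi>) of (x, \<xi>) \<Rightarrow> ?g x \<xi>) \<partial>\<mu>)
        \<le> norm (norm (f x) * (\<bar>x\<bar> ^ j * exp ((real n)\<^sup>2 / (2 * s) * rad x)) * A)"
      proof (rule AE_I2)
        fix x
        have "norm (\<integral>\<xi>. norm (?g x \<xi>) \<partial>\<mu>) = (\<integral>\<xi>. norm (?g x \<xi>) \<partial>\<mu>)" by (simp del: of_real_mult)
        also note nb[of x]
        finally show "norm (\<integral>\<xi>. norm (case (x, \<xi>) of (x, \<xi>) \<Rightarrow> ?g x \<xi>) \<partial>\<mu>)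
          \<le> norm (norm (f x) * (\<bar>x\<bar> ^ j * exp ((real n)\<^sup>2 / (2 * s) * rad x)) * A)"
          by (simp del: of_real_mult) 
      qed
    qed
  qed
  have "(\<integral>\<xi>. hankel j f \<xi> * of_real (\<xi> ^ j * exp (- s * rad \<xi>)) \<partial>\<mu>) = (\<integral>\<xi>. (\<integral>x. ?g x \<xi> \<partial>\<mu>) \<partial>\<mu>)"
    unfolding hankel_def
    by (subst integral_mult_left_zero[symmetric]) (simp add: mult.assoc)
  also have "\<dots> = (\<integral>x. (\<integral>\<xi>. ?g x \<xi> \<partial>\<mu>) \<partial>\<mu>)"
    by (rule mu_pair.Fubini_integral[OF int])
  also have "\<dots> = (\<integral>x. f x * of_real (\<kappa> * Gamma (\<beta> j + 1) * s powr - (\<beta> j + 1) * (x ^ j * exp (- ((real n)\<^sup>2 / (4 * s)) * rad x))) \<partial>\<mu>)"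
    unfolding integral_mult_right_zero integral_of_real
    using ker_gauss_integral[OF s, of j] by (simp add: has_bochner_integral_iff del: of_real_mult)
  also have "\<dots> = (\<integral>x. of_real (\<kappa> * Gamma (\<beta> j + 1) * s powr - (\<beta> j + 1)) * (f x * (of_real (x ^ j) * exp (- of_real ((real n)\<^sup>2 / (4 * s)) * of_real (rad x)))) \<partial>\<mu>)"
    by (intro Bochner_Integration.integral_cong) (simp_all add: exp_of_real[symmetric] mult_ac)
  also have "\<dots> = of_real (\<kappa> * Gamma (\<beta> j + 1) * s powr - (\<beta> j + 1)) * gauss_pair j f (of_real ((real n)\<^sup>2 / (4 * s)))"
    unfolding gauss_pair_def by (rule integral_mult_right_zero)
  finally show ?thesis .
qed

end
end

section \<open>Square integrability of the transform of truncations\<close>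

text \<open>Weierstrass approximation in the form that dominated convergence consumes: a pointwise
  limit together with one bound for all the polynomials.\<close>

lemma weierstrass_sequence:
  fixes G :: "real \<Rightarrow> real"
  assumes G: "continuous_on {0..1} G"
  obtains a :: "nat \<Rightarrow> nat \<Rightarrow> real" and d :: "nat \<Rightarrow> nat" and B :: real
  where "\<And>t. t \<in> {0..1} \<Longrightarrow> (\<lambda>m. \<Sum>i\<le>d m. a m i * t ^ i) \<longlonglongrightarrow> G t"
    and "\<And>t m. t \<in> {0..1} \<Longrightarrow> \<bar>\<Sum>i\<le>d m. a m i * t ^ i\<bar> \<le> B"
proof -
  have "\<exists>a d. \<forall>t\<in>{0..1}. \<bar>G t - (\<Sum>i\<le>d. a i * t ^ i)\<bar> < inverse (real (Suc m))" for m
  proof -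
    obtain g where "real_polynomial_function g" and g: "\<And>t. t \<in> {0..1} \<Longrightarrow> \<bar>G t - g t\<bar> < inverse (real (Suc m))"
      using Stone_Weierstrass_real_polynomial_function[OF _ G, of "inverse (real (Suc m))"] by auto
    then show ?thesis unfolding real_polynomial_function_iff_sum by blast
  qed
  then obtain a :: "nat \<Rightarrow> nat \<Rightarrow> real" and d :: "nat \<Rightarrow> nat"
    where ad: "\<And>m t. t \<in> {0..1} \<Longrightarrow> \<bar>G t - (\<Sum>i\<le>d m. a m i * t ^ i)\<bar> < inverse (real (Suc m))"
    by metis
  have "bounded (G ` {0..1})"
    by (intro compact_imp_bounded compact_continuous_image G) auto
  then obtain B where B: "\<And>t. t \<in> {0..1} \<Longrightarrow> \<bar>G t\<bar> \<le> B"
    unfolding bounded_iff by (metis imageI real_norm_def)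
  show ?thesis
  proof
    fix t :: real assume t: "t \<in> {0..1}"
    have "(\<lambda>m. (\<Sum>i\<le>d m. a m i * t ^ i) - G t) \<longlonglongrightarrow> 0"
      by (rule Lim_null_comparison[OF _ LIMSEQ_inverse_real_of_nat])
         (use ad[OF t] in \<open>auto intro!: always_eventually less_imp_le simp: abs_minus_commute\<close>)
    then show "(\<lambda>m. \<Sum>i\<le>d m. a m i * t ^ i) \<longlonglongrightarrow> G t" by (simp add: LIM_zero_iff)
    fix m
    have "inverse (real (Suc m)) \<le> 1" by (simp add: field_simps)
    then show "\<bar>\<Sum>i\<le>d m. a m i * t ^ i\<bar> \<le> B + 1" using ad[OF t, of m] B[OF t] by linarith
  qed
qed

context kn_params begin

lemma gauss_inner:
  assumes "p > 0" "q > 0"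
  shows "has_bochner_integral \<mu> (\<lambda>x. (x ^ j * exp (- p * rad x)) * (x ^ j * exp (- q * rad x)))
    (\<kappa> * Gamma (\<beta> j + 1) * (p + q) powr - (\<beta> j + 1))"
proof -
  have "(x ^ j * exp (- p * rad x)) * (x ^ j * exp (- q * rad x)) = x ^ (2 * j) * rad x ^ 0 * exp (- (p + q) * rad x)" for x
  proof -
    have "exp (- p * rad x) * exp (- q * rad x) = exp (- (p + q) * rad x)"
      by (simp add: exp_add[symmetric] algebra_simps)
    moreover have "x ^ (2 * j) = x ^ j * x ^ j" by (simp add: mult_2 power_add)
    ultimately show ?thesis by (simp add: mult_ac del: mult_minus_left)
  qed
  then show ?thesis
    using beta_moment[of "p + q" j 0] assms by simp
qed

lemma gauss_span_norm:
  assumes s: "\<And>i. s i > 0"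
  shows "has_bochner_integral \<mu> (\<lambda>x. (\<Sum>i\<le>d::nat. a i * (x ^ j * exp (- s i * rad x)))\<^sup>2)
    (\<Sum>i\<le>d. \<Sum>l\<le>d. a i * a l * (\<kappa> * Gamma (\<beta> j + 1) * (s i + s l) powr - (\<beta> j + 1)))"
proof -
  have "has_bochner_integral \<mu> (\<lambda>x. \<Sum>i\<le>d. \<Sum>l\<le>d. a i * a l * ((x ^ j * exp (- s i * rad x)) * (x ^ j * exp (- s l * rad x))))
    (\<Sum>i\<le>d. \<Sum>l\<le>d. a i * a l * (\<kappa> * Gamma (\<beta> j + 1) * (s i + s l) powr - (\<beta> j + 1)))"
    by (intro has_bochner_integral_sum has_bochner_integral_mult_right gauss_inner s)
  also have "(\<lambda>x. \<Sum>i\<le>d. \<Sum>l\<le>d. a i * a l * ((x ^ j * exp (- s i * rad x)) * (x ^ j * exp (- s l * rad x))))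
     = (\<lambda>x. (\<Sum>i\<le>d. a i * (x ^ j * exp (- s i * rad x)))\<^sup>2)"
    by (simp add: power2_eq_square sum_product mult_ac)
  finally show ?thesis .
qed

lemma isCont_ker: "isCont (ker j x) \<xi>"
proof -
  have "isCont (\<lambda>\<xi>. real n * \<bar>\<xi> * x\<bar> powr (1 / real n)) \<xi>"
    unfolding isCont_def using n_pos
    by (intro tendsto_intros tendsto_powr') (auto simp: always_eventually)
  then have "isCont (\<lambda>\<xi>. bessel_j (\<beta> j) (real n * \<bar>\<xi> * x\<bar> powr (1 / real n))) \<xi>"
    by (rule isCont_o2[OF _ isCont_bessel_j[OF beta_gt]])
  then show ?thesis
    unfolding ker_def[abs_def] by (intro continuous_intros)
qed

context
  fixes g :: "real \<Rightarrow> real" and R :: real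
  assumes g: "memL k n 2 (\<lambda>x. of_real (g x))" and R: "\<forall>x. \<bar>x\<bar> > R \<longrightarrow> g x = 0"
begin

text \<open>The real version serves the square-integrability argument: squares are free of
  conjugation and real polynomials suffice for approximation. \<open>hankel_memL\<close> reassembles
  real and imaginary parts.\<close>

definition rhankel :: "nat \<Rightarrow> real \<Rightarrow> real" where
  "rhankel j \<xi> = (\<integral>x. g x * ker j x \<xi> \<partial>\<mu>)"

lemma of_real_support: "\<forall>x. \<bar>x\<bar> > R \<longrightarrow> complex_of_real (g x) = 0"
  using R by simp

lemma real_measurable: "g \<in> borel_measurable borel"
  using g by (simp add: memL_2_iff borel_measurable_complex_iff)

lemma hankel_real: "hankel j (\<lambda>x. of_real (g x)) \<xi> = of_real (rhankel j \<xi>)"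
  unfolding hankel_def rhankel_def by (simp flip: of_real_mult)

lemma real_sq_integrable: "integrable \<mu> (\<lambda>x. (g x)\<^sup>2)"
  using g by (simp add: memL_2_iff)

lemma rhankel_bound:
  obtains D where "D \<ge> 0" "\<And>\<xi>. \<bar>rhankel j \<xi>\<bar> \<le> D * (\<bar>\<xi>\<bar> ^ j * exp (rad \<xi>))"
  using hankel_bound[OF g of_real_support, of j] unfolding hankel_real norm_of_real by metis

text \<open>A convergent sequence of arguments is bounded, so \<open>ker_bound\<close> gives one
  integrable majorant for the whole sequence.\<close>

lemma isCont_rhankel: "isCont (rhankel j) \<xi>"
proof (unfold continuous_at_sequentially comp_def, intro allI impI)
  note [measurable] = real_measurable
  fix X assume X: "X \<longlonglongrightarrow> \<xi>"
  then obtain B where B: "\<And>i. \<bar>X i\<bar> \<le> B"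
    using Bseq_def[of X] convergent_imp_Bseq[of X] by (auto simp: convergent_def)
  have B0: "B \<ge> 0" using B[of 0] by linarith
  let ?w = "\<lambda>x. norm (complex_of_real (g x)) * (\<bar>x\<bar> ^ j * exp ((real n)\<^sup>2 / (2 * 2) * rad x)) * (B ^ j * exp (rad B))"
  show "(\<lambda>i. rhankel j (X i)) \<longlonglongrightarrow> rhankel j \<xi>"
    unfolding rhankel_def
  proof (rule integral_dominated_convergence[where w = ?w])
    show "integrable \<mu> ?w"
      by (intro integrable_mult_left support_weight_integrable[OF g of_real_support])
    show "AE x in \<mu>. (\<lambda>i. g x * ker j x (X i)) \<longlonglongrightarrow> g x * ker j x \<xi>"
      by (intro AE_I2 tendsto_mult tendsto_const isCont_tendsto_compose[OF isCont_ker X])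
    show "AE x in \<mu>. norm (g x * ker j x (X i)) \<le> ?w x" for i
    proof (rule AE_I2)
      fix x
      have "rad (X i) \<le> rad B" unfolding rad_def using B[of i] B0 by (intro powr_mono2) auto
      then have "\<bar>X i\<bar> ^ j * exp (2 / 2 * rad (X i)) \<le> B ^ j * exp (rad B)"
        using B[of i] B0 by (intro mult_mono power_mono) auto
      then have "\<bar>ker j x (X i)\<bar> \<le> \<bar>x\<bar> ^ j * exp ((real n)\<^sup>2 / (2 * 2) * rad x) * (B ^ j * exp (rad B))"
        by (intro order.trans[OF ker_bound[of 2 j x "X i"]] mult_left_mono) auto
      then have "\<bar>g x\<bar> * \<bar>ker j x (X i)\<bar> \<le> \<bar>g x\<bar> * (\<bar>x\<bar> ^ j * exp ((real n)\<^sup>2 / (2 * 2) * rad x) * (B ^ j * exp (rad B)))"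
        by (rule mult_left_mono) auto
      then show "norm (g x * ker j x (X i)) \<le> ?w x"
        by (simp add: abs_mult mult.assoc)
    qed
  qed auto
qed

lemma rhankel_measurable: "rhankel j \<in> borel_measurable borel"
  by (intro borel_measurable_continuous_onI continuous_at_imp_continuous_on ballI isCont_rhankel)

text \<open>The threshold 1 reflects the growth \<open>exp (rad \<xi>)\<close> that
  \<open>rhankel_bound\<close> permits at this stage.\<close>

lemma rhankel_gauss_integrable:
  assumes s: "s > 1"
  shows "integrable \<mu> (\<lambda>\<xi>. rhankel j \<xi> * (\<xi> ^ j * exp (- s * rad \<xi>)))"
proof -
  note [measurable] = rhankel_measurable
  obtain D where D: "D \<ge> 0" "\<And>\<xi>. \<bar>rhankel j \<xi>\<bar> \<le> D * (\<bar>\<xi>\<bar> ^ j * exp (rad \<xi>))"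
    using rhankel_bound[of j] by blast
  have "integrable \<mu> (\<lambda>\<xi>. \<xi> ^ (2 * j) * rad \<xi> ^ 0 * exp (- (s - 1) * rad \<xi>))"
    using beta_moment[of "s - 1" j 0] s by (simp add: has_bochner_integral_iff)
  then show ?thesis
  proof (rule Bochner_Integration.integrable_bound[OF integrable_mult_right[where c = D]], measurable, intro AE_I2)
    fix \<xi>
    have "norm (rhankel j \<xi> * (\<xi> ^ j * exp (- s * rad \<xi>))) \<le> (D * (\<bar>\<xi>\<bar> ^ j * exp (rad \<xi>))) * (\<bar>\<xi>\<bar> ^ j * exp (- s * rad \<xi>))"
      using mult_right_mono[OF D(2)[of \<xi>], of "\<bar>\<xi>\<bar> ^ j * exp (- s * rad \<xi>)"]
      by (simp add: abs_mult power_abs)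
    also have "\<dots> = D * ((\<bar>\<xi>\<bar> ^ j * \<bar>\<xi>\<bar> ^ j) * (exp (rad \<xi>) * exp (- s * rad \<xi>)))"
      by simp
    also have "exp (rad \<xi>) * exp (- s * rad \<xi>) = exp (- (s - 1) * rad \<xi>)"
      by (simp add: exp_add[symmetric] algebra_simps)
    also have "\<bar>\<xi>\<bar> ^ j * \<bar>\<xi>\<bar> ^ j = \<xi> ^ (2 * j)"
      by (simp add: mult_2 power_add power_mult_distrib[symmetric])
    finally show "norm (rhankel j \<xi> * (\<xi> ^ j * exp (- s * rad \<xi>))) \<le> norm (D * (\<xi> ^ (2 * j) * rad \<xi> ^ 0 * exp (- (s - 1) * rad \<xi>)))"
      using D by simp
  qed
qed

lemma rhankel_dual:
  assumes s: "s > 0"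
  shows "(\<integral>\<xi>. rhankel j \<xi> * (\<xi> ^ j * exp (- s * rad \<xi>)) \<partial>\<mu>)
    = \<kappa> * Gamma (\<beta> j + 1) * s powr - (\<beta> j + 1) * (\<integral>x. g x * (x ^ j * exp (- ((real n)\<^sup>2 / (4 * s)) * rad x)) \<partial>\<mu>)"
proof -
  have gauss_pair_real: "gauss_pair j (\<lambda>x. of_real (g x)) (of_real p) = of_real (\<integral>x. g x * (x ^ j * exp (- p * rad x)) \<partial>\<mu>)" for p
  proof -
    have *: "complex_of_real (g x) * (of_real (x ^ j) * exp (- of_real p * of_real (rad x)))
        = of_real (g x * (x ^ j * exp (- p * rad x)))" for x
      by (simp flip: exp_of_real)
    show ?thesis unfolding gauss_pair_def * by (rule integral_complex_of_real)
  qed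
  show ?thesis
    using hankel_dual[OF g of_real_support s, of j]
    unfolding hankel_real gauss_pair_real of_real_mult[symmetric] integral_complex_of_real of_real_eq_iff .
qed

text \<open>Under \<open>s i \<mapsto> p i\<close> the Gram matrix of the Gaussians is multiplied by
  \<open>A\<close>, because \<open>s i * s l * (p i + p l)\<close> equals n^2/4 times
  \<open>s i + s l\<close>. Duality moves the combination onto \<open>g\<close>, and Cauchy-Schwarz
  finishes. The constant satisfies \<open>A = 1\<close> for \<open>j = 0\<close> and
  \<open>A * (norm (ft_coef 1))\<^sup>2 = 1\<close> for \<open>j = 1\<close>, which is the unitarity
  of the transform on Gaussians.\<close>

lemma rhankel_span_bound:
  fixes j :: nat
  assumes s: "\<And>i. s i > (1 :: real)"
  defines "A \<equiv> (\<kappa> * Gamma (\<beta> j + 1))\<^sup>2 * ((real n)\<^sup>2 / 4) powr - (\<beta> j + 1)"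
  shows "(\<integral>\<xi>. rhankel j \<xi> * (\<Sum>i\<le>d::nat. a i * (\<xi> ^ j * exp (- s i * rad \<xi>))) \<partial>\<mu>)\<^sup>2
    \<le> A * (\<integral>x. (g x)\<^sup>2 \<partial>\<mu>) * (\<integral>\<xi>. (\<Sum>i\<le>d. a i * (\<xi> ^ j * exp (- s i * rad \<xi>)))\<^sup>2 \<partial>\<mu>)"
proof -
  note [measurable] = real_measurable rhankel_measurable
  have s0: "s i > 0" for i using s[of i] by linarith
  define p where "p i = (real n)\<^sup>2 / (4 * s i)" for i
  have p0: "p i > 0" for i using s0 n_pos by (simp add: p_def)
  define C where "C = \<kappa> * Gamma (\<beta> j + 1)"
  define \<alpha>' where "\<alpha>' i = a i * (C * s i powr - (\<beta> j + 1))" for i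
  define \<psi> where "\<psi> x = (\<Sum>i\<le>d. \<alpha>' i * (x ^ j * exp (- p i * rad x)))" for x
  have [measurable]: "\<psi> \<in> borel_measurable borel" unfolding \<psi>_def by measurable
  have gi: "integrable \<mu> (\<lambda>x. g x * (x ^ j * exp (- q * rad x)))" if "q > 0" for q
  proof (rule cauchy_schwarz_integral(1))
    show "integrable \<mu> (\<lambda>x. (norm (x ^ j * exp (- q * rad x)))\<^sup>2)"
      using gauss_inner[OF that that, of j] by (simp add: has_bochner_integral_iff power2_eq_square)
  qed (use real_sq_integrable in auto)
  have \<psi>2: "has_bochner_integral \<mu> (\<lambda>x. (\<psi> x)\<^sup>2) (\<Sum>i\<le>d. \<Sum>l\<le>d. \<alpha>' i * \<alpha>' l * (C * (p i + p l) powr - (\<beta> j + 1)))"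
    unfolding \<psi>_def C_def by (rule gauss_span_norm[OF p0])
  have \<phi>2: "has_bochner_integral \<mu> (\<lambda>x. (\<Sum>i\<le>d. a i * (x ^ j * exp (- s i * rad x)))\<^sup>2) (\<Sum>i\<le>d. \<Sum>l\<le>d. a i * a l * (C * (s i + s l) powr - (\<beta> j + 1)))"
    unfolding C_def by (rule gauss_span_norm[OF s0])
  have term_eq: "\<alpha>' i * \<alpha>' l * (C * (p i + p l) powr - (\<beta> j + 1)) = A * (a i * a l * (C * (s i + s l) powr - (\<beta> j + 1)))" for i l
  proof -
    have "s i powr - (\<beta> j + 1) * s l powr - (\<beta> j + 1) * (p i + p l) powr - (\<beta> j + 1)
        = (s i * s l * (p i + p l)) powr - (\<beta> j + 1)"
      using s0[of i] s0[of l] p0[of i] p0[of l] by (simp add: powr_mult)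
    also have "s i * s l * (p i + p l) = (real n)\<^sup>2 / 4 * (s i + s l)"
      using s0[of i] s0[of l] by (simp add: p_def field_simps)
    also have "\<dots> powr - (\<beta> j + 1) = ((real n)\<^sup>2 / 4) powr - (\<beta> j + 1) * (s i + s l) powr - (\<beta> j + 1)"
      by (subst powr_mult) (use s0[of i] s0[of l] in auto)
    finally have "s i powr - (\<beta> j + 1) * s l powr - (\<beta> j + 1) * (p i + p l) powr - (\<beta> j + 1)
      = ((real n)\<^sup>2 / 4) powr - (\<beta> j + 1) * (s i + s l) powr - (\<beta> j + 1)" .
    moreover have "\<alpha>' i * \<alpha>' l * (C * (p i + p l) powr - (\<beta> j + 1)) 
       = a i * a l * C * C\<^sup>2 * (s i powr - (\<beta> j + 1) * s l powr - (\<beta> j + 1) * (p i + p l) powr - (\<beta> j + 1))"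
      by (simp add: \<alpha>'_def power2_eq_square mult_ac)
    ultimately show ?thesis by (simp add: A_def C_def mult_ac)
  qed
  have "(\<integral>\<xi>. rhankel j \<xi> * (\<Sum>i\<le>d. a i * (\<xi> ^ j * exp (- s i * rad \<xi>))) \<partial>\<mu>)
     = (\<integral>\<xi>. (\<Sum>i\<le>d. a i * (rhankel j \<xi> * (\<xi> ^ j * exp (- s i * rad \<xi>)))) \<partial>\<mu>)"
    by (simp add: sum_distrib_left mult_ac)
  also have "\<dots> = (\<Sum>i\<le>d. a i * (\<integral>\<xi>. rhankel j \<xi> * (\<xi> ^ j * exp (- s i * rad \<xi>)) \<partial>\<mu>))"
    by (subst Bochner_Integration.integral_sum) (use rhankel_gauss_integrable[OF s, of j] in auto)
  also have "\<dots> = (\<Sum>i\<le>d. \<alpha>' i * (\<integral>x. g x * (x ^ j * exp (- p i * rad x)) \<partial>\<mu>))"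
    unfolding rhankel_dual[OF s0] by (simp add: \<alpha>'_def C_def p_def mult_ac)
  also have "\<dots> = (\<integral>x. (\<Sum>i\<le>d. \<alpha>' i * (g x * (x ^ j * exp (- p i * rad x)))) \<partial>\<mu>)"
    by (subst Bochner_Integration.integral_sum) (use gi[OF p0] in auto)
  also have "\<dots> = (\<integral>x. g x * \<psi> x \<partial>\<mu>)"
    by (simp add: \<psi>_def sum_distrib_left mult_ac)
  finally have eq: "(\<integral>\<xi>. rhankel j \<xi> * (\<Sum>i\<le>d. a i * (\<xi> ^ j * exp (- s i * rad \<xi>))) \<partial>\<mu>) = (\<integral>x. g x * \<psi> x \<partial>\<mu>)" .
  have "\<bar>\<integral>x. g x * \<psi> x \<partial>\<mu>\<bar> \<le> sqrt (\<integral>x. (g x)\<^sup>2 \<partial>\<mu>) * sqrt (\<integral>x. (\<psi> x)\<^sup>2 \<partial>\<mu>)"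
    using cauchy_schwarz_integral(2)[of g \<mu> \<psi>] real_sq_integrable \<psi>2 by (simp add: has_bochner_integral_iff)
  then have "\<bar>\<integral>x. g x * \<psi> x \<partial>\<mu>\<bar>\<^sup>2 \<le> (sqrt (\<integral>x. (g x)\<^sup>2 \<partial>\<mu>) * sqrt (\<integral>x. (\<psi> x)\<^sup>2 \<partial>\<mu>))\<^sup>2"
    by (rule power_mono) auto
  also have "\<dots> = (\<integral>x. (g x)\<^sup>2 \<partial>\<mu>) * (\<integral>x. (\<psi> x)\<^sup>2 \<partial>\<mu>)"
    by (simp add: power_mult_distrib)
  also have "(\<integral>x. (\<psi> x)\<^sup>2 \<partial>\<mu>) = A * (\<integral>\<xi>. (\<Sum>i\<le>d. a i * (\<xi> ^ j * exp (- s i * rad \<xi>)))\<^sup>2 \<partial>\<mu>)"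
    using \<psi>2 \<phi>2 unfolding term_eq by (simp add: has_bochner_integral_iff sum_distrib_left)
  finally show ?thesis unfolding eq power2_abs by (simp only: mult_ac)
qed

text \<open>Apart from the factor \<open>\<xi> ^ j\<close> the transform depends on
  \<open>\<bar>\<xi>\<bar>\<close> alone, hence on \<open>exp (- rad \<xi>)\<close>, the variable in
  which polynomials are sums of Gaussians.\<close>

lemma rhankel_scaling:
  assumes "\<xi> \<noteq> 0"
  shows "rhankel j \<xi> = \<xi> ^ j * (rhankel j \<bar>\<xi>\<bar> / \<bar>\<xi>\<bar> ^ j)"
proof -
  have "\<bar>\<xi>\<bar> ^ j * rhankel j \<xi> = \<xi> ^ j * rhankel j \<bar>\<xi>\<bar>"
    unfolding rhankel_def integral_mult_right_zero[symmetric]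
    by (intro Bochner_Integration.integral_cong) (simp_all add: ker_def abs_mult power_mult_distrib)
  then show ?thesis using assms by (simp add: field_simps)
qed

text \<open>On the span of the functions \<open>\<xi> ^ j * exp (- s * rad \<xi>)\<close> the transform is a multiple of an isometry
  and, by duality, \<open>rhankel j\<close> is a bounded functional on it; Weierstrass approximation in the
  variable \<open>exp (- rad \<xi>)\<close> extends the bound to truncations of \<open>rhankel j\<close> itself. Without this fact the
  limit in \<open>FT2\<close> would be void, since \<open>L2norm\<close> is \<open>0\<close> on functions that are not square integrable.\<close>

lemma rhankel_sq_integrable: "integrable \<mu> (\<lambda>\<xi>. (rhankel j \<xi>)\<^sup>2)"
proof -
  note [measurable] = rhankel_measurable
  define A where "A = (\<kappa> * Gamma (\<beta> j + 1))\<^sup>2 * ((real n)\<^sup>2 / 4) powr - (\<beta> j + 1)"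
  define N where "N = A * (\<integral>x. (g x)\<^sup>2 \<partial>\<mu>)"
  \<comment> \<open>A cutoff in \<open>t = exp (- rad \<xi>)\<close>: it vanishes near
    \<open>t = 1\<close> (the origin) and near \<open>t = 0\<close> (infinity), and increases to 1
    in between as \<open>l\<close> grows.\<close>
  define \<eta> where "\<eta> l t = min 1 (max 0 (real l * (t * (1 - t)) - 1))" for l :: nat and t :: real
  \<comment> \<open>The exponent 2 gives all Gaussians below a parameter \<open>2 + i\<close>, above
    the threshold 1 of \<open>rhankel_span_bound\<close>.\<close>
  define v where "v \<xi> = \<xi> ^ j * exp (- 2 * rad \<xi>)" for \<xi>
  \<comment> \<open>The inverse substitution:
    \<open>\<zeta> (exp (- rad \<xi>)) = \<bar>\<xi>\<bar>\<close>.\<close>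
  define \<zeta> where "\<zeta> t = (- ln t) powr (real n / 2)" for t :: real
  have [measurable]: "\<eta> l \<in> borel_measurable borel" "v \<in> borel_measurable borel" for l
    unfolding \<eta>_def v_def by measurable
  have \<eta>01: "0 \<le> \<eta> l t" "\<eta> l t \<le> 1" for l t by (auto simp: \<eta>_def)
  have Fv: "integrable \<mu> (\<lambda>\<xi>. rhankel j \<xi> * v \<xi>)"
    unfolding v_def by (rule rhankel_gauss_integrable) simp
  have v2: "integrable \<mu> (\<lambda>\<xi>. (v \<xi>)\<^sup>2)"
    using gauss_inner[of 2 2 j] by (simp add: has_bochner_integral_iff v_def power2_eq_square)
  have main: "integrable \<mu> (\<lambda>\<xi>. \<eta> l (exp (- rad \<xi>)) * (rhankel j \<xi>)\<^sup>2)
      \<and> (\<integral>\<xi>. \<eta> l (exp (- rad \<xi>)) * (rhankel j \<xi>)\<^sup>2 \<partial>\<mu>) \<le> N" for l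
  proof -
    \<comment> \<open>The divisions by \<open>\<zeta> t ^ j\<close> and \<open>t\<^sup>2\<close>
      undo the factor \<open>v\<close>: for \<open>\<xi> \<noteq> 0\<close>,
      \<open>v \<xi> * H t\<close> is the truncation
      \<open>\<eta> l t * rhankel j \<xi>\<close>.\<close>
    define H where "H t = \<eta> l t * (rhankel j (\<zeta> t) / \<zeta> t ^ j) / t\<^sup>2" for t
    define S where "S = {t \<in> {0..1}. real l * (t * (1 - t)) \<le> 1}"
    define S' where "S' = {t \<in> {0..1}. 1 \<le> real l * (t * (1 - t))}"
    \<comment> \<open>Extending \<open>H\<close> by 0 avoids the singular endpoints 0 and 1. The two
      pieces meet continuously, since the cutoff vanishes where
      \<open>real l * (t * (1 - t)) = 1\<close>.\<close>
    define G where "G t = (if real l * (t * (1 - t)) \<le> 1 then 0 else H t)" for t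
    have S': "0 < t \<and> t < 1" if "t \<in> S'" for t
      using that by (cases "t = 0 \<or> t = 1") (auto simp: S'_def)
    have "continuous_on S' \<zeta>"
      unfolding \<zeta>_def using S' by (intro continuous_on_powr' continuous_intros) (auto simp: less_imp_neq)
    moreover have "continuous_on (\<zeta> ` S') (rhankel j)"
      by (intro continuous_at_imp_continuous_on ballI isCont_rhankel)
    ultimately have "continuous_on S' H"
      unfolding H_def \<eta>_def using S'
      by (intro continuous_intros continuous_on_compose2[of _ "rhankel j" S' \<zeta>]) (auto simp: \<zeta>_def)
    moreover have "H t = 0" if "real l * (t * (1 - t)) = 1" for t
      using that by (simp add: H_def \<eta>_def)
    moreover have "closed S" "closed S'"
      unfolding S_def S'_def by (intro closed_Collect_conj closed_Collect_le continuous_intros; simp add: closed_Collect_le)+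
    ultimately have "continuous_on (S \<union> S') G"
      unfolding G_def by (intro continuous_on_cases) (auto simp: S_def S'_def)
    moreover have "S \<union> S' = {0..1}" by (auto simp: S_def S'_def)
    ultimately have G: "continuous_on {0..1} G" by simp
    obtain a d B where lim: "\<And>t. t \<in> {0..1} \<Longrightarrow> (\<lambda>m. \<Sum>i\<le>d m. a m i * t ^ i) \<longlonglongrightarrow> G t"
      and bd: "\<And>t m. t \<in> {0..1} \<Longrightarrow> \<bar>\<Sum>i\<le>d m. a m i * t ^ i\<bar> \<le> B"
      using weierstrass_sequence[OF G] by blast
    have e01: "exp (- rad \<xi>) \<in> {0..1}" for \<xi> by auto
    define \<phi> where "\<phi> m \<xi> = v \<xi> * (\<Sum>i\<le>d m. a m i * exp (- rad \<xi>) ^ i)" for m \<xi>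
    define \<psi> where "\<psi> \<xi> = v \<xi> * G (exp (- rad \<xi>))" for \<xi>
    have [measurable]: "\<phi> m \<in> borel_measurable borel" for m unfolding \<phi>_def by measurable
    have [measurable]: "G \<in> borel_measurable borel"
      unfolding G_def H_def \<zeta>_def by measurable
    have [measurable]: "\<psi> \<in> borel_measurable borel" unfolding \<psi>_def by measurable
    have \<phi>_span: "\<phi> m \<xi> = (\<Sum>i\<le>d m. a m i * (\<xi> ^ j * exp (- (2 + real i) * rad \<xi>)))" for m \<xi>
      unfolding \<phi>_def v_def sum_distrib_left
      by (intro sum.cong) (auto simp: exp_of_nat_mult[symmetric] exp_add[symmetric] algebra_simps)
    have \<phi>_lim: "(\<lambda>m. \<phi> m \<xi>) \<longlonglongrightarrow> \<psi> \<xi>" for \<xi>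
      unfolding \<phi>_def \<psi>_def by (intro tendsto_mult tendsto_const lim e01)
    have \<phi>_bd: "\<bar>\<phi> m \<xi>\<bar> \<le> B * \<bar>v \<xi>\<bar>" for m \<xi>
      unfolding \<phi>_def abs_mult using bd[OF e01] by (subst mult.commute) (intro mult_right_mono; simp)
    have iw: "integrable \<mu> (\<lambda>\<xi>. B * \<bar>rhankel j \<xi> * v \<xi>\<bar>)"
      by (intro integrable_mult_right integrable_abs Fv)
    have wb: "AE \<xi> in \<mu>. norm (rhankel j \<xi> * \<phi> m \<xi>) \<le> B * \<bar>rhankel j \<xi> * v \<xi>\<bar>" for m
    proof (rule AE_I2)
      fix \<xi> show "norm (rhankel j \<xi> * \<phi> m \<xi>) \<le> B * \<bar>rhankel j \<xi> * v \<xi>\<bar>"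
        using mult_left_mono[OF \<phi>_bd[of m \<xi>], of "\<bar>rhankel j \<xi>\<bar>"] by (simp add: abs_mult mult_ac)
    qed
    have wl: "AE \<xi> in \<mu>. (\<lambda>m. rhankel j \<xi> * \<phi> m \<xi>) \<longlonglongrightarrow> rhankel j \<xi> * \<psi> \<xi>"
      by (intro AE_I2 tendsto_mult tendsto_const \<phi>_lim)
    have l1: "(\<lambda>m. \<integral>\<xi>. rhankel j \<xi> * \<phi> m \<xi> \<partial>\<mu>) \<longlonglongrightarrow> (\<integral>\<xi>. rhankel j \<xi> * \<psi> \<xi> \<partial>\<mu>)"
      by (rule integral_dominated_convergence[OF _ _ iw wl wb]) auto
    have i1: "integrable \<mu> (\<lambda>\<xi>. rhankel j \<xi> * \<psi> \<xi>)"
      by (rule integrable_dominated_convergence[OF _ _ iw wl wb]) auto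
    have sqb: "(\<phi> m \<xi>)\<^sup>2 \<le> B\<^sup>2 * (v \<xi>)\<^sup>2" for m \<xi>
      using power_mono[OF \<phi>_bd[of m \<xi>], of 2] by (simp add: power_mult_distrib)
    have l2: "(\<lambda>m. \<integral>\<xi>. (\<phi> m \<xi>)\<^sup>2 \<partial>\<mu>) \<longlonglongrightarrow> (\<integral>\<xi>. (\<psi> \<xi>)\<^sup>2 \<partial>\<mu>)"
      by (rule integral_dominated_convergence[where w = "\<lambda>\<xi>. B\<^sup>2 * (v \<xi>)\<^sup>2"])
         (auto intro!: integrable_mult_right v2 tendsto_power \<phi>_lim AE_I2 sqb)
    have i2: "integrable \<mu> (\<lambda>\<xi>. (\<psi> \<xi>)\<^sup>2)"
      by (rule integrable_dominated_convergence[where w = "\<lambda>\<xi>. B\<^sup>2 * (v \<xi>)\<^sup>2" and s = "\<lambda>m \<xi>. (\<phi> m \<xi>)\<^sup>2"])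
         (auto intro!: integrable_mult_right v2 tendsto_power \<phi>_lim AE_I2 sqb)
    have "(\<integral>\<xi>. rhankel j \<xi> * \<phi> m \<xi> \<partial>\<mu>)\<^sup>2 \<le> N * (\<integral>\<xi>. (\<phi> m \<xi>)\<^sup>2 \<partial>\<mu>)" for m
      unfolding \<phi>_span N_def A_def by (rule rhankel_span_bound) simp
    then have *: "(\<integral>\<xi>. rhankel j \<xi> * \<psi> \<xi> \<partial>\<mu>)\<^sup>2 \<le> N * (\<integral>\<xi>. (\<psi> \<xi>)\<^sup>2 \<partial>\<mu>)"
      by (intro LIMSEQ_le[OF tendsto_power[OF l1] tendsto_mult[OF tendsto_const l2]]) auto
    have ae: "AE \<xi> in \<mu>. \<psi> \<xi> = \<eta> l (exp (- rad \<xi>)) * rhankel j \<xi>"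
      using AE_mu_nonzero
    proof eventually_elim
      case (elim \<xi>)
      define t where "t = exp (- rad \<xi>)"
      have "\<zeta> t = \<bar>\<xi>\<bar>" using n_pos by (simp add: \<zeta>_def t_def rad_def powr_powr)
      then have "H t = \<eta> l t * (rhankel j \<bar>\<xi>\<bar> / \<bar>\<xi>\<bar> ^ j) / t\<^sup>2" by (simp add: H_def)
      moreover have "G t = H t"
        by (auto simp: G_def H_def \<eta>_def)
      moreover have "v \<xi> = \<xi> ^ j * t\<^sup>2"
        by (simp add: v_def t_def exp_double[symmetric])
      moreover have "t \<noteq> 0" by (simp add: t_def)
      ultimately have "v \<xi> * G t = \<eta> l t * (\<xi> ^ j * (rhankel j \<bar>\<xi>\<bar> / \<bar>\<xi>\<bar> ^ j))"
        by simp
      also have "\<dots> = \<eta> l t * rhankel j \<xi>" using rhankel_scaling[OF elim, of j] by simp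
      finally show ?case by (simp add: \<psi>_def t_def)
    qed
    have ae1: "AE \<xi> in \<mu>. rhankel j \<xi> * \<psi> \<xi> = \<eta> l (exp (- rad \<xi>)) * (rhankel j \<xi>)\<^sup>2"
      using ae by eventually_elim (simp add: power2_eq_square)
    have i3: "integrable \<mu> (\<lambda>\<xi>. \<eta> l (exp (- rad \<xi>)) * (rhankel j \<xi>)\<^sup>2)"
      using i1 by (subst integrable_cong_AE[OF _ _ ae1, symmetric]) auto
    define I where "I = (\<integral>\<xi>. \<eta> l (exp (- rad \<xi>)) * (rhankel j \<xi>)\<^sup>2 \<partial>\<mu>)"
    have I1: "(\<integral>\<xi>. rhankel j \<xi> * \<psi> \<xi> \<partial>\<mu>) = I"
      unfolding I_def by (rule integral_cong_AE[OF _ _ ae1]) auto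
    have I2: "(\<integral>\<xi>. (\<psi> \<xi>)\<^sup>2 \<partial>\<mu>) \<le> I"
      unfolding I_def
    proof (rule integral_mono_AE[OF i2 i3])
      show "AE \<xi> in \<mu>. (\<psi> \<xi>)\<^sup>2 \<le> \<eta> l (exp (- rad \<xi>)) * (rhankel j \<xi>)\<^sup>2"
        using ae
      proof eventually_elim
        case (elim \<xi>)
        have "(\<eta> l (exp (- rad \<xi>)))\<^sup>2 \<le> \<eta> l (exp (- rad \<xi>))"
          using \<eta>01[of l "exp (- rad \<xi>)"] by (simp add: power2_eq_square mult_left_le)
        then show ?case unfolding elim power_mult_distrib by (rule mult_right_mono) simp
      qed
    qed
    have N0: "N \<ge> 0" by (simp add: N_def A_def)
    have I0: "I \<ge> 0" unfolding I_def using \<eta>01 by (intro integral_nonneg_AE) auto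
    \<comment> \<open>A bootstrap: the cutoff ensures that \<open>I\<close> is finite, since
      \<open>i3\<close> gives integrability, so one factor \<open>I\<close> can be cancelled and the
      bound \<open>N\<close> does not depend on \<open>l\<close>.\<close>
    have "I * I \<le> N * I"
      using * mult_left_mono[OF I2 N0] by (simp add: I1 power2_eq_square)
    then have "I \<le> N" using I0 N0 by (cases "I = 0") auto
    then show ?thesis using i3 by (simp add: I_def)
  qed
  have mono: "\<eta> l t \<le> \<eta> l' t" if "l \<le> l'" "t \<in> {0..1}" for l l' t
  proof -
    have "real l * (t * (1 - t)) \<le> real l' * (t * (1 - t))"
      using that by (intro mult_right_mono) auto
    then show ?thesis by (simp add: \<eta>_def)
  qed
  let ?I = "\<lambda>l. \<integral>\<xi>. \<eta> l (exp (- rad \<xi>)) * (rhankel j \<xi>)\<^sup>2 \<partial>\<mu>"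
  have inc: "incseq ?I"
  proof (rule incseq_SucI)
    fix l show "?I l \<le> ?I (Suc l)"
      using main by (intro integral_mono mult_right_mono mono) auto
  qed
  obtain L where L: "?I \<longlonglongrightarrow> L"
    using incseq_convergent[OF inc, of N] main by blast
  show ?thesis
  proof (rule integrable_monotone_convergence[OF _ _ _ L])
    show "AE \<xi> in \<mu>. mono (\<lambda>l. \<eta> l (exp (- rad \<xi>)) * (rhankel j \<xi>)\<^sup>2)"
      by (intro AE_I2 monoI mult_right_mono mono) auto
    show "AE \<xi> in \<mu>. (\<lambda>l. \<eta> l (exp (- rad \<xi>)) * (rhankel j \<xi>)\<^sup>2) \<longlonglongrightarrow> (rhankel j \<xi>)\<^sup>2"
      using AE_mu_nonzero
    proof eventually_elim
      case (elim \<xi>)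
      define t where "t = exp (- rad \<xi>)"
      have "rad \<xi> > 0" using elim by (simp add: rad_def)
      then have t: "t * (1 - t) > 0" by (simp add: t_def)
      obtain l0 where l0: "real l0 > 2 / (t * (1 - t))" using reals_Archimedean2 by blast
      have "\<eta> l t = 1" if "l \<ge> l0" for l
      proof -
        have "2 / (t * (1 - t)) \<le> real l" using l0 that by simp
        then have "2 \<le> real l * (t * (1 - t))" using t by (simp add: field_simps)
        then show ?thesis by (simp add: \<eta>_def)
      qed
      then have "\<forall>\<^sub>F l in sequentially. \<eta> l t * (rhankel j \<xi>)\<^sup>2 = (rhankel j \<xi>)\<^sup>2"
        unfolding eventually_sequentially by (intro exI[of _ l0]) simp
      then show ?case unfolding t_def by (rule tendsto_eventually)
    qed
  qed (use main in auto)
qed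

end
end

section \<open>The unitary extension\<close>

lemma integral_lborel_reflect:
  fixes f :: "real \<Rightarrow> 'b::{banach,second_countable_topology}"
  assumes [measurable]: "f \<in> borel_measurable borel"
  shows "(\<integral>x. f (- x) \<partial>lborel) = (\<integral>x. f x \<partial>lborel)"
  using integral_distr[of uminus lborel borel f] by (simp add: lborel_distr_uminus)

lemma memL_2_add:
  assumes "memL k n 2 f" "memL k n 2 g"
  shows "memL k n 2 (\<lambda>x. f x + g x)"
proof -
  have [measurable]: "f \<in> borel_measurable (mu_kn k n)" "g \<in> borel_measurable (mu_kn k n)"
    and i: "integrable (mu_kn k n) (\<lambda>x. 2 * (norm (f x))\<^sup>2 + 2 * (norm (g x))\<^sup>2)"
    using assms by (auto simp: memL_2_iff)
  have "(norm (a + b))\<^sup>2 \<le> 2 * (norm a)\<^sup>2 + 2 * (norm b)\<^sup>2" for a b :: complex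
  proof -
    have "(norm (a + b))\<^sup>2 \<le> (norm a + norm b)\<^sup>2"
      by (intro power_mono norm_triangle_ineq) auto
    also have "\<dots> \<le> 2 * (norm a)\<^sup>2 + 2 * (norm b)\<^sup>2"
      using sum_squares_bound[of "norm a" "norm b"] by (simp add: power2_sum)
    finally show ?thesis .
  qed
  then have "integrable (mu_kn k n) (\<lambda>x. (norm (f x + g x))\<^sup>2)"
    by (intro Bochner_Integration.integrable_bound[OF i]) (auto intro!: AE_I2)
  then show ?thesis by (auto simp: memL_2_iff)
qed

lemma memL_2_cmult:
  assumes "memL k n 2 f"
  shows "memL k n 2 (\<lambda>x. c * f x)"
  using assms by (auto simp: memL_2_iff norm_mult power_mult_distrib)

lemma memL_2_diff:
  assumes "memL k n 2 f" "memL k n 2 g"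
  shows "memL k n 2 (\<lambda>x. f x - g x)"
  using memL_2_add[OF assms(1) memL_2_cmult[OF assms(2), of "-1"]] by simp

lemma memL_2_bound:
  assumes "memL k n 2 f" "g \<in> borel_measurable (mu_kn k n)" "\<And>x. norm (g x) \<le> norm (f x)"
  shows "memL k n 2 g"
  using assms unfolding memL_2_iff
  by (auto intro!: Bochner_Integration.integrable_bound[of _ "\<lambda>x. (norm (f x))\<^sup>2" "\<lambda>x. (norm (g x))\<^sup>2"] AE_I2 power_mono)

context kn_params begin

lemma gauss_pair_add:
  assumes "memL k n 2 f" "memL k n 2 g" "Re p > 0"
  shows "gauss_pair j (\<lambda>x. f x + g x) p = gauss_pair j f p + gauss_pair j g p"
  using gauss_pair_integrable[OF assms(1,3), of j] gauss_pair_integrable[OF assms(2,3), of j]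
  by (simp add: gauss_pair_def distrib_right)

lemma gauss_pair_cmult: "gauss_pair j (\<lambda>x. c * f x) p = c * gauss_pair j f p"
  by (simp add: gauss_pair_def mult.assoc)

lemma gauss_pair_diff:
  assumes "memL k n 2 f" "memL k n 2 g" "Re p > 0"
  shows "gauss_pair j (\<lambda>x. f x - g x) p = gauss_pair j f p - gauss_pair j g p"
  using gauss_pair_integrable[OF assms(1,3), of j] gauss_pair_integrable[OF assms(2,3), of j]
  by (simp add: gauss_pair_def left_diff_distrib)

lemma gauss_pair_cong_AE:
  assumes "AE x in \<mu>. f x = g x" "f \<in> borel_measurable borel" "g \<in> borel_measurable borel"
  shows "gauss_pair j f p = gauss_pair j g p"
  unfolding gauss_pair_def using assms by (intro integral_cong_AE) auto

text \<open>The weight is even, so reflection changes the sign of the integral.\<close>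

lemma integral_mu_odd:
  fixes h :: "real \<Rightarrow> complex"
  assumes [measurable]: "h \<in> borel_measurable borel" and odd: "\<And>x. h (- x) = - h x"
  shows "(\<integral>x. h x \<partial>\<mu>) = 0"
proof -
  define D where "D x = (real n / 2) powr \<alpha> / (2 * Gamma (\<alpha> + 1)) * \<bar>x\<bar> powr (2 * k + 2 / real n - 2)" for x :: real
  have [measurable]: "D \<in> borel_measurable borel" unfolding D_def by measurable
  have "(\<integral>x. h x \<partial>\<mu>) = (\<integral>x. D x *\<^sub>R h x \<partial>lborel)"
    unfolding mu_kn_def D_def[symmetric] using Gamma_alpha_pos
    by (intro integral_density) (auto simp: D_def)
  moreover have "(\<integral>x. D (- x) *\<^sub>R h (- x) \<partial>lborel) = (\<integral>x. D x *\<^sub>R h x \<partial>lborel)"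
    by (rule integral_lborel_reflect) measurable
  moreover have "(\<integral>x. D (- x) *\<^sub>R h (- x) \<partial>lborel) = - (\<integral>x. D x *\<^sub>R h x \<partial>lborel)"
    by (simp add: odd D_def)
  ultimately show ?thesis by simp
qed

lemma memL_2_Re_Im:
  assumes "memL k n 2 f"
  shows "memL k n 2 (\<lambda>x. of_real (Re (f x)))" "memL k n 2 (\<lambda>x. of_real (Im (f x)))"
proof -
  have [measurable]: "f \<in> borel_measurable borel" using assms by (simp add: memL_2_iff)
  show "memL k n 2 (\<lambda>x. of_real (Re (f x)))" "memL k n 2 (\<lambda>x. of_real (Im (f x)))"
    by (auto intro!: memL_2_bound[OF assms] simp: abs_Re_le_cmod abs_Im_le_cmod)
qed

lemma hankel_memL:
  assumes f: "memL k n 2 f" and R: "\<forall>x. \<bar>x\<bar> > R \<longrightarrow> f x = 0"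
  shows "memL k n 2 (hankel j f)"
proof -
  have R': "\<forall>x. \<bar>x\<bar> > R \<longrightarrow> Re (f x) = 0" "\<forall>x. \<bar>x\<bar> > R \<longrightarrow> Im (f x) = 0"
    using R by auto
  have real: "memL k n 2 (hankel j (\<lambda>x. of_real (g x)))"
    if "memL k n 2 (\<lambda>x. complex_of_real (g x))" "\<forall>x. \<bar>x\<bar> > R \<longrightarrow> g x = 0" for g
  proof -
    have "hankel j (\<lambda>x. of_real (g x)) = (\<lambda>\<xi>. of_real (rhankel g j \<xi>))"
      by (intro ext hankel_real[OF that])
    then show ?thesis
      using rhankel_sq_integrable[OF that, of j] rhankel_measurable[OF that, of j]
      by (simp add: memL_2_iff)
  qed
  have "hankel j f = (\<lambda>\<xi>. hankel j (\<lambda>x. of_real (Re (f x))) \<xi> + \<i> * hankel j (\<lambda>x. of_real (Im (f x))) \<xi>)"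
  proof
    fix \<xi>
    have "hankel j f \<xi> = (\<integral>x. of_real (Re (f x)) * of_real (ker j x \<xi>) + \<i> * (of_real (Im (f x)) * of_real (ker j x \<xi>)) \<partial>\<mu>)"
      unfolding hankel_def
      by (intro Bochner_Integration.integral_cong refl, subst complex_eq) (simp add: algebra_simps)
    also have "\<dots> = hankel j (\<lambda>x. of_real (Re (f x))) \<xi> + \<i> * hankel j (\<lambda>x. of_real (Im (f x))) \<xi>"
      unfolding hankel_def
      by (subst Bochner_Integration.integral_add)
         (use hankel_integrable[OF memL_2_Re_Im(1)[OF f], of R j \<xi>] hankel_integrable[OF memL_2_Re_Im(2)[OF f], of R j \<xi>] R'
          in \<open>auto intro!: integrable_mult_right simp del: of_real_mult\<close>)
    finally show "hankel j f \<xi> = hankel j (\<lambda>x. of_real (Re (f x))) \<xi> + \<i> * hankel j (\<lambda>x. of_real (Im (f x))) \<xi>" .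
  qed
  then show ?thesis
    using real[OF memL_2_Re_Im(1)[OF f] R'(1)] real[OF memL_2_Re_Im(2)[OF f] R'(2)]
    by (auto intro!: memL_2_add memL_2_cmult)
qed

section \<open>The full transform in terms of its two parity components\<close>

definition ft_coef :: "nat \<Rightarrow> complex" where
  "ft_coef j = (if j = 0 then 1 else (- \<i>) ^ n * of_real ((real n / 2) ^ n * Gamma (\<alpha> + 1) / Gamma (\<alpha> + real n + 1)))"

lemma ft_coef_nonzero: "ft_coef j \<noteq> 0"
proof -
  have "Gamma (\<alpha> + real n + 1) > 0"
    using alpha_gt n_pos by (intro Gamma_real_pos) simp
  then show ?thesis
    using Gamma_alpha_pos n_pos by (simp add: ft_coef_def)
qed

lemma FT1_hankel:
  assumes f: "memL k n 2 f" and R: "\<forall>x. \<bar>x\<bar> > R \<longrightarrow> f x = 0"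
  shows "FT1 k n f \<xi> = ft_coef 0 * hankel 0 f \<xi> + ft_coef 1 * hankel 1 f \<xi>"
proof -
  have "f x * kernel_B k n x \<xi> = ft_coef 0 * (f x * of_real (ker 0 x \<xi>)) + ft_coef 1 * (f x * of_real (ker 1 x \<xi>))" for x
    by (simp add: kernel_B_def ft_coef_def ker_def \<beta>_def algebra_simps)
  then show ?thesis
    using hankel_integrable[OF f R, of 0 \<xi>] hankel_integrable[OF f R, of 1 \<xi>]
    by (simp add: FT1_def hankel_def integrable_mult_right)
qed

lemma FT1_memL:
  assumes f: "memL k n 2 f" and R: "\<forall>x. \<bar>x\<bar> > R \<longrightarrow> f x = 0"
  shows "memL k n 2 (FT1 k n f)"
proof -
  have "FT1 k n f = (\<lambda>\<xi>. ft_coef 0 * hankel 0 f \<xi> + ft_coef 1 * hankel 1 f \<xi>)"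
    by (intro ext FT1_hankel[OF f R])
  then show ?thesis by (simp add: memL_2_add memL_2_cmult hankel_memL[OF f R])
qed

lemma hankel_parity: "hankel j f (- \<xi>) = (-1) ^ j * hankel j f \<xi>"
proof -
  have "ker j x (- \<xi>) = (-1) ^ j * ker j x \<xi>" for x
    by (simp add: ker_def power_minus[of "x * \<xi>" j])
  then show ?thesis
    unfolding hankel_def integral_mult_right_zero[symmetric] by (simp add: mult_ac)
qed

text \<open>By parity the Gaussian of degree \<open>j\<close> is orthogonal to the transform
  component of degree \<open>1 - j\<close>; the remaining component obeys
  \<open>hankel_dual\<close>.\<close>

lemma FT1_pair:
  assumes f: "memL k n 2 f" and R: "\<forall>x. \<bar>x\<bar> > R \<longrightarrow> f x = 0" and s: "s > 0" and j: "j < 2"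
  shows "gauss_pair j (FT1 k n f) (of_real s)
    = ft_coef j * of_real (\<kappa> * Gamma (\<beta> j + 1) * s powr - (\<beta> j + 1)) * gauss_pair j f (of_real ((real n)\<^sup>2 / (4 * s)))"
proof -
  have hm: "memL k n 2 (hankel i f)" for i by (rule hankel_memL[OF f R])
  have [measurable]: "hankel i f \<in> borel_measurable borel" for i
    using hm[of i] by (simp add: memL_2_iff)
  have same: "gauss_pair i (hankel i f) (of_real s) = of_real (\<kappa> * Gamma (\<beta> i + 1) * s powr - (\<beta> i + 1)) * gauss_pair i f (of_real ((real n)\<^sup>2 / (4 * s)))" for i
  proof -
    have eq: "complex_of_real (\<xi> ^ i) * exp (- of_real s * of_real (rad \<xi>)) = of_real (\<xi> ^ i * exp (- s * rad \<xi>))" for \<xi>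
      by (simp flip: exp_of_real)
    show ?thesis
      using hankel_dual[OF f R s, of i] unfolding gauss_pair_def[of i "hankel i f"] eq .
  qed
  have cross: "gauss_pair i (hankel (1 - i) f) (of_real s) = 0" if "i < 2" for i
    unfolding gauss_pair_def using that
    by (intro integral_mu_odd) (auto simp: hankel_parity less_2_cases_iff)
  have "FT1 k n f = (\<lambda>\<xi>. ft_coef 0 * hankel 0 f \<xi> + ft_coef 1 * hankel 1 f \<xi>)"
    by (intro ext FT1_hankel[OF f R])
  then have "gauss_pair j (FT1 k n f) (of_real s) = ft_coef 0 * gauss_pair j (hankel 0 f) (of_real s) + ft_coef 1 * gauss_pair j (hankel 1 f) (of_real s)"
    using s by (simp add: gauss_pair_add gauss_pair_cmult memL_2_cmult hm)
  also have "\<dots> = ft_coef j * gauss_pair j (hankel j f) (of_real s)"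
    using j cross[of 0] cross[of 1] by (auto simp: less_2_cases_iff)
  finally show ?thesis unfolding same by (simp add: mult_ac)
qed

text \<open>Passage to the limit over truncations of \<open>f\<close>. The left side converges by
  \<open>gauss_pair_bound\<close>, where \<open>FT1_memL\<close> guarantees that
  \<open>L2norm\<close> of the error is a true norm; the right side converges by domination.\<close>

lemma FT2_pair:
  assumes f: "memL k n 2 f" and g: "FT2 k n f g" and s: "s > 0" and j: "j < 2"
  shows "gauss_pair j g (of_real s)
    = ft_coef j * of_real (\<kappa> * Gamma (\<beta> j + 1) * s powr - (\<beta> j + 1)) * gauss_pair j f (of_real ((real n)\<^sup>2 / (4 * s)))"
proof -
  define p where "p = (real n)\<^sup>2 / (4 * s)"
  have p: "p > 0" using s n_pos by (simp add: p_def)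
  define fR where "fR R x = indicator {-R..R} x * f x" for R x
  have [measurable]: "f \<in> borel_measurable borel" using f by (simp add: memL_2_iff)
  have fR: "memL k n 2 (fR R)" for R
    unfolding fR_def by (rule memL_2_bound[OF f]) (auto simp: indicator_def)
  have supp: "\<forall>x. \<bar>x\<bar> > R \<longrightarrow> fR R x = 0" for R by (auto simp: fR_def indicator_def)
  have gm: "memL k n 2 g" using g by (simp add: FT2_def)
  have lim0: "((\<lambda>R. L2norm k n (\<lambda>\<xi>. FT1 k n (fR R) \<xi> - g \<xi>)) \<longlongrightarrow> 0) at_top"
    using g by (simp add: FT2_def fR_def[abs_def])
  define K where "K = sqrt (\<kappa> * Gamma (\<beta> j + 1) * (2 * s) powr - (\<beta> j + 1))"
  have "((\<lambda>R. gauss_pair j (FT1 k n (fR R)) (of_real s) - gauss_pair j g (of_real s)) \<longlongrightarrow> 0) at_top"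
  proof (rule Lim_null_comparison)
    show "((\<lambda>R. L2norm k n (\<lambda>\<xi>. FT1 k n (fR R) \<xi> - g \<xi>) * K) \<longlongrightarrow> 0) at_top"
      using tendsto_mult[OF lim0 tendsto_const[of K]] by simp
    have "norm (gauss_pair j (FT1 k n (fR R)) (of_real s) - gauss_pair j g (of_real s)) \<le> L2norm k n (\<lambda>\<xi>. FT1 k n (fR R) \<xi> - g \<xi>) * K" for R
      using gauss_pair_bound[OF memL_2_diff[OF FT1_memL[OF fR supp] gm], of "of_real s" j R] s
      by (subst gauss_pair_diff[symmetric]) (auto simp: K_def gm FT1_memL[OF fR supp])
    then show "\<forall>\<^sub>F R in at_top. norm (gauss_pair j (FT1 k n (fR R)) (of_real s) - gauss_pair j g (of_real s)) \<le> L2norm k n (\<lambda>\<xi>. FT1 k n (fR R) \<xi> - g \<xi>) * K"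
      by (rule always_eventually[OF allI])
  qed
  then have l1: "((\<lambda>R. gauss_pair j (FT1 k n (fR R)) (of_real s)) \<longlongrightarrow> gauss_pair j g (of_real s)) at_top"
    by (simp add: LIM_zero_iff)
  have "((\<lambda>R. gauss_pair j (fR R) (of_real p)) \<longlongrightarrow> gauss_pair j f (of_real p)) at_top"
    unfolding gauss_pair_def
  proof (rule integral_dominated_convergence_at_top)
    show "integrable \<mu> (\<lambda>x. norm (f x * (of_real (x ^ j) * exp (- of_real p * complex_of_real (rad x)))))"
      by (intro integrable_norm gauss_pair_integrable f) (simp add: p)
    show "\<forall>\<^sub>F R in at_top. AE x in \<mu>. norm (fR R x * (of_real (x ^ j) * exp (- of_real p * complex_of_real (rad x))))
        \<le> norm (f x * (of_real (x ^ j) * exp (- of_real p * complex_of_real (rad x))))"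
      by (intro always_eventually allI AE_I2) (auto simp: fR_def norm_mult indicator_def)
    show "AE x in \<mu>. ((\<lambda>R. fR R x * (of_real (x ^ j) * exp (- of_real p * complex_of_real (rad x)))) \<longlongrightarrow>
        f x * (of_real (x ^ j) * exp (- of_real p * complex_of_real (rad x)))) at_top"
    proof (rule AE_I2)
      fix x
      have "\<forall>\<^sub>F R in at_top. fR R x = f x"
        using eventually_ge_at_top[of "\<bar>x\<bar>"] by eventually_elim (auto simp: fR_def indicator_def)
      then show "((\<lambda>R. fR R x * (of_real (x ^ j) * exp (- of_real p * complex_of_real (rad x)))) \<longlongrightarrow>
        f x * (of_real (x ^ j) * exp (- of_real p * complex_of_real (rad x)))) at_top"
        by (intro tendsto_eventually) (auto elim: eventually_mono)
    qed
  qed (auto simp: fR_def[abs_def])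
  then have "((\<lambda>R. gauss_pair j (FT1 k n (fR R)) (of_real s)) \<longlongrightarrow>
      ft_coef j * of_real (\<kappa> * Gamma (\<beta> j + 1) * s powr - (\<beta> j + 1)) * gauss_pair j f (of_real p)) at_top"
    unfolding FT1_pair[OF fR supp s j] p_def[symmetric] by (intro tendsto_intros)
  then show ?thesis
    unfolding p_def using l1 by (intro tendsto_unique[OF _ l1]) auto
qed

text \<open>In the variable \<open>s\<close> the Gaussian pairing turns \<open>wlap\<close> into \<open>d/ds\<close>.\<close>

definition heat_pair :: "nat \<Rightarrow> (real \<Rightarrow> complex) \<Rightarrow> real \<Rightarrow> complex" where
  "heat_pair j f s = of_real (s powr - (\<beta> j + 1)) * gauss_pair j f (of_real ((real n)\<^sup>2 / (4 * s)))"

text \<open>By \<open>FT2_pair\<close>, \<open>heat_pair j f s\<close> is a constant times the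
  pairing of the transform of \<open>f\<close> with the Gaussian of parameter \<open>s\<close>.
  Differentiation brings down \<open>- rad\<close>, which is the multiplier that defines
  \<open>is_wlap\<close>.\<close>

lemma heat_pair_has_derivative:
  assumes w: "is_wlap k n f g" and s: "s > 0" and j: "j < 2"
  shows "(heat_pair j f has_vector_derivative heat_pair j g s) (at s)"
proof -
  obtain Ff Fg where f: "memL k n 2 f" and g: "memL k n 2 g" and Ff: "FT2 k n f Ff" and Fg: "FT2 k n g Fg"
    and ae: "AE \<xi> in \<mu>. Fg \<xi> = - complex_of_real (\<bar>\<xi>\<bar> powr (2 / real n)) * Ff \<xi>"
    using w by (auto simp: is_wlap_def)
  define c where "c = ft_coef j * of_real (\<kappa> * Gamma (\<beta> j + 1))"
  have c: "c \<noteq> 0" using ft_coef_nonzero kappa_pos Gamma_beta_pos[of j] by (simp add: c_def)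
  have Ffm: "memL k n 2 Ff" and Fgm: "memL k n 2 Fg" using Ff Fg by (auto simp: FT2_def)
  have [measurable]: "Ff \<in> borel_measurable borel" "Fg \<in> borel_measurable borel"
    using Ffm Fgm by (auto simp: memL_2_iff)
  have qf: "heat_pair j f t = inverse c * gauss_pair j Ff (of_real t)" if "t > 0" for t
    unfolding FT2_pair[OF f Ff that j] heat_pair_def c_def[symmetric] of_real_mult using c
    by (simp add: c_def field_simps)
  have qg: "heat_pair j g t = inverse c * gauss_pair j Fg (of_real t)" if "t > 0" for t
    unfolding FT2_pair[OF g Fg that j] heat_pair_def c_def[symmetric] of_real_mult using c
    by (simp add: c_def field_simps)
  have "gauss_pair j Fg (of_real s) = gauss_pair j (\<lambda>x. - of_real (rad x) * Ff x) (of_real s)"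
    using ae by (intro gauss_pair_cong_AE) (auto simp: rad_def)
  moreover have "(gauss_pair j Ff has_field_derivative gauss_pair j (\<lambda>x. - of_real (rad x) * Ff x) (of_real s)) (at (of_real s))"
    using s by (intro gauss_pair_has_derivative Ffm) simp
  ultimately have "((\<lambda>t. gauss_pair j Ff (of_real t)) has_vector_derivative gauss_pair j Fg (of_real s)) (at s)"
    by (auto intro: has_vector_derivative_real_field)
  then have "((\<lambda>t. inverse c * gauss_pair j Ff (of_real t)) has_vector_derivative inverse c * gauss_pair j Fg (of_real s)) (at s)"
    by (rule has_vector_derivative_mult_right)
  then show ?thesis
    unfolding qg[OF s]
    by (rule has_vector_derivative_transform_within_open[where S = "{0<..}"]) (use s qf in auto)
qed

end

section \<open>Uniqueness for Gaussian pairings\<close>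

context kn_params begin

text \<open>With \<open>t = exp (- rad x)\<close>, the vanishing pairings for integer parameters
  make \<open>h\<close> orthogonal to all polynomials in \<open>t\<close>, hence to continuous
  functions of \<open>t\<close>. The ramps \<open>G l\<close> then converge to the indicator of
  \<open>t < exp (- a)\<close>, that is of \<open>rad x > a\<close>.\<close>

lemma gauss_pairings_determine_tails:
  fixes g :: "real \<Rightarrow> real"
  assumes [measurable]: "g \<in> borel_measurable borel" and g2: "integrable \<mu> (\<lambda>x. (g x)\<^sup>2)"
    and zero: "\<And>p. p > 0 \<Longrightarrow> (\<integral>x. g x * (x ^ j * exp (- p * rad x)) \<partial>\<mu>) = 0"
  shows "integrable \<mu> (\<lambda>x. g x * (x ^ j * exp (- rad x)))"
    and "(\<integral>x. g x * (x ^ j * exp (- rad x)) * indicator {a<..} (rad x) \<partial>\<mu>) = 0"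
proof -
  have gi: "integrable \<mu> (\<lambda>x. g x * (x ^ j * exp (- q * rad x)))" if "q > 0" for q
  proof (rule cauchy_schwarz_integral(1))
    show "integrable \<mu> (\<lambda>x. (norm (x ^ j * exp (- q * rad x)))\<^sup>2)"
      using gauss_inner[OF that that, of j] by (simp add: has_bochner_integral_iff power2_eq_square)
  qed (use g2 in auto)
  define h where "h x = g x * (x ^ j * exp (- rad x))" for x
  have [measurable]: "h \<in> borel_measurable borel" unfolding h_def by measurable
  have hi: "integrable \<mu> h" using gi[of 1] by (simp add: h_def[abs_def])
  then show "integrable \<mu> (\<lambda>x. g x * (x ^ j * exp (- rad x)))" by (simp add: h_def[abs_def])
  have e01: "exp (- rad x) \<in> {0..1}" for x by auto
  have cont: "(\<integral>x. h x * G (exp (- rad x)) \<partial>\<mu>) = 0"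
    if G: "continuous_on {0..1} G" and [measurable]: "G \<in> borel_measurable borel" for G :: "real \<Rightarrow> real"
  proof -
    obtain b d B where lim: "\<And>t. t \<in> {0..1} \<Longrightarrow> (\<lambda>m. \<Sum>i\<le>d m. b m i * t ^ i) \<longlonglongrightarrow> G t"
      and bd: "\<And>t m. t \<in> {0..1} \<Longrightarrow> \<bar>\<Sum>i\<le>d m. b m i * t ^ i\<bar> \<le> B"
      using weierstrass_sequence[OF G] by blast
    have "(\<lambda>m. \<integral>x. h x * (\<Sum>i\<le>d m. b m i * exp (- rad x) ^ i) \<partial>\<mu>) \<longlonglongrightarrow> (\<integral>x. h x * G (exp (- rad x)) \<partial>\<mu>)"
    proof (rule integral_dominated_convergence)
      show "integrable \<mu> (\<lambda>x. \<bar>h x\<bar> * B)" using hi by (intro integrable_mult_left integrable_abs)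
      show "AE x in \<mu>. (\<lambda>m. h x * (\<Sum>i\<le>d m. b m i * exp (- rad x) ^ i)) \<longlonglongrightarrow> h x * G (exp (- rad x))"
        by (intro AE_I2 tendsto_mult tendsto_const lim e01)
      show "AE x in \<mu>. norm (h x * (\<Sum>i\<le>d m. b m i * exp (- rad x) ^ i)) \<le> \<bar>h x\<bar> * B" for m
        unfolding real_norm_def abs_mult by (intro AE_I2 mult_left_mono bd e01) auto
    qed auto
    moreover have "(\<integral>x. h x * (\<Sum>i\<le>d m. b m i * exp (- rad x) ^ i) \<partial>\<mu>) = 0" for m
    proof -
      have "h x * (\<Sum>i\<le>d m. b m i * exp (- rad x) ^ i) = (\<Sum>i\<le>d m. b m i * (g x * (x ^ j * exp (- real (Suc i) * rad x))))" for x
        unfolding h_def sum_distrib_left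
        by (intro sum.cong) (auto simp: exp_of_nat_mult[symmetric] exp_add[symmetric] algebra_simps)
      moreover have "(\<integral>x. (\<Sum>i\<le>d m. b m i * (g x * (x ^ j * exp (- real (Suc i) * rad x)))) \<partial>\<mu>) = 0"
        by (subst Bochner_Integration.integral_sum) (use gi zero in \<open>auto simp del: of_nat_Suc\<close>)
      ultimately show ?thesis by simp
    qed
    ultimately show ?thesis by (simp add: LIMSEQ_const_iff)
  qed
  define G where "G l t = min 1 (max 0 (real l * (exp (- a) - t)))" for l :: nat and t :: real
  have "(\<lambda>l. \<integral>x. h x * G l (exp (- rad x)) \<partial>\<mu>) \<longlonglongrightarrow> (\<integral>x. h x * indicator {a<..} (rad x) \<partial>\<mu>)"
  proof (rule integral_dominated_convergence)
    show "integrable \<mu> (\<lambda>x. \<bar>h x\<bar>)" using hi by (rule integrable_abs)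
    show "AE x in \<mu>. norm (h x * G l (exp (- rad x))) \<le> \<bar>h x\<bar>" for l
      by (intro AE_I2) (auto simp: abs_mult G_def intro!: mult_left_le)
    show "AE x in \<mu>. (\<lambda>l. h x * G l (exp (- rad x))) \<longlonglongrightarrow> h x * indicator {a<..} (rad x)"
    proof (intro AE_I2 tendsto_mult tendsto_const)
      fix x
      show "(\<lambda>l. G l (exp (- rad x))) \<longlonglongrightarrow> indicator {a<..} (rad x)"
      proof (cases "rad x > a")
        case True
        then have pos: "exp (- a) - exp (- rad x) > 0" by simp
        obtain l0 where l0: "real l0 > 1 / (exp (- a) - exp (- rad x))" using reals_Archimedean2 by blast
        have "G l (exp (- rad x)) = 1" if "l \<ge> l0" for l
        proof -
          have "1 / (exp (- a) - exp (- rad x)) \<le> real l" using l0 that by simp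
          then have "1 \<le> real l * (exp (- a) - exp (- rad x))" using pos by (simp add: field_simps)
          then show ?thesis by (simp add: G_def)
        qed
        then have "\<forall>\<^sub>F l in sequentially. G l (exp (- rad x)) = indicator {a<..} (rad x)"
          unfolding eventually_sequentially using True by (intro exI[of _ l0]) simp
        then show ?thesis by (rule tendsto_eventually)
      next
        case False
        then have "real l * (exp (- a) - exp (- rad x)) \<le> 0" for l :: nat
          by (intro mult_nonneg_nonpos) auto
        then have "G l (exp (- rad x)) = 0" for l by (simp add: G_def max_absorb1)
        then show ?thesis using False by simp
      qed
    qed
  qed (auto simp: G_def)
  moreover have "(\<integral>x. h x * G l (exp (- rad x)) \<partial>\<mu>) = 0" for l
    by (rule cont) (auto simp: G_def[abs_def] intro!: continuous_intros)
  ultimately show "(\<integral>x. g x * (x ^ j * exp (- rad x)) * indicator {a<..} (rad x) \<partial>\<mu>) = 0"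
    by (simp add: LIMSEQ_const_iff h_def)
qed

text \<open>Functions of \<open>rad\<close> cannot separate \<open>x\<close> from
  \<open>- x\<close>, so each \<open>j\<close> controls a sum over the two points:
  \<open>j = 0\<close> kills the even part of \<open>g\<close> and \<open>j = 1\<close> the odd
  part.\<close>

lemma real_gauss_pairings_unique:
  fixes g :: "real \<Rightarrow> real"
  assumes [measurable]: "g \<in> borel_measurable borel" and g2: "integrable \<mu> (\<lambda>x. (g x)\<^sup>2)"
    and zero: "\<And>j p. j < 2 \<Longrightarrow> p > 0 \<Longrightarrow> (\<integral>x. g x * (x ^ j * exp (- p * rad x)) \<partial>\<mu>) = 0"
  shows "AE x in \<mu>. g x = 0"
proof -
  define D where "D x = (real n / 2) powr \<alpha> / (2 * Gamma (\<alpha> + 1)) * \<bar>x\<bar> powr (2 * k + 2 / real n - 2)" for x :: real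
  have [measurable]: "D \<in> borel_measurable borel" unfolding D_def by measurable
  have D0: "D x \<ge> 0" for x using Gamma_alpha_pos by (simp add: D_def)
  have Dpos: "D x > 0" if "x \<noteq> 0" for x using Gamma_alpha_pos n_pos that by (simp add: D_def)
  have Dm: "D (- x) = D x" for x by (simp add: D_def)
  define h where "h j x = D x * (g x * (x ^ j * exp (- rad x)))" for j x
  have [measurable]: "h j \<in> borel_measurable borel" for j unfolding h_def by measurable
  have hi: "integrable lborel (h j)" if "j < 2" for j
  proof -
    have "integrable \<mu> (\<lambda>x. g x * (x ^ j * exp (- rad x)))"
      by (rule gauss_pairings_determine_tails(1)[OF assms(1) g2 zero]) (use that in auto)
    then show ?thesis
      using D0 unfolding mu_kn_def D_def[symmetric] h_def by (subst (asm) integrable_density) auto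
  qed
  have him: "integrable lborel (\<lambda>x. h j (- x))" if "j < 2" for j
    using hi[OF that] lborel_integrable_real_affine_iff[of "-1" "h j" 0] by simp
  have tail: "(\<integral>x. h j x * indicator {a<..} (rad x) \<partial>lborel) = 0" if "j < 2" for j a
  proof -
    have "(\<integral>x. g x * (x ^ j * exp (- rad x)) * indicator {a<..} (rad x) \<partial>\<mu>) = 0"
      by (rule gauss_pairings_determine_tails(2)[OF assms(1) g2 zero]) (use that in auto)
    then show ?thesis
      using D0 unfolding mu_kn_def D_def[symmetric] h_def by (subst (asm) integral_density) (auto simp: mult.assoc)
  qed
  have ind: "integrable lborel (\<lambda>x. indicator A x * f x)" if "integrable lborel f" "A \<in> sets borel" for A and f :: "real \<Rightarrow> real"
    using integrable_real_mult_indicator[of A lborel f] that by (simp add: mult.commute)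
  have ae: "AE x in lborel. indicator {0<..} x * (h j x + h j (- x)) = 0" if j: "j < 2" for j
  proof (rule AE_eq_zero_if_tail_integrals_zero)
    show "integrable lborel (\<lambda>x. indicator {0<..} x * (h j x + h j (- x)))"
      using hi[OF j] him[OF j] by (intro ind) auto
    fix a :: real
    \<comment> \<open>The folded function lives on \<open>x > 0\<close>, so negative
      \<open>a\<close> may be replaced by 0. For \<open>b \<ge> 0\<close> the set
      \<open>rad x > rad b\<close> is the union of two opposite rays, and reflection folds one onto
      the other.\<close>
    define b where "b = max a 0"
    have rb: "rad x > rad b \<longleftrightarrow> \<bar>x\<bar> > b" for x
    proof -
      have "rad b < rad x" if "b < \<bar>x\<bar>" 
        unfolding rad_def using that n_pos by (intro powr_less_mono2) (auto simp: b_def)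
      moreover have "rad x \<le> rad b" if "\<not> b < \<bar>x\<bar>" 
        unfolding rad_def using that n_pos by (intro powr_mono2) (auto simp: b_def)
      ultimately show ?thesis by force
    qed
    have i1: "integrable lborel (\<lambda>x. indicator {b<..} x * h j x)"
      using hi[OF j] by (intro ind) auto
    have i2: "integrable lborel (\<lambda>x. indicator {b<..} x * h j (- x))"
      using him[OF j] by (intro ind) auto
    have i3: "integrable lborel (\<lambda>x. indicator {..< - b} x * h j x)"
      using hi[OF j] by (intro ind) auto
    have "(\<integral>x. indicator {a<..} x * (indicator {0<..} x * (h j x + h j (- x))) \<partial>lborel)
       = (\<integral>x. indicator {b<..} x * h j x + indicator {b<..} x * h j (- x) \<partial>lborel)"
      by (intro Bochner_Integration.integral_cong) (auto simp: b_def indicator_def)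
    also have "\<dots> = (\<integral>x. indicator {b<..} x * h j x \<partial>lborel) + (\<integral>x. indicator {b<..} x * h j (- x) \<partial>lborel)"
      by (rule Bochner_Integration.integral_add[OF i1 i2])
    also have "(\<integral>x. indicator {b<..} x * h j (- x) \<partial>lborel) = (\<integral>x. indicator {..< - b} (- x) * h j (- x) \<partial>lborel)"
      by (intro Bochner_Integration.integral_cong) (auto simp: indicator_def)
    also have "\<dots> = (\<integral>x. indicator {..< - b} x * h j x \<partial>lborel)"
      by (rule integral_lborel_reflect) measurable
    also have "(\<integral>x. indicator {b<..} x * h j x \<partial>lborel) + (\<integral>x. indicator {..< - b} x * h j x \<partial>lborel)
       = (\<integral>x. indicator {b<..} x * h j x + indicator {..< - b} x * h j x \<partial>lborel)"
      by (rule Bochner_Integration.integral_add[OF i1 i3, symmetric])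
    also have "\<dots> = (\<integral>x. h j x * indicator {rad b<..} (rad x) \<partial>lborel)"
    proof (intro Bochner_Integration.integral_cong refl)
      fix x
      have "rad b < rad x \<longleftrightarrow> b < x \<or> x < - b" "\<not> (b < x \<and> x < - b)"
        using rb[of x] by (auto simp: b_def)
      then show "indicator {b<..} x * h j x + indicator {..< - b} x * h j x = h j x * indicator {rad b<..} (rad x)"
        by (auto simp: indicator_def)
    qed
    finally show "(\<integral>x. indicator {a<..} x * (indicator {0<..} x * (h j x + h j (- x))) \<partial>lborel) = 0"
      using tail[OF j] by simp
  qed
  have ae0: "AE x in lborel. indicator {0<..} x * (h 0 x + h 0 (- x)) = 0" by (rule ae) simp
  have ae1: "AE x in lborel. indicator {0<..} x * (h 1 x + h 1 (- x)) = 0" by (rule ae) simp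
  have pos: "AE x in lborel. x > 0 \<longrightarrow> g x = 0 \<and> g (- x) = 0"
    using ae0 ae1
  proof eventually_elim
    case (elim x)
    show ?case
    proof
      assume x: "x > 0"
      have "D x * exp (- rad x) * (g x + g (- x)) = 0"
        using elim(1) x by (simp add: h_def Dm algebra_simps)
      moreover have "D x * exp (- rad x) * x * (g x - g (- x)) = 0"
        using elim(2) x by (simp add: h_def Dm algebra_simps)
      ultimately have "g x + g (- x) = 0" "g x - g (- x) = 0" using Dpos[of x] x by auto
      then show "g x = 0 \<and> g (- x) = 0" by linarith
    qed
  qed
  \<comment> \<open>Invariance of Lebesgue measure under reflection transfers the statement to the
    negative half-line.\<close>
  have "AE x in distr lborel borel (uminus :: real \<Rightarrow> real). x > 0 \<longrightarrow> g x = 0 \<and> g (- x) = 0"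
    unfolding lborel_distr_uminus by (rule pos)
  then have neg: "AE x in lborel. - x > 0 \<longrightarrow> g (- x) = 0 \<and> g (- (- x)) = 0"
    by (subst (asm) AE_distr_iff) auto
  have "AE x in lborel. g x = 0"
    using pos neg AE_lborel_singleton[of 0]
  proof eventually_elim
    case (elim x)
    then show ?case by (cases x "0 :: real" rule: linorder_cases) auto
  qed
  then show ?thesis by (subst AE_mu_iff) auto
qed

lemma gauss_pair_unique:
  assumes f: "memL k n 2 f" and zero: "\<And>j p. j < 2 \<Longrightarrow> p > 0 \<Longrightarrow> gauss_pair j f (of_real p) = 0"
  shows "AE x in \<mu>. f x = 0"
proof -
  have [measurable]: "f \<in> borel_measurable borel" using f by (simp add: memL_2_iff)
  have sq: "integrable \<mu> (\<lambda>x. (Re (f x))\<^sup>2)" "integrable \<mu> (\<lambda>x. (Im (f x))\<^sup>2)"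
    using memL_2_Re_Im[OF f] by (auto simp: memL_2_iff)
  have eq: "complex_of_real (x ^ j) * exp (- of_real p * of_real (rad x)) = of_real (x ^ j * exp (- p * rad x))" for j p x
    by (simp flip: exp_of_real)
  have int: "integrable \<mu> (\<lambda>x. f x * of_real (x ^ j * exp (- p * rad x)))" if "p > 0" for j p
    using gauss_pair_integrable[OF f, of "of_real p" j] that unfolding eq by simp
  have z: "(\<integral>x. f x * of_real (x ^ j * exp (- p * rad x)) \<partial>\<mu>) = 0" if "j < 2" "p > 0" for j p
    using zero[OF that] unfolding gauss_pair_def eq .
  have "(\<integral>x. Re (f x) * (x ^ j * exp (- p * rad x)) \<partial>\<mu>) = 0" if "j < 2" "p > 0" for j p
    using integral_Re[OF int[OF that(2), of j]] unfolding z[OF that] by simp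
  then have "AE x in \<mu>. Re (f x) = 0"
    by (intro real_gauss_pairings_unique sq) auto
  moreover have "(\<integral>x. Im (f x) * (x ^ j * exp (- p * rad x)) \<partial>\<mu>) = 0" if "j < 2" "p > 0" for j p
    using integral_Im[OF int[OF that(2), of j]] unfolding z[OF that] by simp
  then have "AE x in \<mu>. Im (f x) = 0"
    by (intro real_gauss_pairings_unique sq) auto
  ultimately show ?thesis
    by eventually_elim (simp add: complex_eq_iff)
qed

end

section \<open>Gluing half-planes\<close>

text \<open>Liouville makes \<open>K\<close> a polynomial; a nonconstant one would be large along
  the positive axis, and a constant equals its limit 0.\<close>

lemma polynomial_growth_decay_zero:
  fixes K :: "complex \<Rightarrow> complex"
  assumes hol: "K holomorphic_on UNIV"
    and growth: "\<And>z. norm z \<ge> 1 \<Longrightarrow> norm (K z) \<le> B * norm z ^ N"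
    and decay: "((\<lambda>x. K (of_real x)) \<longlongrightarrow> 0) at_top"
  shows "K z = 0"
proof -
  define c where "c i = (deriv ^^ i) K 0 / fact i" for i
  have K: "K z = (\<Sum>i\<le>N. c i * z ^ i)" for z
    unfolding c_def by (rule Liouville_polynomial[OF hol growth])
  have inf: "filterlim (\<lambda>x::real. complex_of_real x) at_infinity at_top"
    by (simp add: filterlim_at_infinity_conv_norm_at_top filterlim_abs_real)
  have c0: "c i = 0" if "1 \<le> i" "i \<le> N" for i
  proof (rule ccontr)
    assume "c i \<noteq> 0"
    then have "eventually (\<lambda>z. 1 \<le> norm (\<Sum>i\<le>N. c i * z ^ i)) at_infinity"
      using that by (intro polyfun_extremal exI[of _ i]) auto
    then have "eventually (\<lambda>x. 1 \<le> norm (K (of_real x))) at_top"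
      unfolding K[symmetric] by (rule eventually_compose_filterlim[OF _ inf])
    moreover have "eventually (\<lambda>x. norm (K (of_real x)) < 1) at_top"
      using order_tendstoD(2)[OF tendsto_norm_zero[OF decay], of 1] by simp
    ultimately have "eventually (\<lambda>x::real. False) at_top"
      by eventually_elim simp
    then show False by simp
  qed
  have const: "K z = c 0" for z
    unfolding K using c0 by (subst sum.remove[of _ 0]) auto
  then have "c 0 = 0"
    using decay by (simp add: tendsto_const_iff)
  then show ?thesis by (simp add: const)
qed

text \<open>The two half-planes overlap in a strip and cover the plane, so \<open>V\<close> extends to an entire function.\<close>

lemma glued_half_planes_zero:
  fixes V W :: "complex \<Rightarrow> complex" and \<rho> a b g A B :: real
  assumes \<rho>: "\<rho> > 0" and V: "V holomorphic_on {q. Re q > 0}" and W: "W holomorphic_on {p. Re p > - \<rho>}"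
    and Vb: "\<And>q. Re q > 0 \<Longrightarrow> norm (V q) \<le> A * Re q powr - a" and a: "a > 0"
    and Wb: "\<And>p. Re p > - \<rho> \<Longrightarrow> norm (W p) \<le> B * (Re p + \<rho>) powr - g" and g: "g \<ge> 0" "2 * g \<ge> b"
    and eq: "\<And>q. 0 < q \<Longrightarrow> q < \<rho> \<Longrightarrow>
       V (of_real q) = of_real ((\<rho> / (\<rho> - q)) powr b) * W (of_real (q * \<rho> / (\<rho> - q)))"
    and z: "Re z > 0"
  shows "V z = 0"
proof -
  \<comment> \<open>The Moebius map q -> q \<rho> / (\<rho> - q) is
    \<open>\<rho> * v q - \<rho>\<close>. On \<open>Re q < \<rho>\<close> the value
    \<open>v q\<close> has positive real part, which places the image in the domain of
    \<open>W\<close> and makes the principal power of \<open>v q\<close> holomorphic.\<close>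
  define v where "v q = of_real \<rho> / (of_real \<rho> - q)" for q :: complex
  define L where "L q = v q powr of_real b * W (of_real \<rho> * v q - of_real \<rho>)" for q
  define K where "K q = (if Re q > 0 then V q else L q)" for q
  have Rev: "Re (v q) = \<rho> * (\<rho> - Re q) / (norm (of_real \<rho> - q))\<^sup>2" for q
    by (simp add: v_def Re_divide cmod_power2)
  have nz: "of_real \<rho> - q \<noteq> 0" if "Re q < \<rho>" for q using that by (auto simp: complex_eq_iff)
  have Rev_pos: "Re (v q) > 0" if "Re q < \<rho>" for q
    unfolding Rev using that \<rho> nz[OF that] by (intro divide_pos_pos mult_pos_pos) auto
  have vhol: "v holomorphic_on {q. Re q < \<rho>}"
    unfolding v_def using nz by (intro holomorphic_intros) auto
  have "(W \<circ> (\<lambda>q. of_real \<rho> * v q - of_real \<rho>)) holomorphic_on {q. Re q < \<rho>}"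
    by (rule holomorphic_on_compose_gen[OF _ W]) (use \<rho> Rev_pos in \<open>auto intro!: holomorphic_intros vhol\<close>)
  moreover have "(\<lambda>q. v q powr of_real b) holomorphic_on {q. Re q < \<rho>}"
  proof (intro holomorphic_intros vhol)
    fix q assume "q \<in> {q. Re q < \<rho>}"
    then show "v q \<notin> \<real>\<^sub>\<le>\<^sub>0" using Rev_pos[of q] by (auto simp: complex_nonpos_Reals_iff)
  qed
  ultimately have Lhol: "L holomorphic_on {q. Re q < \<rho>}"
    unfolding L_def comp_def by (intro holomorphic_on_mult)
  have strip: "V q = L q" if q: "Re q > 0" "Re q < \<rho>" for q
  proof -
    let ?S = "{q. Re q > 0} \<inter> {q. Re q < \<rho>}"
    have "V q - L q = 0"
    proof (rule analytic_continuation[where f = "\<lambda>q. V q - L q" and S = ?S and U = "of_real ` {0<..<\<rho>}" and \<xi> = "of_real (\<rho> / 2)"])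
      show "(\<lambda>q. V q - L q) holomorphic_on ?S"
        by (intro holomorphic_on_diff holomorphic_on_subset[OF V] holomorphic_on_subset[OF Lhol]) auto
      show "open ?S" by (intro open_Int open_halfspace_Re_gt open_halfspace_Re_lt)
      show "connected ?S"
        by (intro convex_connected convex_Int convex_halfspace_Re_gt convex_halfspace_Re_lt)
      show "complex_of_real (\<rho> / 2) islimpt of_real ` {0<..<\<rho>}"
      proof -
        have "(\<rho> / 2) islimpt {0<..<\<rho>}" using \<rho> by (intro interior_limit_point) (auto simp: interior_open)
        then show ?thesis
          by (rule islimpt_isCont_image) (simp, simp only: of_real_eq_iff eventually_neq_at_within)
      qed
      show "V z - L z = 0" if "z \<in> of_real ` {0<..<\<rho>}" for z
      proof -
        obtain x where x: "z = of_real x" "0 < x" "x < \<rho>" using \<open>z \<in> _\<close> by auto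
        have vx: "v z = of_real (\<rho> / (\<rho> - x))" by (simp add: v_def x)
        have "\<rho> * (\<rho> / (\<rho> - x)) - \<rho> = x * \<rho> / (\<rho> - x)"
          using x by (simp add: field_simps)
        then have "of_real \<rho> * v z - of_real \<rho> = of_real (x * \<rho> / (\<rho> - x))"
          unfolding vx of_real_mult[symmetric] of_real_diff[symmetric] by (simp only:)
        moreover have "v z powr of_real b = of_real ((\<rho> / (\<rho> - x)) powr b)"
          unfolding vx using x \<rho> by (intro powr_of_real) auto
        ultimately have "L z = of_real ((\<rho> / (\<rho> - x)) powr b) * W (of_real (x * \<rho> / (\<rho> - x)))"
          by (simp only: L_def)
        then show ?thesis using eq[OF x(2,3)] by (simp add: x(1))
      qed
    qed (use q \<rho> in auto)
    then show ?thesis by simp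
  qed
  have "K holomorphic_on {q. Re q > 0}"
    by (rule holomorphic_transform[OF V]) (simp add: K_def)
  moreover have "K holomorphic_on {q. Re q < \<rho>}"
    by (rule holomorphic_transform[OF Lhol]) (use strip in \<open>simp add: K_def\<close>)
  ultimately have "K holomorphic_on ({q. Re q > 0} \<union> {q. Re q < \<rho>})"
    by (intro holomorphic_on_Un open_halfspace_Re_gt open_halfspace_Re_lt)
  moreover have "{q. Re q > 0} \<union> {q. Re q < \<rho>} = UNIV" using \<rho> by auto
  ultimately have Khol: "K holomorphic_on UNIV" by simp
  \<comment> \<open>Growth exponent of \<open>L\<close>: the power of \<open>v\<close> contributes
    \<open>- b\<close>, and the edge singularity of \<open>W\<close> contributes
    \<open>2 * g\<close>, because \<open>Re (v q)\<close> decays at worst like the inverse square of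
    the distance to \<open>\<rho>\<close>.\<close>
  define e where "e = 2 * g - b"
  have e: "e \<ge> 0" using g by (simp add: e_def)
  define N where "N = nat \<lceil>e\<rceil>"
  define C1 where "C1 = \<bar>A\<bar> * (\<rho> / 2) powr - a"
  define C2 where "C2 = \<bar>B\<bar> * (\<rho> powr b * (\<rho> ^ 3 / 2) powr - g * (\<rho> + 1) powr e)"
  have C: "C1 \<ge> 0" "C2 \<ge> 0" by (simp_all add: C1_def C2_def)
  have growth: "norm (K q) \<le> (C1 + C2) * norm q ^ N" if q: "norm q \<ge> 1" for q
  \<comment> \<open>The dividing line runs inside the overlap. To its right the bound on
    \<open>V\<close> is a constant; to its left \<open>\<rho> - Re q\<close> is at least
    \<open>\<rho> / 2\<close>, which keeps \<open>Re (v q)\<close> away from 0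
    quantitatively.\<close>
  proof (cases "Re q \<ge> \<rho> / 2")
    case True
    then have rq: "Re q > 0" using \<rho> by linarith
    have "norm (K q) \<le> A * Re q powr - a" using Vb[OF rq] rq by (simp add: K_def)
    also have "\<dots> \<le> C1"
      unfolding C1_def using True \<rho> a by (intro mult_mono powr_mono2') auto
    also have "\<dots> \<le> (C1 + C2) * norm q ^ N"
      using C q one_le_power[OF q, of N] mult_mono[of C1 "C1 + C2" 1 "norm q ^ N"] by simp
    finally show ?thesis .
  next
    case False
    then have rq: "Re q < \<rho>" using \<rho> by linarith
    define w where "w = norm (of_real \<rho> - q)"
    have w0: "w > 0" using nz[OF rq] by (simp add: w_def)
    have KL: "K q = L q" using strip[OF _ rq] by (simp add: K_def)
    have nv: "norm (v q) = \<rho> / w" using \<rho> by (simp add: v_def w_def norm_divide)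
    have lower: "(\<rho> ^ 3 / 2) / w\<^sup>2 \<le> \<rho> * Re (v q)"
    proof -
      have "\<rho>\<^sup>2 * (\<rho> / 2) \<le> \<rho>\<^sup>2 * (\<rho> - Re q)" using False by (intro mult_left_mono) auto
      then show ?thesis
        unfolding Rev w_def[symmetric] using w0 by (simp add: field_simps power2_eq_square power3_eq_cube)
    qed
    have "norm (L q) = (\<rho> / w) powr b * norm (W (of_real \<rho> * v q - of_real \<rho>))"
      by (simp add: L_def norm_mult norm_powr_real_powr' nv)
    also have "\<dots> \<le> (\<rho> / w) powr b * (\<bar>B\<bar> * ((\<rho> ^ 3 / 2) / w\<^sup>2) powr - g)"
    proof (rule mult_left_mono)
      have "norm (W (of_real \<rho> * v q - of_real \<rho>)) \<le> B * (\<rho> * Re (v q)) powr - g"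
        using Wb[of "of_real \<rho> * v q - of_real \<rho>"] Rev_pos[OF rq] \<rho> by simp
      also have "\<dots> \<le> \<bar>B\<bar> * ((\<rho> ^ 3 / 2) / w\<^sup>2) powr - g"
        using lower g \<rho> w0 by (intro mult_mono powr_mono2') auto
      finally show "norm (W (of_real \<rho> * v q - of_real \<rho>)) \<le> \<bar>B\<bar> * ((\<rho> ^ 3 / 2) / w\<^sup>2) powr - g" .
    qed auto
    also have "\<dots> = \<bar>B\<bar> * (\<rho> powr b * (\<rho> ^ 3 / 2) powr - g * w powr e)"
    proof -
      have "(\<rho> / w) powr b = \<rho> powr b * w powr - b"
        using \<rho> w0 by (simp add: powr_divide powr_minus field_simps)
      moreover have "((\<rho> ^ 3 / 2) / w\<^sup>2) powr - g = (\<rho> ^ 3 / 2) powr - g * w powr (2 * g)"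
      proof -
        have "((\<rho> ^ 3 / 2) / w\<^sup>2) powr - g = (\<rho> ^ 3 / 2) powr - g / (w\<^sup>2) powr - g"
          by (rule powr_divide)
        moreover have "w\<^sup>2 = w powr 2" using w0 by simp
        then have "(w\<^sup>2) powr - g = w powr - (2 * g)" by (simp add: powr_powr)
        ultimately have "((\<rho> ^ 3 / 2) / w\<^sup>2) powr - g = (\<rho> ^ 3 / 2) powr - g / w powr - (2 * g)" by metis
        then show ?thesis by (simp only: powr_minus_divide[of w "2 * g"] divide_divide_eq_right div_by_1)
      qed
      moreover have "w powr - b * w powr (2 * g) = w powr e"
        by (simp add: e_def powr_add[symmetric])
      ultimately show ?thesis by (simp add: mult_ac)
    qed
    also have "w powr e \<le> (\<rho> + 1) powr e * norm q ^ N"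
    proof -
      have "w \<le> \<rho> + norm q" unfolding w_def using norm_triangle_ineq4[of "of_real \<rho>" q] \<rho> by simp
      also have "\<dots> \<le> (\<rho> + 1) * norm q" using q \<rho> mult_left_mono[OF q, of \<rho>] by (simp add: algebra_simps)
      finally have "w powr e \<le> ((\<rho> + 1) * norm q) powr e" using w0 e by (intro powr_mono2) auto
      also have "\<dots> = (\<rho> + 1) powr e * norm q powr e" using \<rho> by (simp add: powr_mult)
      also have "norm q powr e \<le> norm q powr real N"
        using q e by (intro powr_mono) (auto simp: N_def)
      also have "\<dots> = norm q ^ N" using q by (intro powr_realpow) linarith
      finally show ?thesis using \<rho> by (simp add: mult_left_mono)
    qed
    then have "\<bar>B\<bar> * (\<rho> powr b * (\<rho> ^ 3 / 2) powr - g * w powr e) \<le> C2 * norm q ^ N"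
      unfolding C2_def mult.assoc by (intro mult_left_mono) auto
    finally have "norm (K q) \<le> C2 * norm q ^ N" by (simp add: KL)
    also have "\<dots> \<le> (C1 + C2) * norm q ^ N" using C by (intro mult_right_mono) auto
    finally show ?thesis .
  qed
  have decay: "((\<lambda>x. K (of_real x)) \<longlongrightarrow> 0) at_top"
  proof (rule Lim_null_comparison)
    show "\<forall>\<^sub>F x in at_top. norm (K (of_real x)) \<le> A * x powr - a"
      using eventually_gt_at_top[of 0]
    proof eventually_elim
      case (elim x)
      then show ?case using Vb[of "of_real x"] by (simp add: K_def)
    qed
    have "((\<lambda>x. x powr - a) \<longlongrightarrow> 0) at_top"
      using a by (intro tendsto_neg_powr filterlim_ident) auto
    then show "((\<lambda>x. A * x powr - a) \<longlongrightarrow> 0) at_top"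
      using tendsto_mult_right_zero by blast
  qed
  have "K z = 0" by (rule polynomial_growth_decay_zero[OF Khol growth decay])
  then show ?thesis using z by (simp add: K_def)
qed

section \<open>Transport along the heat flow\<close>

lemma has_vector_derivative_within_quotient:
  fixes f :: "real \<Rightarrow> complex"
  assumes "((\<lambda>y. (f y - f x) / of_real (y - x)) \<longlongrightarrow> D) (at x within S)"
  shows "(f has_vector_derivative D) (at x within S)"
proof -
  have "((\<lambda>y. norm ((f y - f x) / of_real (y - x) - D)) \<longlongrightarrow> 0) (at x within S)"
    using assms by (simp add: tendsto_norm_zero_iff LIM_zero_iff)
  moreover have "norm ((1 / norm (y - x)) *\<^sub>R (f y - (f x + (y - x) *\<^sub>R D))) = norm ((f y - f x) / of_real (y - x) - D)"
    if "y \<noteq> x" for y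
  proof -
    have "(f y - f x) / of_real (y - x) - D = (f y - (f x + (y - x) *\<^sub>R D)) / of_real (y - x)"
      using that by (simp add: scaleR_conv_of_real divide_simps)
    then show ?thesis by (simp add: norm_divide del: of_real_diff)
  qed
  then have "\<forall>\<^sub>F y in at x within S. norm ((f y - f x) / of_real (y - x) - D)
      = norm ((1 / norm (y - x)) *\<^sub>R (f y - (f x + (y - x) *\<^sub>R D)))"
    by (auto simp: eventually_at_filter)
  ultimately have "((\<lambda>y. norm ((1 / norm (y - x)) *\<^sub>R (f y - (f x + (y - x) *\<^sub>R D)))) \<longlongrightarrow> 0) (at x within S)"
    by (rule Lim_transform_eventually)
  then show ?thesis
    unfolding has_vector_derivative_def has_derivative_within tendsto_norm_zero_iff
    by (simp add: bounded_linear_scaleR_left)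
qed

context kn_params begin

lemma is_wlap_wlap: "in_W2 k n f \<Longrightarrow> is_wlap k n f (wlap k n f)"
  unfolding in_W2_def wlap_def by (erule someI_ex)

lemma in_W2_memL: "in_W2 k n f \<Longrightarrow> memL k n 2 f"
  by (auto simp: in_W2_def is_wlap_def)

lemma in_W2_wlap_memL: "in_W2 k n f \<Longrightarrow> memL k n 2 (wlap k n f)"
  using is_wlap_wlap by (auto simp: is_wlap_def)

lemma heat_pair_bound:
  assumes f: "memL k n 2 f" and s: "s > 0"
  shows "norm (heat_pair j f s) \<le> L2norm k n f *
    (s powr - (\<beta> j + 1) * sqrt (\<kappa> * Gamma (\<beta> j + 1) * (2 * ((real n)\<^sup>2 / (4 * s))) powr - (\<beta> j + 1)))"
proof -
  have "Re (of_real ((real n)\<^sup>2 / (4 * s))) > 0" using s n_pos by simp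
  from mult_left_mono[OF gauss_pair_bound[OF f this, of j], of "s powr - (\<beta> j + 1)"]
  show ?thesis unfolding heat_pair_def by (simp add: norm_mult mult_ac)
qed

context
  fixes T :: real and u u' :: "real \<Rightarrow> real \<Rightarrow> complex"
  assumes C1: "C1_W2 k n T u u'"
    and heat: "\<forall>t\<in>{0..T}. AE x in \<mu>. complex_of_real (real n) * wlap k n (u t) x - u' t x = 0"
begin

lemma u_W2: "t \<in> {0..T} \<Longrightarrow> in_W2 k n (u t)" and u'_W2: "t \<in> {0..T} \<Longrightarrow> in_W2 k n (u' t)"
  using C1 by (auto simp: C1_W2_def)

text \<open>Along \<open>s = c - n * y\<close> the motion of \<open>u\<close> contributes the
  pairing of \<open>u'\<close>, and the motion of the parameter contributes \<open>- n\<close> times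
  the pairing of \<open>wlap\<close>. The heat equation cancels the two.\<close>

lemma heat_pair_transport_derivative:
  assumes \<tau>: "\<tau> \<in> {0..T}" and j: "j < 2" and c: "c - real n * \<tau> > 0"
  shows "((\<lambda>y. heat_pair j (u y) (c - real n * y)) has_vector_derivative 0) (at \<tau> within {0..T})"
proof -
  let ?F = "at \<tau> within {0..T}"
  define \<sigma> where "\<sigma> y = c - real n * y" for y
  have \<sigma>: "\<sigma> \<tau> > 0" using c by (simp add: \<sigma>_def)
  have \<sigma>_lim: "(\<sigma> \<longlongrightarrow> \<sigma> \<tau>) ?F" unfolding \<sigma>_def by (intro tendsto_intros)
  have \<sigma>_pos: "\<forall>\<^sub>F y in ?F. \<sigma> y > 0" using order_tendstoD(1)[OF \<sigma>_lim \<sigma>] .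
  have in_set: "\<forall>\<^sub>F y in ?F. y \<in> {0..T} \<and> y \<noteq> \<tau>" by (auto simp: eventually_at_filter)
  have um: "memL k n 2 (u y)" if "y \<in> {0..T}" for y using in_W2_memL u_W2 that by blast
  have u'm: "memL k n 2 (u' y)" if "y \<in> {0..T}" for y using in_W2_memL u'_W2 that by blast
  have wm: "memL k n 2 (wlap k n (u \<tau>))" using in_W2_wlap_memL u_W2 \<tau> by blast
  define er where "er y x = (u y x - u \<tau> x) / of_real (y - \<tau>) - u' \<tau> x" for y x
  have erm: "memL k n 2 (er y)" if "y \<in> {0..T}" for y
    using memL_2_diff[OF memL_2_cmult[OF memL_2_diff[OF um[OF that] um[OF \<tau>]], of "inverse (of_real (y - \<tau>))"] u'm[OF \<tau>]]
    by (simp add: er_def[abs_def] divide_inverse mult.commute)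
  have "((\<lambda>y. W2norm k n (er y)) \<longlongrightarrow> 0) ?F"
    using C1 \<tau> by (simp add: C1_W2_def er_def[abs_def])
  \<comment> \<open>\<open>W2norm\<close> dominates \<open>L2norm\<close>, the quantity in which the
    pairings are bounded.\<close>
  then have er_lim: "((\<lambda>y. L2norm k n (er y)) \<longlongrightarrow> 0) ?F"
    by (rule Lim_null_comparison[rotated]) (simp add: W2norm_def L2norm_nonneg)
  define B where "B s = s powr - (\<beta> j + 1) * sqrt (\<kappa> * Gamma (\<beta> j + 1) * (2 * ((real n)\<^sup>2 / (4 * s))) powr - (\<beta> j + 1))" for s
  have B_lim: "((\<lambda>y. B (\<sigma> y)) \<longlongrightarrow> B (\<sigma> \<tau>)) ?F"
    unfolding B_def using \<sigma> n_pos by (intro tendsto_intros \<sigma>_lim) auto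
  have e_lim: "((\<lambda>y. heat_pair j (er y) (\<sigma> y)) \<longlongrightarrow> 0) ?F"
  proof (rule Lim_null_comparison)
    show "((\<lambda>y. L2norm k n (er y) * B (\<sigma> y)) \<longlongrightarrow> 0) ?F"
      using tendsto_mult[OF er_lim B_lim] by simp
    show "\<forall>\<^sub>F y in ?F. norm (heat_pair j (er y) (\<sigma> y)) \<le> L2norm k n (er y) * B (\<sigma> y)"
      using in_set \<sigma>_pos unfolding B_def by eventually_elim (blast intro: heat_pair_bound erm)
  qed
  have "(heat_pair j (u' \<tau>) has_vector_derivative heat_pair j (wlap k n (u' \<tau>)) (\<sigma> \<tau>)) (at (\<sigma> \<tau>))"
    by (intro heat_pair_has_derivative is_wlap_wlap u'_W2 \<tau> \<sigma> j)
  then have "isCont (heat_pair j (u' \<tau>)) (\<sigma> \<tau>)"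
    by (rule has_vector_derivative_continuous)
  then have u'_lim: "((\<lambda>y. heat_pair j (u' \<tau>) (\<sigma> y)) \<longlongrightarrow> heat_pair j (u' \<tau>) (\<sigma> \<tau>)) ?F"
    by (rule isCont_tendsto_compose[OF _ \<sigma>_lim])
  \<comment> \<open>The moving pairing is split: \<open>A\<close> carries the change of
    \<open>u\<close> at the moving parameter, while
    \<open>heat_pair j (u \<tau>) (\<sigma> y)\<close> carries the change of the parameter and is
    handled by the chain rule.\<close>
  define A where "A y = heat_pair j (\<lambda>x. u y x - u \<tau> x) (\<sigma> y)" for y
  have A\<tau>: "A \<tau> = 0" by (simp add: A_def heat_pair_def gauss_pair_def)
  have "(A has_vector_derivative heat_pair j (u' \<tau>) (\<sigma> \<tau>)) ?F"
  proof (rule has_vector_derivative_within_quotient)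
    have "\<forall>\<^sub>F y in ?F. heat_pair j (er y) (\<sigma> y) + heat_pair j (u' \<tau>) (\<sigma> y) = (A y - A \<tau>) / of_real (y - \<tau>)"
      using in_set \<sigma>_pos
    proof eventually_elim
      case (elim y)
      then have p: "Re (of_real ((real n)\<^sup>2 / (4 * \<sigma> y))) > 0" using n_pos by simp
      have "heat_pair j (er y) (\<sigma> y) + heat_pair j (u' \<tau>) (\<sigma> y) = heat_pair j (\<lambda>x. er y x + u' \<tau> x) (\<sigma> y)"
        unfolding heat_pair_def using elim by (subst gauss_pair_add[OF erm u'm[OF \<tau>] p]) (auto simp: distrib_left)
      also have "(\<lambda>x. er y x + u' \<tau> x) = (\<lambda>x. inverse (of_real (y - \<tau>)) * (u y x - u \<tau> x))"
        by (auto simp: er_def divide_inverse)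
      also have "heat_pair j \<dots> (\<sigma> y) = (A y - A \<tau>) / of_real (y - \<tau>)"
        unfolding A\<tau> unfolding A_def heat_pair_def gauss_pair_cmult by (simp only: divide_inverse mult_ac diff_0_right)
      finally show ?case .
    qed
    moreover have "((\<lambda>y. heat_pair j (er y) (\<sigma> y) + heat_pair j (u' \<tau>) (\<sigma> y)) \<longlongrightarrow> heat_pair j (u' \<tau>) (\<sigma> \<tau>)) ?F"
      using tendsto_add[OF e_lim u'_lim] by simp
    ultimately show "((\<lambda>y. (A y - A \<tau>) / of_real (y - \<tau>)) \<longlongrightarrow> heat_pair j (u' \<tau>) (\<sigma> \<tau>)) ?F"
      by (rule Lim_transform_eventually[rotated])
  qed
  moreover have "((\<lambda>y. heat_pair j (u \<tau>) (\<sigma> y)) has_vector_derivative (- real n) *\<^sub>R heat_pair j (wlap k n (u \<tau>)) (\<sigma> \<tau>)) ?F"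
  proof -
    have "(\<sigma> has_vector_derivative - real n) ?F"
      unfolding \<sigma>_def by (auto intro!: derivative_eq_intros simp: has_real_derivative_iff_has_vector_derivative[symmetric])
    moreover have "(heat_pair j (u \<tau>) has_vector_derivative heat_pair j (wlap k n (u \<tau>)) (\<sigma> \<tau>)) (at (\<sigma> \<tau>) within \<sigma> ` {0..T})"
      by (rule has_vector_derivative_at_within, intro heat_pair_has_derivative is_wlap_wlap u_W2 \<tau> \<sigma> j)
    ultimately show ?thesis
      using vector_diff_chain_within[of \<sigma> "- real n" \<tau> "{0..T}" "heat_pair j (u \<tau>)"] by (simp add: comp_def)
  qed
  ultimately have "((\<lambda>y. A y + heat_pair j (u \<tau>) (\<sigma> y)) has_vector_derivative
      heat_pair j (u' \<tau>) (\<sigma> \<tau>) + (- real n) *\<^sub>R heat_pair j (wlap k n (u \<tau>)) (\<sigma> \<tau>)) ?F"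
    by (rule has_vector_derivative_add)
  moreover have "heat_pair j (u' \<tau>) (\<sigma> \<tau>) + (- real n) *\<^sub>R heat_pair j (wlap k n (u \<tau>)) (\<sigma> \<tau>) = 0"
  proof -
    have "AE x in \<mu>. complex_of_real (real n) * wlap k n (u \<tau>) x - u' \<tau> x = 0"
      using heat \<tau> by blast
    then have "AE x in \<mu>. u' \<tau> x = of_real (real n) * wlap k n (u \<tau>) x"
      by eventually_elim simp
    then have "gauss_pair j (u' \<tau>) p = of_real (real n) * gauss_pair j (wlap k n (u \<tau>)) p" for p
      unfolding gauss_pair_cmult[symmetric] using u'm[OF \<tau>] wm
      by (intro gauss_pair_cong_AE) (auto simp: memL_2_iff)
    then show ?thesis by (simp add: heat_pair_def scaleR_conv_of_real)
  qed
  ultimately have D: "((\<lambda>y. A y + heat_pair j (u \<tau>) (\<sigma> y)) has_vector_derivative 0) ?F" by simp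
  \<comment> \<open>Recombining the two parts uses integrability of the pairings, hence a positive
    parameter; this holds near \<open>\<tau>\<close>.\<close>
  obtain d where d: "d > 0" "\<And>y. y \<in> {0..T} \<Longrightarrow> y \<noteq> \<tau> \<Longrightarrow> dist y \<tau> < d \<Longrightarrow> \<sigma> y > 0"
    using \<sigma>_pos unfolding eventually_at by blast
  show ?thesis
  proof (rule has_vector_derivative_transform_within[OF D d(1) \<tau>])
    fix y assume y: "y \<in> {0..T}" "dist y \<tau> < d"
    then have "\<sigma> y > 0" using d(2)[of y] \<sigma> by (cases "y = \<tau>") auto
    then have "Re (of_real ((real n)\<^sup>2 / (4 * \<sigma> y))) > 0" using n_pos by simp
    then show "A y + heat_pair j (u \<tau>) (\<sigma> y) = heat_pair j (u y) (c - real n * y)"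
      unfolding A_def heat_pair_def \<sigma>_def[symmetric]
      by (subst gauss_pair_diff[OF um[OF y(1)] um[OF \<tau>]]) (auto simp: algebra_simps)
  qed
qed

text \<open>With \<open>c = s + n * t\<close> the parameter falls from \<open>s + n * t\<close> at
  time 0 to \<open>s\<close> at time \<open>t\<close>, staying positive, and the pairing is constant
  along this line.\<close>

lemma heat_pair_transport:
  assumes t: "t \<in> {0..T}" and j: "j < 2" and s: "s > 0"
  shows "heat_pair j (u t) s = heat_pair j (u 0) (s + real n * t)"
proof -
  let ?m = "\<lambda>y. heat_pair j (u y) ((s + real n * t) - real n * y)"
  have D: "(?m has_vector_derivative 0) (at \<tau> within {0..t})" if "\<tau> \<in> {0..t}" for \<tau>
  proof -
    have "real n * \<tau> \<le> real n * t" using that by (intro mult_left_mono) auto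
    then have "(?m has_vector_derivative 0) (at \<tau> within {0..T})"
      using that t s by (intro heat_pair_transport_derivative j) auto
    then show ?thesis
      by (rule has_vector_derivative_within_subset) (use t in auto)
  qed
  obtain c where c: "\<And>y. y \<in> {0..t} \<Longrightarrow> ?m y = c"
    using has_vector_derivative_zero_constant[of "{0..t}" ?m] D by auto
  show ?thesis using c[of 0] c[of t] t by simp
qed

lemma gaussian_decay_imp_zero:
  assumes T: "T > 0" and \<delta>: "\<delta> \<ge> 1 / (4 * T)"
    and decay: "\<And>x. norm (u T x) \<le> C * exp (- real n * \<delta> * rad x)"
    and t: "t \<in> {0..T}"
  shows "AE x in \<mu>. u t x = 0"
proof -
  \<comment> \<open>The critical value: n^2/(4 q) exceeds n T exactly when
    \<open>q < \<rho>\<close>, so the parameter at time \<open>T\<close> is then positive. The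
    hypothesis on \<delta> reads \<open>real n * \<delta> \<ge> \<rho>\<close>.\<close>
  define \<rho> where "\<rho> = real n / (4 * T)"
  have \<rho>: "\<rho> > 0" using n_pos T by (simp add: \<rho>_def)
  have um: "memL k n 2 (u y)" if "y \<in> {0..T}" for y using in_W2_memL u_W2 that by blast
  have [measurable]: "u T \<in> borel_measurable borel" using um[of T] T by (simp add: memL_2_iff)
  have C0: "C \<ge> 0"
    using order.trans[OF norm_ge_zero decay[of 0]] by (simp add: zero_le_mult_iff)
  have dom: "norm (u T x * of_real (x ^ j)) * exp (- c * rad x) \<le> C * (\<bar>x\<bar> ^ j * rad x ^ 0 * exp (- (c + \<rho>) * rad x))" for x c j
  proof -
    have "\<rho> \<le> real n * \<delta>"
      using mult_left_mono[OF \<delta>, of "real n"] by (simp add: \<rho>_def)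
    then have "exp (- real n * \<delta> * rad x) \<le> exp (- \<rho> * rad x)"
      by (auto intro: mult_right_mono)
    then have "norm (u T x) \<le> C * exp (- \<rho> * rad x)"
      using decay[of x] C0 by (meson mult_left_mono order.trans)
    then have "norm (u T x) * (\<bar>x\<bar> ^ j * exp (- c * rad x)) \<le> C * exp (- \<rho> * rad x) * (\<bar>x\<bar> ^ j * exp (- c * rad x))"
      by (rule mult_right_mono) auto
    also have "\<dots> = C * (\<bar>x\<bar> ^ j * (exp (- \<rho> * rad x) * exp (- c * rad x)))"
      by simp
    also have "exp (- \<rho> * rad x) * exp (- c * rad x) = exp (- (c + \<rho>) * rad x)"
      by (simp add: exp_add[symmetric] algebra_simps)
    finally show ?thesis by (simp add: norm_mult norm_power mult.assoc)
  qed
  have zero: "gauss_pair j (u 0) (of_real q) = 0" if j: "j < 2" and q: "q > 0" for j q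
  proof -
    define b where "b = \<beta> j + 1"
    have b: "b > 0" using beta_gt[of j] by (simp add: b_def)
    \<comment> \<open>The exponent of the Gaussian moment of \<open>\<bar>x\<bar> ^ j\<close>, which
      measures the singularity of the final pairing at the edge. Here
      \<open>2 * g - b = \<alpha> + 1\<close>, so the gluing exponent is positive.\<close>
    define g where "g = \<alpha> + 1 + real j * real n / 2"
    have g: "g > 0" "2 * g \<ge> b" using alpha_gt by (auto simp: g_def b_def \<beta>_def add_pos_nonneg)
    have mom: "has_bochner_integral \<mu> (\<lambda>x. C * (\<bar>x\<bar> ^ j * rad x ^ 0 * exp (- c * rad x))) (C * (\<kappa> * Gamma g * c powr - g))" if "c > 0" for c
      using has_bochner_integral_mult_right[OF power_moment[OF that, of j 0], of C] by (simp add: g_def)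
    have int: "integrable \<mu> (\<lambda>x. norm (u T x * of_real (x ^ j)) * exp (- c * rad x))" if "c > - \<rho>" for c
    proof (rule Bochner_Integration.integrable_bound)
      show "integrable \<mu> (\<lambda>x. C * (\<bar>x\<bar> ^ j * rad x ^ 0 * exp (- (c + \<rho>) * rad x)))"
        using mom[of "c + \<rho>"] that by (simp add: has_bochner_integral_iff)
      show "AE x in \<mu>. norm (norm (u T x * of_real (x ^ j)) * exp (- c * rad x))
          \<le> norm (C * (\<bar>x\<bar> ^ j * rad x ^ 0 * exp (- (c + \<rho>) * rad x)))"
        using dom[of _ j c] C0 by (intro AE_I2) simp
    qed auto
    have V: "gauss_pair j (u 0) holomorphic_on {q. Re q > 0}"
      unfolding holomorphic_on_def field_differentiable_def
      by (intro ballI exI, rule has_field_derivative_at_within, rule gauss_pair_has_derivative[OF um]) (use T in auto)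
    have W: "gauss_pair j (u T) holomorphic_on {p. Re p > - \<rho>}"
      unfolding holomorphic_on_def field_differentiable_def
      by (intro ballI exI, rule has_field_derivative_at_within, rule gauss_pair_has_derivative_general[OF _ int]) auto
    define A where "A = L2norm k n (u 0) * sqrt (\<kappa> * Gamma b * 2 powr - b)"
    \<comment> \<open>Cauchy-Schwarz takes the square root of the Gaussian norm, hence half the
      exponent; being negative it yields the decay at infinity.\<close>
    have Vb: "norm (gauss_pair j (u 0) p) \<le> A * Re p powr - (b / 2)" if "Re p > 0" for p
    proof -
      have "sqrt (Re p powr - b) = Re p powr - (b / 2)"
        using that by (simp add: powr_half_sqrt[symmetric] powr_powr)
      then show ?thesis
        using gauss_pair_bound[OF um[of 0] that, of j] that T
        by (simp add: A_def b_def[symmetric] powr_mult real_sqrt_mult)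
    qed
    have Wb: "norm (gauss_pair j (u T) p) \<le> (C * (\<kappa> * Gamma g)) * (Re p + \<rho>) powr - g" if "Re p > - \<rho>" for p
    proof -
      have "norm (gauss_pair j (u T) p) \<le> (\<integral>x. norm (u T x * (of_real (x ^ j) * exp (- p * of_real (rad x)))) \<partial>\<mu>)"
        unfolding gauss_pair_def by (rule integral_norm_bound)
      also have "\<dots> = (\<integral>x. norm (u T x * of_real (x ^ j)) * exp (- Re p * rad x) \<partial>\<mu>)"
        by (simp add: norm_mult mult.assoc)
      also have "\<dots> \<le> (\<integral>x. C * (\<bar>x\<bar> ^ j * rad x ^ 0 * exp (- (Re p + \<rho>) * rad x)) \<partial>\<mu>)"
        using mom[of "Re p + \<rho>"] that by (intro integral_mono int dom) (auto simp: has_bochner_integral_iff)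
      also have "\<dots> = C * (\<kappa> * Gamma g * (Re p + \<rho>) powr - g)"
        using mom[of "Re p + \<rho>"] that by (simp add: has_bochner_integral_iff)
      finally show ?thesis by (simp add: mult.assoc)
    qed
    have eq: "gauss_pair j (u 0) (of_real q) = of_real ((\<rho> / (\<rho> - q)) powr b) * gauss_pair j (u T) (of_real (q * \<rho> / (\<rho> - q)))"
      if q: "0 < q" "q < \<rho>" for q
    proof -
      \<comment> \<open>The parameter at time \<open>T\<close> whose transport back to time 0 is
        n^2/(4 q): the subtracted term n^2/(4 \<rho>) equals n T.\<close>
      define s where "s = (real n)\<^sup>2 / 4 * (1 / q - 1 / \<rho>)"
      define s' where "s' = s + real n * T"
      have s: "s > 0" using q \<rho> n_pos by (simp add: s_def field_simps)
      have s'q: "s' = (real n)\<^sup>2 / (4 * q)"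
        using q T n_pos by (simp add: s'_def s_def \<rho>_def field_simps power2_eq_square)
      have s': "s' > 0" using q n_pos by (simp add: s'q)
      have 1: "(real n)\<^sup>2 / (4 * s') = q" using q n_pos by (simp add: s'q)
      have 2: "(real n)\<^sup>2 / (4 * s) = q * \<rho> / (\<rho> - q)"
        using q \<rho> n_pos by (simp add: s_def field_simps)
      have 3: "s' / s = \<rho> / (\<rho> - q)"
        using q \<rho> n_pos by (simp add: s'q s_def field_simps)
      have "heat_pair j (u T) s = heat_pair j (u 0) s'"
        unfolding s'_def using T by (intro heat_pair_transport j s) auto
      then have e: "of_real (s powr - b) * gauss_pair j (u T) (of_real (q * \<rho> / (\<rho> - q))) = of_real (s' powr - b) * gauss_pair j (u 0) (of_real q)"
        by (simp only: heat_pair_def 1 2 b_def)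
      have "of_real (s' powr b) * (of_real (s' powr - b) * gauss_pair j (u 0) (of_real q)) = gauss_pair j (u 0) (of_real q)"
        using s' by (simp add: powr_minus)
      moreover have "s' powr b * s powr - b = (\<rho> / (\<rho> - q)) powr b"
        unfolding 3[symmetric] using s s' by (simp add: powr_divide powr_minus field_simps)
      ultimately show ?thesis
        unfolding e[symmetric] by (metis mult.assoc of_real_mult)
    qed
    show ?thesis
      by (rule glued_half_planes_zero[OF \<rho> V W Vb _ Wb _ g(2) eq]) (use b g q in auto)
  qed
  show ?thesis
  proof (rule gauss_pair_unique[OF um[OF t]])
    fix j :: nat and p :: real
    assume j: "j < 2" and p: "p > 0"
    define s where "s = (real n)\<^sup>2 / (4 * p)"
    have s: "s > 0" using p n_pos by (simp add: s_def)
    \<comment> \<open>The initial pairings vanish at every positive parameter; transport carries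
      this to time \<open>t\<close>, where \<open>p\<close> is hit by
      \<open>s = (real n)\<^sup>2 / (4 * p)\<close>.\<close>
    have "real n * t \<ge> 0" using t by simp
    then have "heat_pair j (u 0) (s + real n * t) = 0"
      unfolding heat_pair_def using s n_pos by (subst zero[OF j]) (auto intro!: divide_pos_pos)
    then have "heat_pair j (u t) s = 0" using heat_pair_transport[OF t j s] by simp
    moreover have "(real n)\<^sup>2 / (4 * s) = p" using p n_pos by (simp add: s_def)
    ultimately show "gauss_pair j (u t) (of_real p) = 0" using s by (simp add: heat_pair_def)
  qed
qed

end
end

theorem theorem4p1:
  fixes n :: nat and k T C \<delta> :: real
    and u u' :: "real \<Rightarrow> real \<Rightarrow> complex"
  assumes "n \<ge> 1"
    and "k \<ge> (real n - 1) / (2 * real n)"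
    and "2 * k + 2 / real n - 2 > 0"
    and "T > 0"
    and "C1_W2 k n T u u'"
    and "\<forall>t\<in>{0..T}. AE x in mu_kn k n.
           complex_of_real (real n) * wlap k n (u t) x - u' t x = 0"
    and "memL k n 1 (u 0)"
    and "C > 0" and "\<delta> > 0"
    and "\<forall>x. norm (u T x) \<le> C * exp (- real n * \<delta> * \<bar>x\<bar> powr (2 / real n))"
    and "\<delta> \<ge> 1 / (4 * T)"
  shows "\<forall>t\<in>{0..T}. AE x in mu_kn k n. u t x = 0"
proof
  interpret kn_params k n by unfold_locales fact+
  fix t assume "t \<in> {0..T}"
  then show "AE x in mu_kn k n. u t x = 0"
    using assms by (intro gaussian_decay_imp_zero[of T u u' \<delta> C t]) (auto simp: rad_def)
qed

end
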